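(* Assume Hypothesis UL (stated in the context). Then as $x\to\infty$, \[ V_{\phi,\sigma}(x) \geq \frac{x}{(\log x)^{1+o(1)}}. \]
   Context: $\phi$ is Euler's totient function and $\sigma$ is the sum-of-divisors function, both on the positive integers. $V_{\phi,\sigma}(x)$ is the number of positive integers $v\le x$ that lie both in the image of $\phi$ and in the image of $\sigma$, i.e. such that there exist positive integers $n,m$ with $\phi(n)=v=\sigma(m)$. Hypothesis UL (an unproved hypothesis, a quantitative form of Dickson's prime $k$-tuples conjecture with uniformity in the coefficients) is the following statement. Suppose $a_1,\dots,a_h$ are positive integers and $b_1,\dots,b_h$ are integers such that $\prod_{1\le i<j\le h}(a_ib_j-a_jb_i)\ne 0$. Assume that for some constant $A>0$, we have \[ \max_{1\le i\le h}\{|a_i|,|b_i|\}\le x^A. \] Then for large $x$, depending on $A$ and $h$, the number of natural numbers $n\le x$ for which $a_in+b_i$ is prime for every $1\le i\le h$ is \[ \gg_{A,h} C\,\frac{x}{(\log x)^h}, \] where the implied positive constant depends only on $A$ and $h$. Here $C$ is the singular series associated to $\{a_in+b_i\}_{i=1}^h$, defined by \[ C:=\prod_{p}\frac{1-\nu(p)/p}{(1-1/p)^h},\qquad \nu(p):=\#\Big\{n \bmod p:\ \prod_{i=1}^h(a_in+b_i)\equiv 0 \pmod p\Big\}, \] the product being over all primes $p$. *)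

theory Defs
  imports "HOL-Analysis.Analysis" "HOL-Number_Theory.Number_Theory"
begin

definition divisor_sigma :: "nat \<Rightarrow> nat" where
  "divisor_sigma m = (\<Sum>d | d dvd m. d)"

definition V_phi_sigma :: "real \<Rightarrow> nat" where
  "V_phi_sigma x =
     card {v::nat. 0 < v \<and> real v \<le> x \<and>
             (\<exists>n>0. totient n = v) \<and> (\<exists>m>0. divisor_sigma m = v)}"

text \<open>A system of \<open>h\<close> linear forms \<open>a i * n + b i\<close> is given by \<open>a, b :: nat \<Rightarrow> int\<close>;
  only the values at the indices \<open>1, \<dots>, h\<close> matter.\<close>

definition forms_nu :: "nat \<Rightarrow> (nat \<Rightarrow> int) \<Rightarrow> (nat \<Rightarrow> int) \<Rightarrow> nat \<Rightarrow> nat" where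
  "forms_nu h a b p =
     card {n::int. 0 \<le> n \<and> n < int p \<and> [(\<Prod>i=1..h. a i * n + b i) = 0] (mod int p)}"

text \<open>The product over primes, taken in increasing order. If all \<open>a i\<close> are positive and the forms
  are pairwise non-proportional, then only finitely many primes \<open>p\<close> satisfy \<open>forms_nu h a b p \<noteq> h\<close>,
  so the product converges in the sense of \<open>has_prod\<close> (finitely many factors may be \<open>0\<close>).\<close>

definition singular_series :: "nat \<Rightarrow> (nat \<Rightarrow> int) \<Rightarrow> (nat \<Rightarrow> int) \<Rightarrow> real" where
  "singular_series h a b =
     (\<Prod>p. if prime p then (1 - real (forms_nu h a b p) / real p) / (1 - 1 / real p) ^ h else 1)"

text \<open>Primality of the integer \<open>a i * n + b i\<close> is understood up to sign. If negative primes were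
  excluded, the hypothesis below would be refuted by the single form \<open>n - b\<close> with \<open>b \<ge> x\<close>, which
  the size condition allows for \<open>A > 1\<close>. For forms that are nonnegative at all \<open>n \<ge> 1\<close>
  the sign plays no role.\<close>

definition prime_values_count :: "nat \<Rightarrow> (nat \<Rightarrow> int) \<Rightarrow> (nat \<Rightarrow> int) \<Rightarrow> real \<Rightarrow> nat" where
  "prime_values_count h a b x =
     card {n::nat. 0 < n \<and> real n \<le> x \<and> (\<forall>i\<in>{1..h}. prime \<bar>a i * int n + b i\<bar>)}"

text \<open>Both the implied constant \<open>c\<close> and the threshold hidden in \<open>\<forall>\<^sub>F x in at_top\<close>
  depend only on \<open>A\<close> and \<open>h\<close>; the coefficients may vary with \<open>x\<close>.\<close>

definition Hypothesis_UL :: bool where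
  "Hypothesis_UL \<longleftrightarrow>
     (\<forall>h::nat. \<forall>A::real. h \<ge> 1 \<longrightarrow> A > 0 \<longrightarrow>
        (\<exists>c>0. \<forall>\<^sub>F x in at_top. \<forall>a b.
           (\<forall>i\<in>{1..h}. a i > 0) \<longrightarrow>
           (\<Prod>(i, j)\<in>{(i, j). 1 \<le> i \<and> i < j \<and> j \<le> h}. a i * b j - a j * b i) \<noteq> 0 \<longrightarrow>
           (\<forall>i\<in>{1..h}. real_of_int \<bar>a i\<bar> \<le> x powr A \<and> real_of_int \<bar>b i\<bar> \<le> x powr A) \<longrightarrow>
           real (prime_values_count h a b x) \<ge> c * singular_series h a b * (x / ln x ^ h)))"

end

theory Submission
  imports Defs "HOL-Computational_Algebra.Squarefree" "HOL-Real_Asymp.Real_Asymp"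
begin

text \<open>
  Write \<open>L = ln (ln x)\<close> and fix \<open>0 < \<theta> < 1\<close>. We look for common values of the shape
  \<open>216 m n1 n2 n3 = \<phi>(p1 p2 p3) = \<sigma>(q1 q2 q3)\<close>, where \<open>m = a1 a2 a3 = b1 b2 b3\<close>, the \<open>n\<^sub>i\<close> are primes and
  \<open>p\<^sub>i = 6 a\<^sub>i n\<^sub>i + 1\<close>, \<open>q\<^sub>i = 6 b\<^sub>i n\<^sub>i - 1\<close>. Here \<open>n1\<close> and \<open>n2\<close> are powers of \<open>x\<close>, \<open>ln n3\<close> is about \<open>(ln x)\<close> to the
  power \<open>\<theta>\<close>, and \<open>m\<close> is squarefree with about \<open>2 (1 - \<theta>) L\<close> prime factors above the size of \<open>n3\<close>, which are
  divided between \<open>a1\<close> and \<open>a2\<close>, and about \<open>3 \<theta> L\<close> prime factors below it, which are divided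
  between all three. The primality of the \<open>p\<^sub>i\<close> costs a factor \<open>exp (-(2 + \<theta>) L)\<close>, and \<open>m\<close> has about
  \<open>exp ((2 (1 - \<theta>) ln 2 + 3 \<theta> ln 3) L)\<close> factorisations; \<open>\<theta>\<close> is chosen such that the two balance. Then the
  numbers \<open>m n1 n2 n3 \<le> x\<close> have \<open>exp (o(L))\<close> representations on average, and there are
  \<open>x exp (-(1 + o(1)) L)\<close> of them.

  Hypothesis UL bounds the first moment of the number of representations from below, separately for each \<open>m\<close>.
  Brun's sieve bounds the second moment from above up to a factor \<open>exp (o(L))\<close>: when two factorisations share a
  component, the choices that remain still do not outnumber the inverse of the probability that
  the remaining forms are prime. By Cauchy-Schwarz a proportion \<open>exp (- o(L))\<close> of the numbers
  \<open>m n1 n2 n3\<close> is represented. They determine \<open>m\<close> and the \<open>n\<^sub>i\<close>, because the primes come from disjoint ranges.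
\<close>

text \<open>Every \<open>a\<^sub>i\<close> and \<open>b\<^sub>i\<close> gets about as many prime
  factors as a typical integer of its size, namely \<open>L\<close>, \<open>L\<close> and
  \<open>\<theta> * L\<close>; this fixes the number of prime factors of \<open>m\<close> in the two
  ranges. Two components alone would not do: \<open>m\<close> would have about exp (2 ln 2 L)
  factorisations against a cost of exp (2 L), and 2 ln 2 < 2. Three components of full size would
  have exp (3 ln 3 L) against exp (3 L), more than enough, but integers with so many prime factors
  are too rare. In between, the reciprocals of the \<open>m\<close> sum to about exp (((2 - 2 ln 2)
  (1 - \<theta>) + (3 - 3 ln 3) \<theta>) L), and the balance says exactly that this exponent is 0.
  What remains is one factor 1 / ln x, for the primality of \<open>n1\<close>; the primality of
  \<open>n2\<close> and \<open>n3\<close> costs next to nothing, because their reciprocals are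
  summed over long logarithmic ranges. The coefficients of the forms may be as large as a power of
  x, so all bounds have to be uniform in them. Losing powers of \<open>L\<close> is affordable,
  which is why Brun's pure sieve suffices.\<close>

section \<open>Mertens' second theorem up to a constant\<close>

lemma prod_primes_dvd:
  fixes n :: nat
  assumes "finite S" "\<And>p. p \<in> S \<Longrightarrow> prime p" "\<And>p. p \<in> S \<Longrightarrow> p dvd n"
  shows "\<Prod>S dvd n"
  using assms
proof (induction S rule: finite_induct)
  case (insert p S)
  have "coprime p (\<Prod>S)"
    by (rule prod_coprime_right) (use insert in \<open>auto intro: primes_coprime\<close>)
  then show ?case
    using insert by (auto intro: divides_mult)
qed auto

lemma finite_primes_le [simp]: "finite {p. prime p \<and> p \<le> (n::nat)}"
  by (rule finite_subset[of _ "{..n}"]) auto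

text \<open>Erdos' induction: the primes in \<open>(m + 1, 2 m + 1]\<close> divide
  \<open>(2 m + 1) choose m\<close>, which is at most \<open>4 ^ m\<close> because it occurs twice
  among binomial coefficients of sum \<open>2 * 4 ^ m\<close>. The primes up to \<open>m + 1\<close>
  are left to the induction hypothesis.\<close>

lemma primorial_le: "\<Prod>{p. prime p \<and> p \<le> n} \<le> (4::nat) ^ n"
proof (induction n rule: less_induct)
  case (less n)
  consider "n \<le> 1" | "n = 2" | "n > 2" "even n" | "n > 2" "odd n" by linarith
  then show ?case
  proof cases
    case 1
    then have "{p. prime p \<and> p \<le> n} = {}"
      by (auto dest: prime_ge_2_nat)
    then show ?thesis by (simp only: prod.empty) simp
  next
    case 2
    have "{p::nat. prime p \<and> p \<le> 2} = {2}"
      by (auto dest: prime_ge_2_nat)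
    then show ?thesis using 2 by simp
  next
    case 3
    have "\<not> prime n" using 3 by (metis less_irrefl_nat primes_dvd_imp_eq two_is_prime_nat)
    then have "{p. prime p \<and> p \<le> n} = {p. prime p \<and> p \<le> n - 1}"
      using 3 by (auto simp: le_less) 
    moreover have "\<Prod>{p. prime p \<and> p \<le> n - 1} \<le> 4 ^ (n - 1)"
      using less[of "n - 1"] 3 by auto
    moreover have "(4::nat) ^ (n - 1) \<le> 4 ^ n" by (simp add: power_increasing)
    ultimately show ?thesis by (metis order_trans)
  next
    case 4
    then obtain m where m: "n = 2 * m + 1" "m \<ge> 1" by (auto elim!: oddE)
    define Q where "Q = {p. prime p \<and> m + 1 < p \<and> p \<le> n}"
    have fQ: "finite Q" unfolding Q_def by (rule finite_subset[of _ "{..n}"]) auto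
    have "\<Prod>Q dvd (2 * m + 1) choose m"
    proof (rule prod_primes_dvd[OF fQ])
      fix p assume "p \<in> Q"
      then have p: "prime p" "m + 1 < p" "p \<le> 2 * m + 1" by (auto simp: Q_def m)
      show "prime p" by fact
      have "fact m * fact (2 * m + 1 - m) * ((2 * m + 1) choose m) = (fact (2 * m + 1) :: nat)"
        by (rule binomial_fact_lemma) auto
      moreover have "p dvd fact (2 * m + 1)" using p prime_dvd_fact_iff by blast
      moreover have "2 * m + 1 - m = m + 1" by simp
      ultimately have "p dvd fact m * fact (m + 1) * ((2 * m + 1) choose m)"
        by metis
      moreover have "\<not> p dvd fact m" "\<not> p dvd fact (m + 1)"
        using p prime_dvd_fact_iff[of p m] prime_dvd_fact_iff[of p "m + 1"] by linarith+
      ultimately show "p dvd (2 * m + 1) choose m"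
        using p by (simp add: prime_dvd_mult_iff)
    qed
    then have "\<Prod>Q \<le> (2 * m + 1) choose m"
      by (auto intro: dvd_imp_le)
    also have "\<dots> \<le> (\<Sum>k\<le>m. (2 * m + 1) choose k)"
      by (rule member_le_sum) auto
    also have "\<dots> = 4 ^ m" by (simp only: binomial_r_part_sum power_mult) simp
    finally have *: "\<Prod>Q \<le> 4 ^ m" .
    have "{p. prime p \<and> p \<le> n} = {p. prime p \<and> p \<le> m + 1} \<union> Q"
      using m by (auto simp: Q_def)
    moreover have "{p. prime p \<and> p \<le> m + 1} \<inter> Q = {}" by (auto simp: Q_def)
    ultimately have "\<Prod>{p. prime p \<and> p \<le> n} = \<Prod>{p. prime p \<and> p \<le> m + 1} * \<Prod>Q"
      using fQ by (simp add: prod.union_disjoint)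
    also have "\<dots> \<le> 4 ^ (m + 1) * 4 ^ m"
      using less[of "m + 1"] m * by (intro mult_le_mono) auto
    also have "\<dots> = 4 ^ n" unfolding m by (simp flip: power_add)
    finally show ?thesis .
  qed
qed

lemma sum_ln_primes_le: "(\<Sum>p | prime p \<and> p \<le> n. ln (real p)) \<le> real n * ln 4"
proof -
  have "(\<Sum>p | prime p \<and> p \<le> n. ln (real p)) = ln (\<Prod>p | prime p \<and> p \<le> n. real p)"
    by (subst ln_prod) (auto dest: prime_gt_0_nat)
  also have "(\<Prod>p | prime p \<and> p \<le> n. real p) = real (\<Prod>{p. prime p \<and> p \<le> n})"
    by simp
  also have "ln \<dots> \<le> ln (real (4 ^ n))"
    by (subst ln_le_cancel_iff)
       (use primorial_le[of n] in \<open>auto simp del: of_nat_prod of_nat_power intro!: prod_pos dest: prime_gt_0_nat\<close>)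
  finally show ?thesis by (simp add: ln_realpow)
qed

text \<open>Count \<open>ln p\<close> over the pairs of a prime \<open>p\<close> and a multiple
  \<open>k \<le> n\<close>. For each \<open>k\<close> the primes dividing it contribute at most
  \<open>ln k\<close>, as their product divides \<open>k\<close>. Replacing \<open>n div p\<close>
  by \<open>n / p - 1\<close> costs the Chebyshev sum, at most \<open>n * ln 4\<close>.\<close>

lemma sum_ln_over_primes_le:
  "(\<Sum>p | prime p \<and> p \<le> n. ln (real p) / real p) \<le> ln (real n) + ln 4"
proof (cases "n = 0")
  case False
  let ?P = "{p. prime p \<and> p \<le> n}"
  have pr: "real p \<ge> 1" "ln (real p) \<ge> 0" if "prime p" for p :: nat
    using prime_gt_0_nat[OF that] by auto
  have "(\<Sum>p\<in>?P. real (n div p) * ln (real p)) = (\<Sum>p\<in>?P. \<Sum>k | k \<in> {1..n} \<and> p dvd k. ln (real p))"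
  proof (rule sum.cong)
    fix p assume "p \<in> ?P"
    then have p: "p > 0" using prime_gt_0_nat by auto
    have "{k. k \<in> {1..n} \<and> p dvd k} = (\<lambda>j. p * j) ` {1..n div p}"
    proof (rule equalityI; rule subsetI)
      fix k assume "k \<in> {k. k \<in> {1..n} \<and> p dvd k}"
      then obtain j where "k = p * j" "p * j \<le> n" "p * j \<ge> 1" by (auto elim!: dvdE)
      then show "k \<in> (\<lambda>j. p * j) ` {1..n div p}"
        using p by (auto simp: less_eq_div_iff_mult_less_eq mult.commute intro!: imageI)
    next
      fix k assume "k \<in> (\<lambda>j. p * j) ` {1..n div p}"
      then obtain j where j: "k = p * j" "1 \<le> j" "j \<le> n div p" by (elim imageE) auto
      then have "p * j \<le> n" using p by (simp add: less_eq_div_iff_mult_less_eq mult.commute)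
      then show "k \<in> {k. k \<in> {1..n} \<and> p dvd k}" using j p by auto
    qed
    moreover have "inj_on (\<lambda>j. p * j) {1..n div p}" using p by (auto intro!: inj_onI)
    ultimately have "card {k. k \<in> {1..n} \<and> p dvd k} = n div p"
      by (simp add: card_image)
    then show "real (n div p) * ln (real p) = (\<Sum>k | k \<in> {1..n} \<and> p dvd k. ln (real p))" by simp
  qed auto
  also have "\<dots> = (\<Sum>k\<in>{1..n}. \<Sum>p | p \<in> ?P \<and> p dvd k. ln (real p))"
    by (rule sum.swap_restrict) auto
  also have "\<dots> \<le> (\<Sum>k\<in>{1..n}. ln (real n))"
  proof (rule sum_mono)
    fix k assume k: "k \<in> {1..n}"
    let ?Q = "{p. p \<in> ?P \<and> p dvd k}"
    have "(\<Sum>p\<in>?Q. ln (real p)) = ln (real (\<Prod>?Q))"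
      by (simp, subst ln_prod) (auto dest: prime_gt_0_nat)
    also have "\<Prod>?Q dvd k" by (rule prod_primes_dvd) auto
    then have "\<Prod>?Q \<le> n" using k by (auto dest!: dvd_imp_le)
    then have "ln (real (\<Prod>?Q)) \<le> ln (real n)"
      using False by (subst ln_le_cancel_iff)
        (auto simp del: of_nat_prod intro!: prod_pos dest: prime_gt_0_nat)
    finally show "(\<Sum>p\<in>?Q. ln (real p)) \<le> ln (real n)" .
  qed
  finally have 1: "(\<Sum>p\<in>?P. real (n div p) * ln (real p)) \<le> real n * ln (real n)" by simp
  have "(\<Sum>p\<in>?P. (real n / real p - 1) * ln (real p)) \<le> (\<Sum>p\<in>?P. real (n div p) * ln (real p))"
  proof (intro sum_mono mult_right_mono)
    fix p assume "p \<in> ?P"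
    then have p: "prime p" by auto
    show "real n / real p - 1 \<le> real (n div p)"
      using floor_divide_of_nat_eq[of n p, where ?'a = real] by linarith
    show "0 \<le> ln (real p)" using pr p by auto
  qed
  moreover have "(\<Sum>p\<in>?P. (real n / real p - 1) * ln (real p))
      = real n * (\<Sum>p\<in>?P. ln (real p) / real p) - (\<Sum>p\<in>?P. ln (real p))"
    by (simp add: algebra_simps sum_subtractf sum_distrib_left)
  ultimately have "real n * (\<Sum>p\<in>?P. ln (real p) / real p) \<le> real n * (ln (real n) + ln 4)"
    using 1 sum_ln_primes_le[of n] by (simp add: algebra_simps)
  then show ?thesis using False by simp
qed (simp add: prime_gt_0_nat)

definition prime_recip_sum :: "nat \<Rightarrow> real" where
  "prime_recip_sum n = (\<Sum>p | prime p \<and> p \<le> n. 1 / real p)"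

lemma sum_primes_le_conv:
  fixes f :: "nat \<Rightarrow> real"
  shows "(\<Sum>p | prime p \<and> p \<le> n. f p) = (\<Sum>k\<le>n. if prime k then f k else 0)"
proof -
  have "(\<Sum>k\<le>n. if prime k then f k else 0) = sum f {k \<in> {..n}. prime k}"
    by (rule sum.inter_filter [symmetric]) simp
  also have "{k \<in> {..n}. prime k} = {p. prime p \<and> p \<le> n}" by auto
  finally show ?thesis by simp
qed

lemma ln_ln_step:
  assumes "n \<ge> (2::nat)"
  shows "(ln (real n + 1) - ln (real n)) / ln (real n + 1) \<le> ln (ln (real n + 1)) - ln (ln (real n))"
proof -
  have pos: "ln (real n) > 0" "ln (real n + 1) > 0" using assms by auto
  have "ln (ln (real n) / ln (real n + 1)) \<le> ln (real n) / ln (real n + 1) - 1"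
    using pos by (intro ln_le_minus_one) auto
  then show ?thesis using pos by (simp add: ln_div field_simps)
qed

lemma prime_recip_sum_upper:
  assumes "n \<ge> 2"
  shows "prime_recip_sum n \<le> ln (ln (real n)) + (1 + 2 * ln 4 / ln 2 - ln (ln 2))"
proof -
  define T where "T n = (\<Sum>p | prime p \<and> p \<le> n. ln (real p) / real p)" for n :: nat
  have T: "T n \<le> ln (real n) + ln 4" for n unfolding T_def by (rule sum_ln_over_primes_le)
  have T_Suc: "T (Suc n) = T n + (if prime (Suc n) then ln (real (Suc n)) / real (Suc n) else 0)" for n
    unfolding T_def sum_primes_le_conv by simp
  have S_Suc: "prime_recip_sum (Suc n) = prime_recip_sum n + (if prime (Suc n) then 1 / real (Suc n) else 0)" for n
    unfolding prime_recip_sum_def sum_primes_le_conv by simp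
  \<comment> \<open>Partial summation as an induction: a new prime \<open>n + 1\<close> adds
    \<open>1 / (n + 1)\<close> to both terms, so the difference moves only through the change of
    \<open>1 / ln n\<close>, weighted by \<open>T n\<close>. The right-hand side is the telescoped
    sum of the bounds for these changes.\<close>
  have "prime_recip_sum n - T n / ln (real n) \<le> ln (ln (real n)) - ln (ln 2) + ln 4 * (1 / ln 2 - 1 / ln (real n))"
    using assms
  proof (induction n rule: dec_induct)
    case base
    have "{p. prime p \<and> p \<le> (2::nat)} = {2}" by (auto dest: prime_ge_2_nat)
    then show ?case by (simp add: T_def prime_recip_sum_def)
  next
    case (step n)
    have pos: "ln (real n) > 0" "ln (real n + 1) > 0" using step by auto
    have le: "ln (real n) \<le> ln (real n + 1)" using step by auto
    have "prime_recip_sum (Suc n) - T (Suc n) / ln (real (Suc n))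
        = prime_recip_sum n - T n / ln (real n + 1)"
      using pos by (simp add: S_Suc T_Suc add_divide_distrib add.commute[of 1])
    also have "\<dots> = prime_recip_sum n - T n / ln (real n) + T n * (1 / ln (real n) - 1 / ln (real n + 1))"
      by (simp add: algebra_simps)
    also have "T n * (1 / ln (real n) - 1 / ln (real n + 1)) \<le> (ln (real n) + ln 4) * (1 / ln (real n) - 1 / ln (real n + 1))"
      using pos le by (intro mult_right_mono T) (simp add: frac_le)
    also have "\<dots> = (ln (real n + 1) - ln (real n)) / ln (real n + 1) + ln 4 * (1 / ln (real n) - 1 / ln (real n + 1))"
      using pos by (simp add: field_simps)
    finally show ?case using step ln_ln_step[of n]
      by (simp add: algebra_simps)
  qed
  moreover have "T n / ln (real n) \<le> 1 + ln 4 / ln (real n)"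
    using T[of n] assms by (simp add: field_simps)
  moreover have "ln 4 / ln (real n) \<le> ln 4 / ln 2" "ln 4 / ln (real n) \<ge> 0"
    using assms by (auto intro!: divide_left_mono)
  ultimately show ?thesis by (simp add: algebra_simps)
qed

text \<open>Factor each \<open>k \<le> n\<close> as a product of a squarefree number and a square.\<close>

lemma prime_recip_sum_lower:
  assumes "n \<ge> 2"
  shows "prime_recip_sum n \<ge> ln (ln (real n)) - ln 2"
proof -
  let ?P = "{p. prime p \<and> p \<le> n}"
  have sq: "(\<Sum>r\<in>{1..N}. 1 / real r ^ 2) \<le> 2 - 1 / real N" if "N \<ge> 1" for N
    using that
  proof (induction N rule: dec_induct)
    case (step N)
    have "1 / real (Suc N) ^ 2 \<le> 1 / real N - 1 / real (Suc N)"
    proof -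
      have "1 / real (Suc N) ^ 2 \<le> 1 / (real N * real (Suc N))"
        using step by (intro divide_left_mono) (auto simp: power2_eq_square)
      also have "\<dots> = 1 / real N - 1 / real (Suc N)"
        using step by (simp add: field_simps)
      finally show ?thesis .
    qed
    then show ?case using step by simp
  qed auto
  have "ln (real n) \<le> ln (real n + 1)" using assms by auto
  also have "\<dots> \<le> harm n" by (rule ln_le_harm)
  also have "harm n = (\<Sum>k\<in>{1..n}. 1 / real k)" by (simp add: harm_def inverse_eq_divide)
  also have "\<dots> \<le> (\<Sum>(I, r)\<in>Pow ?P \<times> {1..n}. (\<Prod>p\<in>I. 1 / real p) * (1 / real r ^ 2))"
  proof (rule sum_le_included[where i = "\<lambda>(I, r). \<Prod>I * r ^ 2"])
    show "\<forall>k\<in>{1..n}. \<exists>y\<in>Pow ?P \<times> {1..n}. (case y of (I, r) \<Rightarrow> \<Prod>I * r\<^sup>2) = k \<and>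
       1 / real k \<le> (case y of (I, r) \<Rightarrow> (\<Prod>p\<in>I. 1 / real p) * (1 / (real r)\<^sup>2))"
    proof
      fix k assume k: "k \<in> {1..n}"
      define I where "I = prime_factors (squarefree_part k)"
      define r where "r = square_part k"
      have kk: "squarefree_part k * r ^ 2 = k"
        unfolding r_def by (rule squarefree_decompose [symmetric])
      have "squarefree_part k dvd k" using kk by (metis dvd_triv_left)
      have sub: "I \<subseteq> ?P"
      proof
        fix p assume "p \<in> I"
        then have p: "prime p" "p dvd squarefree_part k"
          unfolding I_def by (simp_all add: in_prime_factors_iff)
        then have "p dvd k" using \<open>squarefree_part k dvd k\<close> dvd_trans by blast
        then have "p \<le> k" using k by (intro dvd_imp_le) auto
        then show "p \<in> ?P" using p k by simp
      qed
      have "\<Prod>I = (\<Prod>p\<in>I. p ^ multiplicity p (squarefree_part k))"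
      proof (rule prod.cong)
        fix p assume "p \<in> I"
        then have p: "prime p" "p dvd squarefree_part k" by (auto simp: I_def)
        then have "multiplicity p (squarefree_part k) > 0"
          by (simp add: prime_multiplicity_gt_zero_iff)
        moreover have "multiplicity p (squarefree_part k) \<le> Suc 0"
          using p by (intro prime_multiplicity_squarefree_part_le_Suc_0) auto
        ultimately show "p = p ^ multiplicity p (squarefree_part k)" 
          by (simp add: le_Suc_eq)
      qed auto
      also have "\<dots> = squarefree_part k"
        unfolding I_def by (subst prod_prime_factors) auto
      finally have I: "\<Prod>I = squarefree_part k" .
      have r: "r \<in> {1..n}"
      proof -
        have "r \<noteq> 0" using k kk by (intro notI) auto
        moreover have "r dvd k" using kk by (metis dvd_mult dvd_triv_left power2_eq_square)
        ultimately have "r \<le> k" "r > 0" using k by (auto dest: dvd_imp_le)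
        then show ?thesis using k by auto
      qed
      have "1 / real k = 1 / real (\<Prod>I * r ^ 2)" using kk I by simp
      also have "\<dots> = (\<Prod>p\<in>I. 1 / real p) * (1 / real r ^ 2)"
        by (simp add: prod_dividef)
      finally show "\<exists>y\<in>Pow ?P \<times> {1..n}. (case y of (I, r) \<Rightarrow> \<Prod>I * r\<^sup>2) = k \<and>
       1 / real k \<le> (case y of (I, r) \<Rightarrow> (\<Prod>p\<in>I. 1 / real p) * (1 / (real r)\<^sup>2))"
        using sub r kk I by (intro bexI[of _ "(I, r)"]) auto
    qed
  qed (auto intro!: divide_nonneg_nonneg prod_nonneg)
  also have "\<dots> = (\<Sum>I\<in>Pow ?P. \<Prod>p\<in>I. 1 / real p) * (\<Sum>r\<in>{1..n}. 1 / real r ^ 2)"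
    by (simp only: sum_product sum.cartesian_product)
  also have "(\<Sum>I\<in>Pow ?P. \<Prod>p\<in>I. 1 / real p) = (\<Prod>p\<in>?P. 1 / real p + 1)"
    by (subst prod_add) auto
  also have "(\<Prod>p\<in>?P. 1 / real p + 1) * (\<Sum>r\<in>{1..n}. 1 / real r ^ 2) \<le> exp (prime_recip_sum n) * 2"
  proof (rule mult_mono)
    have "(\<Prod>p\<in>?P. 1 / real p + 1) \<le> (\<Prod>p\<in>?P. exp (1 / real p))"
    proof (rule prod_mono)
      fix p assume "p \<in> ?P"
      show "0 \<le> 1 / real p + 1 \<and> 1 / real p + 1 \<le> exp (1 / real p)"
        using exp_ge_add_one_self[of "1 / real p"] by (simp only: add.commute) simp
    qed
    then show "(\<Prod>p\<in>?P. 1 / real p + 1) \<le> exp (prime_recip_sum n)"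
      by (simp add: prime_recip_sum_def exp_sum)
    show "(\<Sum>r\<in>{1..n}. 1 / real r ^ 2) \<le> 2"
      using sq[of n] assms by (smt (verit) divide_nonneg_nonneg of_nat_0_le_iff one_le_numeral order_trans)
  qed (auto intro!: sum_nonneg)
  finally have "ln (ln (real n)) \<le> ln (exp (prime_recip_sum n) * 2)"
    using assms by (subst ln_le_cancel_iff) auto
  then show ?thesis by (simp add: ln_mult)
qed

section \<open>Brun's pure sieve\<close>

text \<open>For \<open>- x\<close> with \<open>x\<close> an indicator, \<open>esum\<close> is
  inclusion-exclusion truncated at depth \<open>r\<close>; \<open>esym\<close> is the elementary
  symmetric polynomial of degree \<open>r\<close>. At reciprocals of primes, \<open>esym\<close>
  sums \<open>1 / m\<close> over the squarefree \<open>m\<close> with exactly \<open>r\<close> prime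
  factors, all from \<open>P\<close>.\<close>

definition esum :: "('a \<Rightarrow> real) \<Rightarrow> nat \<Rightarrow> 'a set \<Rightarrow> real" where
  "esum x r P = (\<Sum>I | I \<subseteq> P \<and> card I \<le> r. \<Prod>i\<in>I. x i)"

definition esym :: "('a \<Rightarrow> real) \<Rightarrow> nat \<Rightarrow> 'a set \<Rightarrow> real" where
  "esym x r P = (\<Sum>I | I \<subseteq> P \<and> card I = r. \<Prod>i\<in>I. x i)"

lemma esum_0:
  assumes "finite P"
  shows "esum x 0 P = 1"
proof -
  have "{I. I \<subseteq> P \<and> card I \<le> 0} = {{}}"
    using assms by (auto dest: finite_subset)
  then show ?thesis by (simp add: esum_def)
qed

lemma esym_0:
  assumes "finite P"
  shows "esym x 0 P = 1"
proof -
  have "{I. I \<subseteq> P \<and> card I = 0} = {{}}"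
    using assms by (auto dest: finite_subset)
  then show ?thesis by (simp add: esym_def)
qed

lemma esum_empty: "esum x r {} = 1"
proof -
  have *: "{I. I \<subseteq> {} \<and> card I \<le> r} = {{}}" by auto
  show ?thesis unfolding esum_def * by simp
qed

lemma esum_insert:
  assumes "finite P" "q \<notin> P"
  shows "esum x (Suc r) (insert q P) = esum x (Suc r) P + x q * esum x r P"
proof -
  let ?A = "{I. I \<subseteq> P \<and> card I \<le> Suc r}" and ?B = "{I. I \<subseteq> P \<and> card I \<le> r}"
  have fin: "finite ?A" "finite ?B"
    using assms(1) by (auto intro: finite_subset[of _ "Pow P"])
  have fI: "finite I" "q \<notin> I" if "I \<subseteq> P" for I
    using that assms finite_subset by auto
  have "{I. I \<subseteq> insert q P \<and> card I \<le> Suc r} = ?A \<union> insert q ` ?B"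
  proof (rule equalityI; rule subsetI)
    fix I assume I: "I \<in> {I. I \<subseteq> insert q P \<and> card I \<le> Suc r}"
    show "I \<in> ?A \<union> insert q ` ?B"
    proof (cases "q \<in> I")
      case True
      have "finite I" using I assms(1) finite_subset by auto
      then have "I = insert q (I - {q})" "I - {q} \<in> ?B"
        using True I by (auto simp: card_Diff_singleton)
      then show ?thesis by blast
    qed (use I in auto)
  next
    fix I assume "I \<in> ?A \<union> insert q ` ?B"
    then show "I \<in> {I. I \<subseteq> insert q P \<and> card I \<le> Suc r}"
      using fI by auto
  qed
  moreover have "?A \<inter> insert q ` ?B = {}" using assms by auto
  moreover have "inj_on (insert q) ?B"
    using assms by (auto intro!: inj_onI)
  ultimately have "esum x (Suc r) (insert q P)
      = (\<Sum>I\<in>?A. \<Prod>i\<in>I. x i) + (\<Sum>I\<in>?B. \<Prod>i\<in>insert q I. x i)"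
    unfolding esum_def using fin by (simp add: sum.union_disjoint sum.reindex)
  also have "(\<Sum>I\<in>?B. \<Prod>i\<in>insert q I. x i) = x q * (\<Sum>I\<in>?B. \<Prod>i\<in>I. x i)"
    unfolding sum_distrib_left by (rule sum.cong) (use fI in auto)
  finally show ?thesis by (simp add: esum_def)
qed

lemma esum_Suc:
  assumes "finite P"
  shows "esum x (Suc r) P = esum x r P + esym x (Suc r) P"
proof -
  have "{I. I \<subseteq> P \<and> card I \<le> Suc r} = {I. I \<subseteq> P \<and> card I \<le> r} \<union> {I. I \<subseteq> P \<and> card I = Suc r}"
    by auto
  moreover have "finite {I. I \<subseteq> P \<and> card I \<le> r}" "finite {I. I \<subseteq> P \<and> card I = Suc r}"
    using assms by (auto intro: finite_subset[of _ "Pow P"])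
  moreover have "{I. I \<subseteq> P \<and> card I \<le> r} \<inter> {I. I \<subseteq> P \<and> card I = Suc r} = {}" by auto
  ultimately show ?thesis unfolding esum_def esym_def by (simp add: sum.union_disjoint)
qed

text \<open>The values may lie anywhere in \<open>[0, 1]\<close> because the inequality is used
  twice: for indicators of residue classes and for the densities \<open>k / p\<close>. Adding an
  index \<open>q\<close> subtracts \<open>x q\<close> times the error at the previous depth; errors
  at consecutive depths have opposite signs, so the two contributions reinforce each other.\<close>

lemma bonferroni:
  assumes "finite P" "\<And>i. i \<in> P \<Longrightarrow> 0 \<le> x i \<and> x i \<le> 1"
  shows "(-1) ^ r * (esum (\<lambda>i. - x i) r P - (\<Prod>i\<in>P. 1 - x i)) \<ge> 0"
  using assms
proof (induction P arbitrary: r rule: finite_induct)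
  case empty
  then show ?case by (simp add: esum_empty)
next
  case (insert q P)
  show ?case
  proof (cases r)
    case 0
    have "(\<Prod>i\<in>insert q P. 1 - x i) \<le> 1"
      using insert by (intro prod_le_1) auto
    then show ?thesis using insert 0 by (simp add: esum_0)
  next
    case (Suc s)
    define R where "R = (\<Prod>i\<in>P. 1 - x i)"
    have "0 \<le> (-1) ^ Suc s * (esum (\<lambda>i. - x i) (Suc s) P - R)"
      "0 \<le> (-1) ^ s * (esum (\<lambda>i. - x i) s P - R)"
      using insert.IH[of "Suc s"] insert.IH[of s] insert.prems unfolding R_def by auto
    moreover have "0 \<le> x q" using insert.prems by auto
    ultimately have "0 \<le> (-1) ^ Suc s * (esum (\<lambda>i. - x i) (Suc s) P - R)
        + x q * ((-1) ^ s * (esum (\<lambda>i. - x i) s P - R))"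
      by (metis add_nonneg_nonneg mult_nonneg_nonneg)
    also have "\<dots> = (-1) ^ r * (esum (\<lambda>i. - x i) r (insert q P) - (\<Prod>i\<in>insert q P. 1 - x i))"
      using insert.hyps by (simp add: Suc esum_insert R_def [symmetric] algebra_simps)
    finally show ?thesis .
  qed
qed

text \<open>This is the accumulated rounding error of the sieve: a set \<open>I\<close> of primes
  involves \<open>k ^ card I\<close> residue classes, each counted with an error of at most
  1.\<close>

lemma esum_const_le:
  assumes "finite P" "k \<ge> 0"
  shows "esum (\<lambda>_. k) r P \<le> (1 + k * real (card P)) ^ r"
  using assms(1)
proof (induction P arbitrary: r rule: finite_induct)
  case empty
  then show ?case by (simp add: esum_empty)
next
  case (insert q P)
  show ?case
  proof (cases r)
    case (Suc s)
    define a where "a = 1 + k * real (card P)"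
    have a: "a \<ge> 0" using assms by (simp add: a_def)
    have "esum (\<lambda>_. k) r (insert q P) \<le> a ^ Suc s + k * a ^ s"
      unfolding Suc esum_insert[OF insert.hyps] a_def
      by (intro add_mono insert.IH mult_left_mono assms)
    also have "\<dots> = (a + k) * a ^ s" by (simp add: algebra_simps)
    also have "\<dots> \<le> (a + k) * (a + k) ^ s"
      using a assms by (intro mult_left_mono power_mono) auto
    finally show ?thesis using insert.hyps by (simp add: Suc a_def algebra_simps)
  qed (use insert in \<open>simp add: esum_0\<close>)
qed

text \<open>Double counting: an \<open>(r + 1)\<close>-set with a marked element is an
  \<open>r\<close>-set with a point outside it.\<close>

lemma esym_Suc:
  assumes "finite P"
  shows "real (Suc r) * esym x (Suc r) P
    = (\<Sum>I | I \<subseteq> P \<and> card I = r. (\<Prod>i\<in>I. x i) * (\<Sum>p\<in>P - I. x p))"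
proof -
  have fP: "finite I" if "I \<subseteq> P" for I using that assms finite_subset by auto
  have fin: "finite {I. I \<subseteq> P \<and> card I = s}" for s
    using assms by (auto intro: finite_subset[of _ "Pow P"])
  have "real (Suc r) * esym x (Suc r) P = (\<Sum>J | J \<subseteq> P \<and> card J = Suc r. \<Sum>p\<in>J. \<Prod>i\<in>J. x i)"
    unfolding esym_def sum_distrib_left by (rule sum.cong) auto
  also have "\<dots> = (\<Sum>(J, p)\<in>(SIGMA J:{J. J \<subseteq> P \<and> card J = Suc r}. J). \<Prod>i\<in>J. x i)"
    by (rule sum.Sigma) (use fP fin in auto)
  also have "\<dots> = (\<Sum>(I, p)\<in>(SIGMA I:{I. I \<subseteq> P \<and> card I = r}. P - I). (\<Prod>i\<in>I. x i) * x p)"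
    by (rule sum.reindex_bij_witness[where i = "\<lambda>(I, p). (insert p I, p)" and j = "\<lambda>(J, p). (J - {p}, p)"])
       (use fP in \<open>auto simp: card_Diff_singleton insert_absorb prod.remove mult.commute\<close>)
  also have "\<dots> = (\<Sum>I | I \<subseteq> P \<and> card I = r. \<Sum>p\<in>P - I. (\<Prod>i\<in>I. x i) * x p)"
    by (rule sum.Sigma [symmetric]) (use assms fin in auto)
  finally show ?thesis by (simp add: sum_distrib_left)
qed

lemma esym_upper:
  assumes "finite P" "\<And>i. i \<in> P \<Longrightarrow> 0 \<le> x i"
  shows "esym x r P \<le> sum x P ^ r / fact r"
proof (induction r)
  case (Suc r)
  have S: "sum x P \<ge> 0" using assms by (auto intro: sum_nonneg)
  have "real (Suc r) * esym x (Suc r) P \<le> (\<Sum>I | I \<subseteq> P \<and> card I = r. (\<Prod>i\<in>I. x i) * sum x P)"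
    unfolding esym_Suc[OF assms(1)]
    by (intro sum_mono mult_left_mono sum_mono2 prod_nonneg) (use assms in auto)
  also have "\<dots> = esym x r P * sum x P" by (simp add: esym_def sum_distrib_right)
  also have "\<dots> \<le> sum x P ^ r / fact r * sum x P" using Suc S by (intro mult_right_mono)
  finally have "esym x (Suc r) P \<le> sum x P ^ r / fact r * sum x P / real (Suc r)"
    by (subst pos_le_divide_eq) (simp_all add: mult.commute)
  also have "\<dots> = sum x P ^ Suc r / fact (Suc r)" by (simp add: mult.commute)
  finally show ?case .
qed (use assms in \<open>simp add: esym_0\<close>)

lemma esym_lower:
  assumes "finite P" "\<And>i. i \<in> P \<Longrightarrow> 0 \<le> x i" "\<And>i. i \<in> P \<Longrightarrow> x i \<le> e"
    and "T \<ge> 0" "\<And>s. s < r \<Longrightarrow> T \<le> sum x P - real s * e"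
  shows "esym x r P \<ge> T ^ r / fact r"
  using assms(5)
proof (induction r)
  case (Suc r)
  have "esym x r P * T = (\<Sum>I | I \<subseteq> P \<and> card I = r. (\<Prod>i\<in>I. x i) * T)"
    by (simp add: esym_def sum_distrib_right)
  also have "\<dots> \<le> (\<Sum>I | I \<subseteq> P \<and> card I = r. (\<Prod>i\<in>I. x i) * (\<Sum>p\<in>P - I. x p))"
  proof (intro sum_mono mult_left_mono prod_nonneg)
    fix I assume I: "I \<in> {I. I \<subseteq> P \<and> card I = r}"
    have "(\<Sum>p\<in>I. x p) \<le> real (card I) * e"
      using I assms(3) by (intro sum_bounded_above) auto
    moreover have "(\<Sum>p\<in>P - I. x p) = sum x P - sum x I"
      using I assms(1) by (intro sum_diff) auto
    ultimately show "T \<le> (\<Sum>p\<in>P - I. x p)" using I Suc.prems[of r] by auto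
  qed (use assms in auto)
  also have "\<dots> = real (Suc r) * esym x (Suc r) P" using esym_Suc[OF assms(1)] by simp
  finally have "esym x r P * T \<le> real (Suc r) * esym x (Suc r) P" .
  moreover have "T ^ r / fact r * T \<le> esym x r P * T"
    using Suc assms(4) by (intro mult_right_mono) auto
  ultimately have "T ^ r / fact r * T / real (Suc r) \<le> esym x (Suc r) P"
    by (subst pos_divide_le_eq) (simp_all add: mult.commute)
  moreover have "T ^ r / fact r * T / real (Suc r) = T ^ Suc r / fact (Suc r)" by (simp add: mult.commute)
  ultimately show ?case by metis
qed (use assms in \<open>simp add: esym_0\<close>)

section \<open>Counting integers in prescribed residue classes\<close>

lemma card_residue_class:
  fixes m Y r :: nat
  assumes "m > 0"
  shows "\<bar>real (card {n. n < Y \<and> n mod m = r mod m}) - real Y / real m\<bar> \<le> 1"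
proof -
  define s where "s = r mod m"
  have s: "s < m" using assms by (simp add: s_def)
  show ?thesis
  proof (cases "s < Y")
    case True
    define q where "q = (Y - 1 - s) div m"
    have "{n. n < Y \<and> n mod m = s} = (\<lambda>j. s + m * j) ` {..q}"
    proof (rule equalityI; rule subsetI)
      fix n assume n: "n \<in> {n. n < Y \<and> n mod m = s}"
      then have eq: "n = s + m * (n div m)" using mod_mult_div_eq[of n m] by auto
      have "n div m * m \<le> Y - 1 - s" using n eq by (subst mult.commute, unfold mem_Collect_eq) linarith
      then have "n div m \<le> q" using assms by (simp add: q_def less_eq_div_iff_mult_less_eq)
      then show "n \<in> (\<lambda>j. s + m * j) ` {..q}" using eq by blast
    next
      fix n assume "n \<in> (\<lambda>j. s + m * j) ` {..q}"
      then obtain j where j: "n = s + m * j" "j \<le> q" by (elim imageE) auto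
      then have "j * m \<le> Y - 1 - s" using assms by (simp add: q_def less_eq_div_iff_mult_less_eq)
      then show "n \<in> {n. n < Y \<and> n mod m = s}" using j True s by (auto simp: mult.commute)
    qed
    moreover have "inj_on (\<lambda>j. s + m * j) {..q}" using assms by (auto intro!: inj_onI)
    ultimately have c: "card {n. n < Y \<and> n mod m = s} = q + 1" by (simp add: card_image)
    have "q * m \<le> Y - 1 - s" "Y - 1 - s < (q + 1) * m"
      using assms by (auto simp: q_def dividend_less_div_times)
    then have "q * m \<le> Y" "Y \<le> (q + 1) * m + s" using True by linarith+
    then have "real (q * m) \<le> real Y" "real Y \<le> real ((q + 1) * m + s)"
      by (simp_all only: of_nat_le_iff)
    moreover have "real s \<le> real m" using s by simp
    ultimately have "real q \<le> real Y / real m" "real Y / real m \<le> real q + 2"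
      using assms by (simp_all add: field_simps)
    then show ?thesis unfolding s_def[symmetric] c by (simp add: abs_le_iff)
  next
    case False
    have "n mod m \<noteq> s" if "n < Y" for n
      using mod_less_eq_dividend[of n m] that False by linarith
    then have "{n. n < Y \<and> n mod m = s} = {}" by blast
    then have c: "card {n. n < Y \<and> n mod m = s} = 0" by (simp only: card.empty)
    have "real Y \<le> real m" using False s by simp
    then show ?thesis unfolding s_def[symmetric] c using assms by (simp add: field_simps)
  qed
qed

text \<open>The class \<open>r mod m\<close> is carried along so that the induction can absorb one
  prime of \<open>P\<close> at a time into the modulus, by the Chinese remainder theorem. In the end
  there are \<open>k ^ card P\<close> classes, each with an error of at most 1.\<close>

lemma card_residues_primes:
  fixes P :: "nat set" and \<rho> :: "nat \<Rightarrow> nat set"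
  assumes "finite P" "\<And>p. p \<in> P \<Longrightarrow> prime p" "\<And>p. p \<in> P \<Longrightarrow> \<rho> p \<subseteq> {..<p} \<and> card (\<rho> p) = k"
    and "m > 0" "\<And>p. p \<in> P \<Longrightarrow> coprime m p"
  shows "\<bar>real (card {n. n < Y \<and> n mod m = r mod m \<and> (\<forall>p\<in>P. n mod p \<in> \<rho> p)})
           - real Y / real m * (\<Prod>p\<in>P. real k / real p)\<bar> \<le> real k ^ card P"
  using assms
proof (induction P arbitrary: m r rule: finite_induct)
  case empty
  then show ?case using card_residue_class[of m Y r] by simp
next
  case (insert q P)
  have q: "prime q" "q > 0" "coprime m q" "\<rho> q \<subseteq> {..<q}" "card (\<rho> q) = k"
    using insert.prems(1-2,4)[of q] by (auto dest: prime_gt_0_nat)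
  then have fin: "finite (\<rho> q)" using finite_subset by blast
  have "\<exists>t. t mod m = r mod m \<and> t mod q = s" if "s \<in> \<rho> q" for s
  proof -
    obtain t where "[t = r] (mod m)" "[t = s] (mod q)"
      using binary_chinese_remainder_nat[of m q r s] q by auto
    moreover have "s mod q = s" using that q(4) by auto
    ultimately show ?thesis by (auto simp: cong_def)
  qed
  then obtain t where t: "\<And>s. s \<in> \<rho> q \<Longrightarrow> t s mod m = r mod m \<and> t s mod q = s" by metis
  define C where "C m r P = {n. n < Y \<and> n mod m = r mod m \<and> (\<forall>p\<in>P. n mod p \<in> \<rho> p)}" for m r P
  have finC: "finite (C m r P)" for m r P
    unfolding C_def by (rule finite_subset[of _ "{..<Y}"]) auto
  have eq: "C m r (insert q P) = (\<Union>s\<in>\<rho> q. C (m * q) (t s) P)"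
  proof (rule equalityI; rule subsetI)
    fix n assume n: "n \<in> C m r (insert q P)"
    then have s: "n mod q \<in> \<rho> q" by (simp add: C_def)
    then have "[n = t (n mod q)] (mod m)" "[n = t (n mod q)] (mod q)"
      using n t by (auto simp: C_def cong_def)
    then have "[n = t (n mod q)] (mod m * q)"
      using q(3) by (simp add: coprime_cong_mult_nat)
    then have "n \<in> C (m * q) (t (n mod q)) P" using n by (simp add: C_def cong_def)
    then show "n \<in> (\<Union>s\<in>\<rho> q. C (m * q) (t s) P)" using s by blast
  next
    fix n assume "n \<in> (\<Union>s\<in>\<rho> q. C (m * q) (t s) P)"
    then obtain s where s: "s \<in> \<rho> q" "n \<in> C (m * q) (t s) P" by blast
    then have "[n = t s] (mod m * q)" by (simp add: C_def cong_def)
    then have "[n = t s] (mod m)" "[n = t s] (mod q)"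
      using cong_modulus_mult_nat[of n "t s" m q] cong_modulus_mult_nat[of n "t s" q m]
      by (auto simp: mult.commute)
    then show "n \<in> C m r (insert q P)" using s t[of s] by (auto simp: C_def cong_def)
  qed
  have disj: "C (m * q) (t s) P \<inter> C (m * q) (t s') P = {}" if "s \<in> \<rho> q" "s' \<in> \<rho> q" "s \<noteq> s'" for s s'
  proof (rule ccontr)
    assume "C (m * q) (t s) P \<inter> C (m * q) (t s') P \<noteq> {}"
    then obtain n where "n mod (m * q) = t s mod (m * q)" "n mod (m * q) = t s' mod (m * q)"
      by (auto simp: C_def)
    then have "[t s = t s'] (mod q * m)" by (simp add: cong_def mult.commute)
    then have "[t s = t s'] (mod q)" by (rule cong_modulus_mult_nat)
    then show False using t that by (auto simp: cong_def)
  qed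
  have "real (card (C m r (insert q P))) = (\<Sum>s\<in>\<rho> q. real (card (C (m * q) (t s) P)))"
    unfolding eq using fin finC disj by (subst card_UN_disjoint) auto
  moreover have "real Y / real m * (\<Prod>p\<in>insert q P. real k / real p)
      = (\<Sum>s\<in>\<rho> q. real Y / real (m * q) * (\<Prod>p\<in>P. real k / real p))"
    using insert.hyps q by simp
  ultimately have "\<bar>real (card (C m r (insert q P))) - real Y / real m * (\<Prod>p\<in>insert q P. real k / real p)\<bar>
      = \<bar>\<Sum>s\<in>\<rho> q. (real (card (C (m * q) (t s) P)) - real Y / real (m * q) * (\<Prod>p\<in>P. real k / real p))\<bar>"
    by (simp only: sum_subtractf)
  also have "\<dots> \<le> (\<Sum>s\<in>\<rho> q. \<bar>real (card (C (m * q) (t s) P)) - real Y / real (m * q) * (\<Prod>p\<in>P. real k / real p)\<bar>)"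
    by (rule sum_abs)
  also have "\<dots> \<le> (\<Sum>s\<in>\<rho> q. real k ^ card P)"
  proof (rule sum_mono)
    fix s
    have "coprime (m * q) p" if "p \<in> P" for p
      using that insert.prems(1)[of p] insert.prems(4)[of p] insert.hyps q
      by (auto intro!: primes_coprime simp: coprime_mult_left_iff)
    then show "\<bar>real (card (C (m * q) (t s) P)) - real Y / real (m * q) * (\<Prod>p\<in>P. real k / real p)\<bar>
       \<le> real k ^ card P"
      unfolding C_def using insert.prems q by (intro insert.IH) auto
  qed
  also have "\<dots> = real k ^ card (insert q P)" using q insert.hyps by simp
  finally show ?case unfolding C_def .
qed

text \<open>The second term is the price of cutting inclusion-exclusion at depth
  \<open>2 * j\<close>, the third the rounding errors of the terms kept. Larger \<open>j\<close>
  shrinks one and inflates the other; they are balanced in \<open>sieve_forms_upper\<close>.\<close>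

theorem brun_sieve:
  fixes P :: "nat set" and \<rho> :: "nat \<Rightarrow> nat set"
  assumes P: "finite P" "\<And>p. p \<in> P \<Longrightarrow> prime p" "\<And>p. p \<in> P \<Longrightarrow> \<rho> p \<subseteq> {..<p} \<and> card (\<rho> p) = k"
  shows "real (card {n. n < Y \<and> (\<forall>p\<in>P. n mod p \<notin> \<rho> p)})
    \<le> real Y * (\<Prod>p\<in>P. 1 - real k / real p)
      + real Y * (real k * (\<Sum>p\<in>P. 1 / real p)) ^ (2 * j + 1) / fact (2 * j + 1)
      + (1 + real k * real (card P)) ^ (2 * j)"
proof -
  define x where "x n p = (if n mod p \<in> \<rho> p then 1 else 0 :: real)" for n p
  define y where "y p = real k / real p" for p :: nat
  define \<I> where "\<I> = {I. I \<subseteq> P \<and> card I \<le> 2 * j}"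
  define N where "N I = card {n. n < Y \<and> (\<forall>p\<in>I. n mod p \<in> \<rho> p)}" for I
  have y01: "0 \<le> y p \<and> y p \<le> 1" if "p \<in> P" for p
  proof -
    have "card (\<rho> p) \<le> card {..<p}" using P(3)[OF that] by (intro card_mono) auto
    then have "real k \<le> real p" using P(3)[OF that] by simp
    then show ?thesis using P(2)[OF that] prime_gt_0_nat by (auto simp: y_def field_simps)
  qed
  have finI: "finite I" if "I \<in> \<I>" for I using that P(1) finite_subset by (auto simp: \<I>_def)
  have "real (card {n. n < Y \<and> (\<forall>p\<in>P. n mod p \<notin> \<rho> p)}) = (\<Sum>n<Y. \<Prod>p\<in>P. 1 - x n p)"
  proof -
    have "(\<Prod>p\<in>P. 1 - x n p) = (if \<forall>p\<in>P. n mod p \<notin> \<rho> p then 1 else 0)" for n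
      using P(1) by (auto simp: x_def prod_zero_iff)
    then have "(\<Sum>n<Y. \<Prod>p\<in>P. 1 - x n p) = (\<Sum>n<Y. if \<forall>p\<in>P. n mod p \<notin> \<rho> p then 1 else 0)" by simp
    also have "\<dots> = (\<Sum>n\<in>{n \<in> {..<Y}. \<forall>p\<in>P. n mod p \<notin> \<rho> p}. 1)"
      by (rule sum.inter_filter [symmetric]) simp
    finally show ?thesis by simp
  qed
  also have "\<dots> \<le> (\<Sum>n<Y. esum (\<lambda>p. - x n p) (2 * j) P)"
  proof (rule sum_mono)
    fix n
    have "(-1) ^ (2 * j) * (esum (\<lambda>p. - x n p) (2 * j) P - (\<Prod>p\<in>P. 1 - x n p)) \<ge> 0"
      by (rule bonferroni) (use P in \<open>auto simp: x_def\<close>)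
    then show "(\<Prod>p\<in>P. 1 - x n p) \<le> esum (\<lambda>p. - x n p) (2 * j) P" by simp
  qed
  also have "\<dots> = (\<Sum>I\<in>\<I>. \<Sum>n<Y. \<Prod>p\<in>I. - x n p)"
    unfolding esum_def \<I>_def by (rule sum.swap)
  also have "\<dots> = (\<Sum>I\<in>\<I>. (-1) ^ card I * real (N I))"
  proof (rule sum.cong)
    fix I assume I: "I \<in> \<I>"
    have "(\<Prod>p\<in>I. - x n p) = (-1) ^ card I * (if \<forall>p\<in>I. n mod p \<in> \<rho> p then 1 else 0)" for n
      using finI[OF I] by (auto simp: x_def prod_uminus prod_zero_iff)
    then have "(\<Sum>n<Y. \<Prod>p\<in>I. - x n p) = (-1) ^ card I * (\<Sum>n<Y. if \<forall>p\<in>I. n mod p \<in> \<rho> p then 1 else 0)"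
      by (simp add: sum_distrib_left)
    also have "(\<Sum>n<Y. if \<forall>p\<in>I. n mod p \<in> \<rho> p then 1 else 0) = (\<Sum>n\<in>{n \<in> {..<Y}. \<forall>p\<in>I. n mod p \<in> \<rho> p}. 1 :: real)"
      by (rule sum.inter_filter [symmetric]) simp
    finally show "(\<Sum>n<Y. \<Prod>p\<in>I. - x n p) = (-1) ^ card I * real (N I)" by (simp add: N_def)
  qed auto
  also have "\<dots> \<le> (\<Sum>I\<in>\<I>. real Y * (\<Prod>p\<in>I. - y p) + real k ^ card I)"
  proof (rule sum_mono)
    fix I assume I: "I \<in> \<I>"
    have "\<bar>real (N I) - real Y * (\<Prod>p\<in>I. y p)\<bar> \<le> real k ^ card I"
      using card_residues_primes[of I \<rho> k 1 Y 0] I P finI[OF I]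
      by (auto simp: N_def y_def \<I>_def subset_eq)
    moreover have "(\<Prod>p\<in>I. - y p) = (-1) ^ card I * (\<Prod>p\<in>I. y p)" by (rule prod_uminus)
    moreover have "(-1) ^ card I = (1::real) \<or> (-1) ^ card I = (-1::real)"
      by (cases "even (card I)") auto
    ultimately show "(-1) ^ card I * real (N I) \<le> real Y * (\<Prod>p\<in>I. - y p) + real k ^ card I"
      by (elim disjE) (simp_all add: abs_le_iff)
  qed
  also have "\<dots> = real Y * esum (\<lambda>p. - y p) (2 * j) P + esum (\<lambda>_. real k) (2 * j) P"
    by (simp add: sum.distrib esum_def \<I>_def sum_distrib_left)
  \<comment> \<open>The even truncation lies above the full product. The next, odd depth lies below
    it, so the excess is at most the one term of degree \<open>2 * j + 1\<close> by which the two
    depths differ.\<close>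
  also have "esum (\<lambda>p. - y p) (2 * j) P = esum (\<lambda>p. - y p) (Suc (2 * j)) P + esym y (Suc (2 * j)) P"
  proof -
    have "esym (\<lambda>p. - y p) (Suc (2 * j)) P = - esym y (Suc (2 * j)) P"
      by (simp add: esym_def prod_uminus sum_negf)
    then show ?thesis using esum_Suc[OF P(1), of "\<lambda>p. - y p" "2 * j"] by simp
  qed
  also have "real Y * (esum (\<lambda>p. - y p) (Suc (2 * j)) P + esym y (Suc (2 * j)) P) + esum (\<lambda>_. real k) (2 * j) P
    \<le> real Y * ((\<Prod>p\<in>P. 1 - y p) + sum y P ^ (2 * j + 1) / fact (2 * j + 1)) + (1 + real k * real (card P)) ^ (2 * j)"
  proof (intro add_mono mult_left_mono esum_const_le P)
    have "(-1) ^ (Suc (2 * j)) * (esum (\<lambda>p. - y p) (Suc (2 * j)) P - (\<Prod>p\<in>P. 1 - y p)) \<ge> 0"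
      by (rule bonferroni) (use P y01 in auto)
    then show "esum (\<lambda>p. - y p) (Suc (2 * j)) P \<le> (\<Prod>p\<in>P. 1 - y p)" by simp
    show "esym y (Suc (2 * j)) P \<le> sum y P ^ (2 * j + 1) / fact (2 * j + 1)"
      using esym_upper[OF P(1), of y "Suc (2 * j)"] y01 by (simp del: power_Suc fact_Suc)
  qed auto
  finally show ?thesis
    by (simp add: y_def sum_distrib_left distrib_left del: power_Suc fact_Suc)
qed

section \<open>Linear forms and the singular series\<close>

definition form_roots :: "(int \<times> int) set \<Rightarrow> nat \<Rightarrow> nat set" where
  "form_roots FS p = {n. n < p \<and> (\<exists>(c, d)\<in>FS. int p dvd c * int n + d)}"

definition prime_forms :: "(int \<times> int) set \<Rightarrow> nat \<Rightarrow> bool" where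
  "prime_forms FS n \<longleftrightarrow> (\<forall>(c, d)\<in>FS. prime (c * int n + d))"

lemma card_form_root:
  assumes "prime p" "\<not> int p dvd c"
  shows "card (form_roots {(c, d)} p) = 1"
proof -
  have p: "p > 0" using assms prime_gt_0_nat by blast
  have cop: "coprime (int p) c" using assms by (intro prime_imp_coprime) auto
  then obtain e where e: "[c * e = 1] (mod int p)"
    using cong_solve_coprime_int[of c "int p"] by (auto simp: coprime_commute)
  define n where "n = nat ((- d * e) mod int p)"
  have n: "int n = (- d * e) mod int p" "n < p" using p by (auto simp: n_def nat_less_iff)
  have "[c * int n + d = c * (- d * e) + d] (mod int p)"
    unfolding n(1) by (intro cong_add cong_mult) auto
  also have "c * (- d * e) + d = - d * (c * e) + d" by simp
  also have "[- d * (c * e) + d = - d * 1 + d] (mod int p)"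
    by (intro cong_add cong_mult e) auto
  finally have "int p dvd c * int n + d" by (simp add: cong_0_iff)
  moreover have "m = n" if "m < p" "int p dvd c * int m + d" for m
  proof -
    have "int p dvd (c * int m + d) - (c * int n + d)"
      using that \<open>int p dvd c * int n + d\<close> by (intro dvd_diff)
    then have "int p dvd c * (int m - int n)" by (simp add: algebra_simps)
    then have "int p dvd int m - int n" using cop by (simp add: coprime_dvd_mult_right_iff)
    then have "[int m = int n] (mod int p)" by (simp add: cong_iff_dvd_diff)
    then have "[m = n] (mod p)" by (simp only: cong_int_iff)
    then show ?thesis using that n(2) cong_less_modulus_unique_nat by blast
  qed
  moreover have "form_roots {(c, d)} p = {m. m < p \<and> int p dvd c * int m + d}"
    by (simp add: form_roots_def)
  ultimately have "form_roots {(c, d)} p = {n}" using n(2) by blast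
  then show ?thesis by simp
qed

lemma finite_form_roots [simp]: "finite (form_roots FS p)"
  unfolding form_roots_def by (rule finite_subset[of _ "{..<p}"]) auto

lemma form_roots_UN: "form_roots FS p = (\<Union>f\<in>FS. form_roots {f} p)"
  by (auto simp: form_roots_def)

lemma card_form_roots_le:
  assumes "prime p" "finite FS" "\<And>c d. (c, d) \<in> FS \<Longrightarrow> coprime c d"
  shows "card (form_roots FS p) \<le> card FS"
proof -
  have "card (form_roots {f} p) \<le> 1" if f: "f \<in> FS" for f
  proof (cases "int p dvd fst f")
    case True
    have "\<not> int p dvd fst f * int n + snd f" for n
    proof
      assume "int p dvd fst f * int n + snd f"
      then have "int p dvd snd f" using True by (simp add: dvd_add_right_iff)
      moreover have "coprime (fst f) (snd f)" using assms(3) f by simp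
      ultimately have "int p dvd 1" using True coprime_common_divisor by blast
      then show False using prime_gt_1_nat[OF assms(1)] by simp
    qed
    then have "form_roots {f} p = {}" by (auto simp: form_roots_def split: prod.splits)
    then show ?thesis by simp
  next
    case False
    then show ?thesis using card_form_root[OF assms(1), of "fst f" "snd f"] by simp
  qed
  then have "(\<Sum>f\<in>FS. card (form_roots {f} p)) \<le> (\<Sum>f\<in>FS. 1)" by (intro sum_mono)
  moreover have "card (form_roots FS p) \<le> (\<Sum>f\<in>FS. card (form_roots {f} p))"
    by (subst form_roots_UN) (rule card_UN_le[OF assms(2)])
  ultimately show ?thesis by simp
qed

lemma card_form_roots_eq:
  assumes "prime p" "finite FS" "\<And>c d. (c, d) \<in> FS \<Longrightarrow> \<not> int p dvd c"
    and "\<And>c d c' d'. (c, d) \<in> FS \<Longrightarrow> (c', d') \<in> FS \<Longrightarrow> (c, d) \<noteq> (c', d') \<Longrightarrow> \<not> int p dvd c * d' - c' * d"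
  shows "card (form_roots FS p) = card FS"
proof -
  have "card (form_roots FS p) = (\<Sum>f\<in>FS. card (form_roots {f} p))"
    unfolding form_roots_UN[of FS]
  proof (rule card_UN_disjoint)
    show "\<forall>f\<in>FS. \<forall>g\<in>FS. f \<noteq> g \<longrightarrow> form_roots {f} p \<inter> form_roots {g} p = {}"
    proof (intro ballI impI equals0I)
      fix f g n assume fg: "f \<in> FS" "g \<in> FS" "f \<noteq> g" and n: "n \<in> form_roots {f} p \<inter> form_roots {g} p"
      obtain c d c' d' where [simp]: "f = (c, d)" "g = (c', d')" by (metis surj_pair)
      have "int p dvd c * (c' * int n + d') - c' * (c * int n + d)"
        using n by (intro dvd_diff dvd_mult) (auto simp: form_roots_def)
      also have "\<dots> = c * d' - c' * d" by (simp add: algebra_simps)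
      finally show False using assms(4) fg by auto
    qed
  qed (use assms in auto)
  also have "\<dots> = (\<Sum>f\<in>FS. 1)"
    using card_form_root[OF assms(1)] assms(3) by (intro sum.cong) (auto split: prod.splits)
  finally show ?thesis by simp
qed

abbreviation prime_forms_le :: "(int \<times> int) set \<Rightarrow> real \<Rightarrow> nat set" where
  "prime_forms_le FS t \<equiv> {n. 0 < n \<and> real n \<le> t \<and> prime_forms FS n}"

text \<open>The factor 6 makes \<open>6 a n + 1\<close> and \<open>6 b n - 1\<close> coprime to 6,
  so that modulo 2 and 3 only the form \<open>n\<close> has a root. This rules out a local
  obstruction for every choice of \<open>a\<close> and \<open>b\<close>.\<close>

definition pair_forms :: "nat \<Rightarrow> nat \<Rightarrow> (int \<times> int) set" where
  "pair_forms a b = {(1, 0), (6 * int a, 1), (6 * int b, -1)}"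

text \<open>The worst case is \<open>\<nu> = 3\<close>. There
  \<open>(1 + 3 t) (1 - t)^3 \<le> 1\<close> with \<open>t = 1 / p\<close> gives the lower bound
  \<open>(1 - 3 t) (1 + 3 t)\<close>, a form chosen because its product over all integers
  telescopes.\<close>

lemma singular_factor_lower:
  assumes "p \<ge> 5" "\<nu> \<le> 3"
  shows "(1 - real \<nu> / real p) / (1 - 1 / real p) ^ 3 \<ge> 1 - 9 / real p ^ 2"
proof -
  define t where "t = 1 / real p"
  have t: "0 < t" "t \<le> 1/5" using assms by (auto simp: t_def field_simps)
  have "(1 - 3 * t) / (1 - t) ^ 3 \<ge> (1 - 3 * t) * (1 + 3 * t)"
  proof -
    have "(1 + 3 * t) * (1 - t) ^ 3 = 1 - t^2 * (6 - 8 * t + 3 * t^2)"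
      by (simp add: power2_eq_square power3_eq_cube algebra_simps)
    moreover have "t^2 * (6 - 8 * t + 3 * t^2) \<ge> 0" using t by (intro mult_nonneg_nonneg) auto
    ultimately have "(1 + 3 * t) * (1 - t) ^ 3 \<le> 1" by linarith
    then have "(1 + 3 * t) \<le> 1 / (1 - t) ^ 3" using t by (simp add: field_simps)
    then have "(1 - 3 * t) * (1 + 3 * t) \<le> (1 - 3 * t) * (1 / (1 - t) ^ 3)" using t by (intro mult_left_mono) auto
    then show ?thesis by simp
  qed
  moreover have "(1 - real \<nu> * t) / (1 - t) ^ 3 \<ge> (1 - 3 * t) / (1 - t) ^ 3"
    using t assms by (intro divide_right_mono) auto
  moreover have "(1 - 3 * t) * (1 + 3 * t) = 1 - 9 * t ^ 2"
    by (simp add: power2_eq_square algebra_simps)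
  ultimately show ?thesis by (simp add: t_def power_divide)
qed

text \<open>Serves the convergence of the singular series: where the three forms have three distinct
  roots, the factor differs from 1 by \<open>O(1 / p^2)\<close>.\<close>

lemma singular_factor_close:
  assumes "p \<ge> (5::nat)"
  shows "\<bar>(1 - 3 / real p) / (1 - 1 / real p) ^ 3 - 1\<bar> \<le> 24 * (1 / real p ^ 2)"
proof -
  define t where "t = 1 / real p"
  have t: "0 < t" "t \<le> 1/5" using assms by (auto simp: t_def field_simps)
  have "(1 - t) ^ 3 \<ge> (1/2) ^ 3" using t by (intro power_mono) auto
  then have d: "(1 - t) ^ 3 \<ge> 1/8" by (simp add: power3_eq_cube)
  have "(1 - 3 * t) / (1 - t) ^ 3 - 1 = - (t ^ 2 * (3 - t) / (1 - t) ^ 3)"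
  proof -
    have "1 - 3 * t - (1 - t) ^ 3 = - (t ^ 2 * (3 - t))"
      by (simp add: power2_eq_square power3_eq_cube algebra_simps)
    moreover have "(1 - 3 * t) / (1 - t) ^ 3 - 1 = (1 - 3 * t - (1 - t) ^ 3) / (1 - t) ^ 3"
    proof -
      have "(1 - t) ^ 3 \<noteq> 0" using d by linarith
      then show ?thesis by (simp add: diff_divide_distrib)
    qed
    ultimately show ?thesis by simp
  qed
  moreover have "t ^ 2 * (3 - t) / (1 - t) ^ 3 \<ge> 0" using t by auto
  moreover have "t ^ 2 * (3 - t) / (1 - t) ^ 3 \<le> t ^ 2 * 3 / (1 / 8)"
    using t d by (intro frac_le mult_left_mono mult_nonneg_nonneg) auto
  ultimately have "\<bar>(1 - 3 * t) / (1 - t) ^ 3 - 1\<bar> \<le> 24 * t ^ 2" by simp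
  then show ?thesis by (simp add: t_def power_divide)
qed

text \<open>Since \<open>1 - 9 / k^2 = (k - 3) (k + 3) / k^2\<close>, the partial products have a
  closed form that decreases to 4 / 35. Taking all \<open>k\<close> instead of the primes only makes
  the product smaller.\<close>

lemma telescoping_product:
  assumes "N \<ge> (5::nat)"
  shows "(\<Prod>k=5..<N. 1 - 9 / real k ^ 2) \<ge> 4 / 35"
proof -
  have "(\<Prod>k=5..<N. 1 - 9 / real k ^ 2) = 4 / 35 * (real N * (real N + 1) * (real N + 2)) / ((real N - 1) * (real N - 2) * (real N - 3))"
    using assms
  proof (induction N rule: dec_induct)
    case (step N)
    define n where "n = real N"
    have n: "n \<ge> 5" using step by (simp add: n_def)
    have "(\<Prod>k=5..<Suc N. 1 - 9 / real k ^ 2)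
        = 4 / 35 * (n * (n + 1) * (n + 2)) / ((n - 1) * (n - 2) * (n - 3)) * (1 - 9 / n ^ 2)"
      using step by (simp add: n_def)
    also have "1 - 9 / n ^ 2 = (n - 3) * (n + 3) / (n * n)"
      using n by (simp add: field_simps power2_eq_square)
    also have "4 / 35 * (n * (n + 1) * (n + 2)) / ((n - 1) * (n - 2) * (n - 3)) * ((n - 3) * (n + 3) / (n * n))
        = 4 / 35 * ((n + 1) * (n + 2) * (n + 3)) / (n * (n - 1) * (n - 2))"
      using n by (simp add: divide_simps)
    finally show ?case by (simp add: n_def algebra_simps)
  qed simp
  also have "\<dots> \<ge> 4 / 35 * 1"
  proof -
    define n where "n = real N"
    have n: "n \<ge> 5" using assms by (simp add: n_def)
    have "(n - 1) * (n - 2) * (n - 3) \<le> n * (n + 1) * (n + 2)"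
      using n by (intro mult_mono) auto
    moreover have "(n - 1) * (n - 2) * (n - 3) > 0" using n by auto
    ultimately have "1 \<le> (n * (n + 1) * (n + 2)) / ((n - 1) * (n - 2) * (n - 3))"
      by (simp only: le_divide_eq_1_pos)
    then show ?thesis unfolding n_def by (metis mult_left_mono times_divide_eq_right zero_le_divide_iff zero_le_numeral)
  qed
  finally show ?thesis by simp
qed

text \<open>A prime above 3 that divides \<open>a\<close>, \<open>b\<close> or \<open>a + b\<close>
  leaves fewer than three roots, which only increases its factor; hence a bound independent of
  \<open>a\<close> and \<open>b\<close>. The primes 2 and 3 contribute
  \<open>4 * (9 / 4) = 9\<close>, which is estimated by 1.\<close>

lemma singular_series_lower:
  fixes a b :: nat
  assumes ab: "a > 0" "b > 0"
    and f: "f = (\<lambda>i::nat. if i = 1 then 1 else if i = 2 then 6 * int a else 6 * int b)"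
    and g: "g = (\<lambda>i::nat. if i = 1 then 0 else if i = 2 then 1 else - 1)"
  shows "singular_series 3 f g \<ge> 4 / 35"
proof -
  define F where "F p = (if prime p then (1 - real (forms_nu 3 f g p) / real p) / (1 - 1 / real p) ^ 3 else 1)" for p
  have i13: "{1..3::nat} = {1, 2, 3}" by auto
  have nu: "forms_nu 3 f g p = card (form_roots (pair_forms a b) p)" if "prime p" for p
  proof -
    have *: "[(\<Prod>i=1..3. f i * n + g i) = 0] (mod int p) \<longleftrightarrow> (\<exists>(c, d)\<in>pair_forms a b. int p dvd c * n + d)" for n
      using that unfolding i13
      by (simp add: f g pair_forms_def cong_0_iff prime_dvd_mult_iff)
    have "{n::int. 0 \<le> n \<and> n < int p \<and> [(\<Prod>i=1..3. f i * n + g i) = 0] (mod int p)}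
        = int ` form_roots (pair_forms a b) p"
      unfolding * form_roots_def
    proof (rule equalityI; rule subsetI)
      fix n assume "n \<in> {n. 0 \<le> n \<and> n < int p \<and> (\<exists>(c, d)\<in>pair_forms a b. int p dvd c * n + d)}"
      then show "n \<in> int ` {n. n < p \<and> (\<exists>(c, d)\<in>pair_forms a b. int p dvd c * int n + d)}"
        by (intro image_eqI[of _ _ "nat n"]) auto
    qed auto
    then show ?thesis unfolding forms_nu_def by (simp add: card_image)
  qed
  have fin: "finite (pair_forms a b)" and card: "card (pair_forms a b) = 3"
    using ab by (auto simp: pair_forms_def)
  have nu_le: "forms_nu 3 f g p \<le> 3" if "prime p" for p
    using card_form_roots_le[OF that fin] nu[OF that] card by (fastforce simp: pair_forms_def)
  have F5: "F p \<ge> 1 - 9 / real p ^ 2" if "p \<ge> 5" for p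
    using that singular_factor_lower[OF that nu_le] by (auto simp: F_def)
  have small: "form_roots (pair_forms a b) p = {0}" if "p = 2 \<or> p = 3" for p
  proof -
    have "\<not> 2 dvd 6 * k + 1 \<and> \<not> 3 dvd 6 * k + 1 \<and> \<not> 2 dvd 6 * k - 1 \<and> \<not> 3 dvd 6 * k - 1" for k :: int
      by presburger
    then have "\<not> int p dvd 6 * (int a * int n) + 1 \<and> \<not> int p dvd 6 * (int b * int n) + - 1" for n
      using that by auto
    then have "form_roots (pair_forms a b) p = {n. n < p \<and> p dvd n}"
      by (simp add: form_roots_def pair_forms_def mult.assoc)
    also have "\<dots> = {0}" using that by (auto dest: dvd_imp_le)
    finally show ?thesis .
  qed
  have "F 2 = 4" using nu[of 2] small[of 2] by (simp add: F_def power3_eq_cube)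
  moreover have "F 3 = 9/4" using nu[of 3] small[of 3] by (simp add: F_def power3_eq_cube)
  moreover have "\<not> prime (4::nat)" by simp
  ultimately have init: "(\<Prod>k<5. F k) = 9"
    by (simp add: lessThan_Suc numeral_eq_Suc F_def)
  have pos: "1 - 9 / real k ^ 2 > 0" if "k \<ge> 5" for k :: nat
  proof -
    have "5 ^ 2 \<le> real k ^ 2" using that by (intro power_mono) auto
    moreover have "9 / real k ^ 2 < 1" if "25 \<le> real k ^ 2"
      using that by (subst pos_divide_less_eq) linarith+
    ultimately show ?thesis by simp
  qed
  have part: "(\<Prod>k<N. F k) \<ge> 4 / 35" if "N \<ge> 5" for N
  proof -
    have "(\<Prod>k<N. F k) = (\<Prod>k<5. F k) * (\<Prod>k=5..<N. F k)"
      using that by (subst prod.union_disjoint [symmetric]) (auto intro: prod.cong)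
    also have "\<dots> \<ge> 1 * (\<Prod>k=5..<N. 1 - 9 / real k ^ 2)"
      unfolding init using F5 pos
      by (intro mult_mono prod_mono prod_nonneg) (auto intro: less_imp_le order_trans)
    finally show ?thesis using telescoping_product[OF that] by simp
  qed
  \<comment> \<open>From \<open>B\<close> on no prime divides a leading coefficient or a determinant
    of two of the forms, so there are three distinct roots and the factors are close to 1.\<close>
  define B where "B = 36 * a * b * (a + b) + 5"
  have big: "forms_nu 3 f g p = 3" if "prime p" "p \<ge> B" for p
  proof -
    have nd: "\<not> int p dvd int m" if "0 < m" "m \<le> 36 * a * b * (a + b)" for m
      using that \<open>p \<ge> B\<close> by (auto simp: B_def dest!: dvd_imp_le)
    have n: "a * b * (a + b) > 0" using ab by simp
    have le: "6 * a \<le> 36 * a * b * (a + b)" "6 * b \<le> 36 * a * b * (a + b)" "6 * a + 6 * b \<le> 36 * a * b * (a + b)"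
    proof -
      define D where "D = (a * b) * (a + b)"
      have "1 * (a + b) \<le> D" unfolding D_def using ab by (intro mult_le_mono1) simp
      moreover have eq: "36 * a * b * (a + b) = 36 * D" by (simp add: D_def)
      ultimately show "6 * a \<le> 36 * a * b * (a + b)" "6 * b \<le> 36 * a * b * (a + b)"
        "6 * a + 6 * b \<le> 36 * a * b * (a + b)"
        unfolding eq by simp_all
    qed
    have 1: "\<not> int p dvd 1" using nd[of 1] n by simp
    have "\<not> int p dvd 6 * int a" "\<not> int p dvd 6 * int b" "\<not> int p dvd 6 * int a + 6 * int b"
      using nd[of "6 * a"] nd[of "6 * b"] nd[of "6 * a + 6 * b"] le ab by auto
    moreover from this(3) have "\<not> int p dvd - (6 * int a) - 6 * int b"
      by (metis dvd_minus_iff minus_add_distrib uminus_add_conv_diff add.commute)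
    moreover from calculation(3) have "\<not> int p dvd 6 * int b + 6 * int a"
      by (metis add.commute)
    ultimately have "card (form_roots (pair_forms a b) p) = card (pair_forms a b)"
      using 1 by (intro card_form_roots_eq[OF that(1) fin]) (auto simp: pair_forms_def)
    then show ?thesis using nu[OF that(1)] card by simp
  qed
  have "summable (\<lambda>p. 24 * (1 / real p ^ 2))"
    by (intro summable_mult inverse_power_summable[of 2, where ?'a = real, simplified inverse_eq_divide]) simp
  then have "summable (\<lambda>p. norm (F p - 1))"
  proof (rule summable_comparison_test_ev[rotated])
    show "\<forall>\<^sub>F p in sequentially. norm (norm (F p - 1)) \<le> 24 * (1 / real p ^ 2)"
      using eventually_ge_at_top[of B]
    proof eventually_elim
      case (elim p)
      then show ?case
        using big[of p] singular_factor_close[of p] by (auto simp: F_def B_def)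
    qed
  qed
  then have conv: "convergent_prod F"
    by (intro abs_convergent_prod_imp_convergent_prod summable_imp_abs_convergent_prod)
  then have "(\<lambda>n. \<Prod>i\<le>n. F i) \<longlonglongrightarrow> prodinf F" by (rule convergent_prod_LIMSEQ)
  then have "4 / 35 \<le> prodinf F"
  proof (rule tendsto_lowerbound)
    show "\<forall>\<^sub>F n in sequentially. 4 / 35 \<le> (\<Prod>i\<le>n. F i)"
      by (rule eventually_sequentiallyI[of 5]) (simp only: lessThan_Suc_atMost [symmetric] part)
  qed simp
  also have "prodinf F = singular_series 3 f g"
    unfolding singular_series_def by (rule prodinf_cong) (simp add: F_def)
  finally show ?thesis .
qed

lemma UL_pair_lower:
  assumes UL: Hypothesis_UL and A: "A > 0"
  shows "\<exists>c>0. \<forall>\<^sub>F Y in at_top. \<forall>a b. a > 0 \<longrightarrow> b > 0 \<longrightarrow> 6 * real a \<le> Y powr A \<longrightarrow> 6 * real b \<le> Y powr A \<longrightarrow>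
     real (card (prime_forms_le (pair_forms a b) Y)) \<ge> c * (Y / ln Y ^ 3)"
proof -
  define f where "f a b = (\<lambda>i::nat. if i = 1 then 1 else if i = 2 then 6 * int a else 6 * int b)" for a b
  define g where "g = (\<lambda>i::nat. if i = 1 then 0 else if i = 2 then 1 else - 1 :: int)"
  have i13: "{1..3::nat} = {1, 2, 3}" by auto
  have "{(i::nat, j). 1 \<le> i \<and> i < j \<and> j \<le> 3} = {(1, 2), (1, 3), (2, 3)}"
    by auto
  note pairs = this
  obtain c where c: "c > 0" and ev: "\<forall>\<^sub>F x in at_top. \<forall>a b.
           (\<forall>i\<in>{1..3}. a i > 0) \<longrightarrow>
           (\<Prod>(i, j)\<in>{(i, j). 1 \<le> i \<and> i < j \<and> j \<le> 3}. a i * b j - a j * b i) \<noteq> 0 \<longrightarrow>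
           (\<forall>i\<in>{1..3}. real_of_int \<bar>a i\<bar> \<le> x powr A \<and> real_of_int \<bar>b i\<bar> \<le> x powr A) \<longrightarrow>
           real (prime_values_count 3 a b x) \<ge> c * singular_series 3 a b * (x / ln x ^ 3)"
    using UL[unfolded Hypothesis_UL_def, THEN spec, of 3, THEN spec, of A,
        THEN mp, OF one_le_numeral, THEN mp, OF A] by (elim exE conjE) (rule that)
  show ?thesis
  proof (intro exI[of _ "c * (4 / 35)"] conjI)
    show "\<forall>\<^sub>F Y in at_top. \<forall>a b. a > 0 \<longrightarrow> b > 0 \<longrightarrow> 6 * real a \<le> Y powr A \<longrightarrow> 6 * real b \<le> Y powr A \<longrightarrow>
     real (card (prime_forms_le (pair_forms a b) Y)) \<ge> c * (4 / 35) * (Y / ln Y ^ 3)"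
      using ev eventually_gt_at_top[of 1]
    proof eventually_elim
      case (elim Y)
      show ?case
      proof (intro allI impI)
        fix a b assume ab: "a > 0" "b > 0" "6 * real a \<le> Y powr A" "6 * real b \<le> Y powr A"
        have Y1: "Y powr A \<ge> 1" using ab by linarith
        have "real (prime_values_count 3 (f a b) g Y) \<ge> c * singular_series 3 (f a b) g * (Y / ln Y ^ 3)"
        proof (intro elim(1)[rule_format])
          show "(\<Prod>(i, j)\<in>{(i, j). 1 \<le> i \<and> i < j \<and> j \<le> 3}. f a b i * g j - f a b j * g i) \<noteq> 0"
            unfolding pairs using ab by (simp add: f_def g_def)
        qed (use ab Y1 in \<open>auto simp: f_def g_def\<close>)
        moreover have "c * (4 / 35) * (Y / ln Y ^ 3) \<le> c * singular_series 3 (f a b) g * (Y / ln Y ^ 3)"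
          using c elim(2) singular_series_lower[OF ab(1,2) f_def[of a b] g_def]
          by (intro mult_right_mono mult_left_mono) auto
        \<comment> \<open>\<open>Hypothesis_UL\<close> takes primality up to sign; for
          \<open>n > 0\<close> all three forms are positive, so the absolute values
          disappear.\<close>
        moreover have "prime_values_count 3 (f a b) g Y = card (prime_forms_le (pair_forms a b) Y)"
        proof -
          have "(\<forall>i\<in>{1..3}. prime \<bar>f a b i * int n + g i\<bar>) \<longleftrightarrow> prime_forms (pair_forms a b) n" if "n > 0" for n
          proof -
            have "0 < int a * int n" "0 < int b * int n" using that ab by auto
            then show ?thesis unfolding i13 by (simp add: f_def g_def prime_forms_def pair_forms_def)
          qed
          then show ?thesis unfolding prime_values_count_def by (metis (no_types, lifting))
        qed
        ultimately show "real (card (prime_forms_le (pair_forms a b) Y)) \<ge> c * (4 / 35) * (Y / ln Y ^ 3)"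
          by linarith
      qed
    qed
  qed (use c in auto)
qed

section \<open>Upper bounds for prime values of linear forms\<close>

definition psum :: "real \<Rightarrow> real" where
  "psum t = (\<Sum>p | prime p \<and> real p \<le> t. 1 / real p)"

lemma finite_primes_le_real [simp]: "finite {p. prime p \<and> real p \<le> t}"
proof -
  have "p \<le> nat \<lceil>t\<rceil>" if "real p \<le> t" for p using that by linarith
  then have "{p. prime p \<and> real p \<le> t} \<subseteq> {..nat \<lceil>t\<rceil>}" by blast
  then show ?thesis by (rule finite_subset) simp
qed

theorem mertens: "\<exists>C>0. \<forall>t\<ge>4. \<bar>psum t - ln (ln t)\<bar> \<le> C"
proof -
  define C where "C = \<bar>1 + 2 * ln 4 / ln 2 - ln (ln 2)\<bar> + 2 * ln (2::real)"
  have l2: "ln (2::real) > 0" by simp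
  have "\<bar>psum t - ln (ln t)\<bar> \<le> C" if t: "t \<ge> 4" for t
  proof -
    define n where "n = nat \<lfloor>t\<rfloor>"
    have n: "n \<ge> 4" "real n \<le> t" "t < real n + 1" using t by (auto simp: n_def le_nat_iff le_floor_iff)
    have "real p \<le> t \<longleftrightarrow> p \<le> n" for p using n by linarith
    then have eq: "psum t = prime_recip_sum n" by (simp add: psum_def prime_recip_sum_def)
    have "4 * real n \<le> real n * real n" using n by (intro mult_right_mono) auto
    \<comment> \<open>Rounding \<open>t\<close> down to \<open>n\<close> changes \<open>ln t\<close>
      by at most a factor 2, hence \<open>ln (ln t)\<close> by at most \<open>ln 2\<close>.\<close>
    then have "t \<le> real n ^ 2" using n unfolding power2_eq_square by linarith
    then have "ln t \<le> ln (real n ^ 2)" using t n by (subst ln_le_cancel_iff) auto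
    then have "ln t \<le> 2 * ln (real n)" using n by (simp add: ln_realpow)
    then have "ln (ln t) \<le> ln (2 * ln (real n))" using t n by (subst ln_le_cancel_iff) auto
    also have "\<dots> = ln 2 + ln (ln (real n))" using n by (subst ln_mult) auto
    finally have 1: "ln (ln t) \<le> ln 2 + ln (ln (real n))" .
    have "ln (real n) \<le> ln t" using n by (subst ln_le_cancel_iff) auto
    then have 2: "ln (ln (real n)) \<le> ln (ln t)" using n t by (subst ln_le_cancel_iff) auto
    show ?thesis
      using prime_recip_sum_upper[of n] prime_recip_sum_lower[of n] n 1 2 l2 unfolding eq C_def by linarith
  qed
  moreover have "C > 0" using l2 unfolding C_def by linarith
  ultimately show ?thesis by blast
qed

lemma psum_diff:
  assumes "s \<le> t"
  shows "(\<Sum>p | prime p \<and> s < real p \<and> real p \<le> t. 1 / real p) = psum t - psum s"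
proof -
  have "{p. prime p \<and> s < real p \<and> real p \<le> t} = {p. prime p \<and> real p \<le> t} - {p. prime p \<and> real p \<le> s}"
    by auto
  then show ?thesis unfolding psum_def using assms by (simp add: sum_diff Collect_mono)
qed

text \<open>Applied to the leading coefficients and the determinants of the forms, to limit the
  primes at which there are fewer roots than forms: the product of these primes divides
  \<open>m\<close>.\<close>

lemma card_large_prime_divisors:
  fixes m :: int
  assumes "m \<noteq> 0" "real_of_int \<bar>m\<bar> \<le> M" "W > 1"
  shows "finite {p. prime p \<and> W < real p \<and> int p dvd m}"
    and "real (card {p. prime p \<and> W < real p \<and> int p dvd m}) * ln W \<le> ln M"
proof -
  let ?D = "{p. prime p \<and> W < real p \<and> int p dvd m}"
  have "p \<le> nat \<bar>m\<bar>" if "int p dvd m" for p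
    using dvd_imp_le_int[OF assms(1) that] by linarith
  then have "?D \<subseteq> {..nat \<bar>m\<bar>}" by blast
  then show fin: "finite ?D" by (rule finite_subset) simp
  have "\<Prod>?D dvd nat \<bar>m\<bar>"
    by (rule prod_primes_dvd[OF fin]) (auto simp: nat_dvd_iff)
  then have le: "\<Prod>?D \<le> nat \<bar>m\<bar>" using assms(1) by (intro dvd_imp_le) auto
  have "W ^ card ?D = (\<Prod>p\<in>?D. W)" by simp
  also have "\<dots> \<le> (\<Prod>p\<in>?D. real p)" using assms by (intro prod_mono) auto
  also have "\<dots> = real (\<Prod>?D)" by simp
  also have "\<dots> \<le> real (nat \<bar>m\<bar>)" using le by (simp only: of_nat_le_iff)
  also have "\<dots> \<le> M" using assms by simp
  finally have "W ^ card ?D \<le> M" .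
  then have "ln (W ^ card ?D) \<le> ln M" using assms by (intro ln_mono) auto
  then show "real (card ?D) * ln W \<le> ln M" using assms by (simp add: ln_realpow)
qed

lemma sum_UN_le:
  fixes f :: "'a \<Rightarrow> real"
  assumes "finite I" "\<And>i. i \<in> I \<Longrightarrow> finite (B i)" "\<And>x. f x \<ge> 0"
  shows "sum f (\<Union>i\<in>I. B i) \<le> (\<Sum>i\<in>I. sum f (B i))"
  using assms(1,2)
proof (induction I rule: finite_induct)
  case (insert i I)
  have fin: "finite (B i)" "finite (\<Union>i\<in>I. B i)" using insert by auto
  have "sum f (\<Union>i\<in>insert i I. B i) = sum f (B i \<union> (\<Union>i\<in>I. B i))" by simp
  also have "\<dots> \<le> sum f (B i) + sum f (\<Union>i\<in>I. B i)"
    using sum.union_inter[OF fin, of f] sum_nonneg[of "B i \<inter> (\<Union>i\<in>I. B i)" f] assms(3) by simp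
  also have "\<dots> \<le> sum f (B i) + (\<Sum>i\<in>I. sum f (B i))" using insert by simp
  finally show ?case using insert.hyps by simp
qed simp

lemma power_le_exp_fact: "x \<ge> 0 \<Longrightarrow> x ^ n / fact n \<le> exp (x::real)"
proof -
  assume x: "x \<ge> 0"
  have "(\<Sum>k\<in>{n}. x ^ k / fact k) \<le> (\<Sum>k. x ^ k / fact k)"
    using summable_exp[of x] x by (intro sum_le_suminf) (auto simp: divide_inverse mult.commute)
  then show ?thesis by (simp add: exp_def divide_inverse scaleR_conv_of_real mult.commute)
qed

text \<open>Since \<open>fact r\<close> is at least \<open>(r / e) ^ r\<close>, a truncation depth
  \<open>r\<close> that exceeds \<open>e * y\<close> by a constant factor makes the tail
  exponentially small in \<open>r\<close>.\<close>

lemma power_div_fact_le: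
  assumes "y \<ge> 0" "y \<le> t * real r / exp 1" "t \<ge> 0"
  shows "y ^ r / fact r \<le> t ^ r"
proof -
  have "y ^ r / fact r \<le> (t * real r / exp 1) ^ r / fact r"
    using assms by (intro divide_right_mono power_mono) auto
  also have "\<dots> = t ^ r / exp (real r) * (real r ^ r / fact r)"
    by (simp add: power_divide power_mult_distrib flip: exp_of_nat_mult)
  also have "\<dots> \<le> t ^ r / exp (real r) * exp (real r)"
    using assms by (intro mult_left_mono power_le_exp_fact) auto
  finally show ?thesis by simp
qed

text \<open>Here \<open>exp u\<close> is the length of the range of \<open>n\<close> and \<open>exp (exp L)\<close> bounds the coefficients.
  Sieving only by primes above \<open>exp L\<close> makes the primes at which two forms have a common root
  contribute a bounded amount.\<close>

lemma sieve_forms_upper: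
  fixes L u C :: real
  assumes C: "C > 0" "\<And>t. t \<ge> 4 \<Longrightarrow> \<bar>psum t - ln (ln t)\<bar> \<le> C"
    and L: "L \<ge> 10" "L \<ge> 5 * C" and u: "u \<ge> 1000 * L" "u \<le> exp L"
    and FS: "finite FS" "card FS = k" "k \<le> 5"
      "\<And>c d. (c, d) \<in> FS \<Longrightarrow> 0 < c \<and> real_of_int c \<le> exp (exp L) \<and> \<bar>d\<bar> \<le> 1"
      "\<And>c d c' d'. (c, d) \<in> FS \<Longrightarrow> (c', d') \<in> FS \<Longrightarrow> (c, d) \<noteq> (c', d') \<Longrightarrow> c * d' - c' * d \<noteq> 0"
  shows "real (card (prime_forms_le FS (exp u)))
    \<le> (2 * (200 * L\<^sup>2 * exp (2 * C + 30)) ^ 5 + 4) * (exp u / u ^ k)"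
proof -
  define W where "W = exp L"
  \<comment> \<open>With depth about \<open>60 * L\<close> the moduli stay below about
    \<open>exp (0.3 * u)\<close>, so the rounding errors are negligible, while
    \<open>ln (ln z)\<close> falls short of \<open>ln u\<close> by only
    \<open>ln (200 * L)\<close>.\<close>
  define z where "z = exp (u / (200 * L))"
  define bad where "bad m = {p. prime p \<and> W < real p \<and> int p dvd m}" for m :: int
  define MS where "MS = fst ` FS \<union> (\<lambda>((c, d), (c', d')). c * d' - c' * d) ` {(f, g) \<in> FS \<times> FS. f \<noteq> g}"
  define BAD where "BAD = (\<Union>m\<in>MS. bad m)"
  define Q where "Q = {p. prime p \<and> W < real p \<and> real p \<le> z}"
  define P where "P = Q - BAD"
  \<comment> \<open>\<open>2 * j + 1\<close> is at least ten times the bound \<open>6 * L\<close>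
    for the sum of \<open>k / p\<close>. As \<open>exp 2 \<le> 10\<close>,
    \<open>power_div_fact_le\<close> makes the tail at most \<open>exp (- 60 * L)\<close>.\<close>
  define j where "j = nat \<lceil>30 * L\<rceil>"
  define r where "r = 2 * j + 1"
  define Y where "Y = nat \<lfloor>exp u\<rfloor> + 1"
  \<comment> \<open>The loss in the main term per form: \<open>200 * L\<^sup>2\<close> comes from
    cutting the primes at \<open>z\<close> and at \<open>W\<close>, \<open>2 * C\<close> from using
    Mertens twice, and 30 from the bad primes, as \<open>MS\<close> has at most 5 + 25 elements and
    each contributes at most 1.\<close>
  define D where "D = 200 * L\<^sup>2 * exp (2 * C + 30)"
  have W: "W > 1" "W \<ge> 4" using L exp_ge_add_one_self[of L] unfolding W_def by linarith+
  have L0: "L > 0" using L by simp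
  have u0: "u > 0" using u L by linarith
  have uz: "u / (200 * L) \<ge> 5" using u L0 by (simp add: field_simps)
  then have z4: "z \<ge> 4" using exp_ge_add_one_self[of "u / (200 * L)"] unfolding z_def by linarith
  have MS: "m \<noteq> 0 \<and> real_of_int \<bar>m\<bar> \<le> 2 * exp (exp L)" if m: "m \<in> MS" for m
  proof -
    consider f where "f \<in> FS" "m = fst f"
      | c d c' d' where "(c, d) \<in> FS" "(c', d') \<in> FS" "(c, d) \<noteq> (c', d')" "m = c * d' - c' * d"
      using m unfolding MS_def by fastforce
    then show ?thesis
    proof cases
      case 1
      then have "0 < m \<and> real_of_int m \<le> exp (exp L)" using FS(4)[of "fst f" "snd f"] by simp
      then show ?thesis using exp_gt_zero[of "exp L"] by auto
    next
      case 2
      have f: "0 < c \<and> real_of_int c \<le> exp (exp L) \<and> \<bar>d\<bar> \<le> 1"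
        "0 < c' \<and> real_of_int c' \<le> exp (exp L) \<and> \<bar>d'\<bar> \<le> 1"
        using FS(4)[OF 2(1)] FS(4)[OF 2(2)] by blast+
      have "\<bar>m\<bar> \<le> \<bar>c\<bar> * \<bar>d'\<bar> + \<bar>c'\<bar> * \<bar>d\<bar>" unfolding 2
        by (metis abs_mult abs_triangle_ineq4)
      also have "\<dots> \<le> \<bar>c\<bar> * 1 + \<bar>c'\<bar> * 1" using f by (intro add_mono mult_left_mono) auto
      finally have "\<bar>m\<bar> \<le> c + c'" using f by simp
      then have "real_of_int \<bar>m\<bar> \<le> real_of_int c + real_of_int c'" by linarith
      moreover have "m \<noteq> 0" unfolding 2(4) by (rule FS(5)[OF 2(1-3)])
      ultimately show ?thesis using f by linarith
    qed
  qed
  have PR: "{(f, g) \<in> FS \<times> FS. f \<noteq> g} \<subseteq> FS \<times> FS" by auto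
  have finPR: "finite {(f, g) \<in> FS \<times> FS. f \<noteq> g}"
    by (rule finite_subset[OF PR]) (rule finite_cartesian_product[OF FS(1) FS(1)])
  have finMS: "finite MS" unfolding MS_def by (intro finite_UnI finite_imageI finPR FS(1))
  have "card MS \<le> card (fst ` FS) + card ((\<lambda>((c, d), (c', d')). c * d' - c' * d) ` {(f, g) \<in> FS \<times> FS. f \<noteq> g})"
    unfolding MS_def by (rule card_Un_le)
  also have "\<dots> \<le> card FS + card {(f, g) \<in> FS \<times> FS. f \<noteq> g}"
    by (intro add_mono card_image_le finPR FS(1))
  also have "card {(f, g) \<in> FS \<times> FS. f \<noteq> g} \<le> card (FS \<times> FS)"
    by (rule card_mono[OF finite_cartesian_product[OF FS(1) FS(1)] PR])
  also have "card FS + card (FS \<times> FS) \<le> 5 + 5 * 5"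
    unfolding card_cartesian_product using FS(2,3) by (intro add_mono mult_le_mono) simp_all
  finally have cardMS: "card MS \<le> 30" by simp
  have bad: "finite (bad m)" "(\<Sum>p\<in>bad m. 1 / real p) \<le> 1" if "m \<in> MS" for m
  proof -
    show fin: "finite (bad m)"
      unfolding bad_def by (rule card_large_prime_divisors(1)) (use MS[OF that] W in auto)
    have "real (card (bad m)) * ln W \<le> ln (2 * exp (exp L))"
      unfolding bad_def by (rule card_large_prime_divisors(2)) (use MS[OF that] W in auto)
    then have "real (card (bad m)) * L \<le> ln 2 + exp L" by (simp add: W_def ln_mult)
    moreover have "ln 2 \<le> (1::real)" using ln_2_less_1 by simp
    moreover have "real (card (bad m)) * 2 \<le> real (card (bad m)) * L" using L by (intro mult_left_mono) auto
    ultimately have "real (card (bad m)) \<le> exp L" using W unfolding W_def by linarith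
    then have *: "real (card (bad m)) / exp L \<le> 1" by simp
    have "(\<Sum>p\<in>bad m. 1 / real p) \<le> (\<Sum>p\<in>bad m. 1 / exp L)"
      using W by (intro sum_mono divide_left_mono) (auto simp: bad_def W_def)
    also have "\<dots> = real (card (bad m)) / exp L" by simp
    finally show "(\<Sum>p\<in>bad m. 1 / real p) \<le> 1" using * by (rule order_trans)
  qed
  have finBAD: "finite BAD" unfolding BAD_def using finMS bad by auto
  have "(\<Sum>p\<in>BAD. 1 / real p) \<le> (\<Sum>m\<in>MS. \<Sum>p\<in>bad m. 1 / real p)"
    unfolding BAD_def by (rule sum_UN_le) (use finMS bad in auto)
  also have "\<dots> \<le> (\<Sum>m\<in>MS. 1)" using bad by (intro sum_mono) auto
  finally have sumBAD: "(\<Sum>p\<in>BAD. 1 / real p) \<le> 30" using cardMS by simp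
  have finQ: "finite Q" unfolding Q_def by (rule finite_subset[OF _ finite_primes_le_real[of z]]) auto
  then have finP: "finite P" by (simp add: P_def)
  have lnz: "ln (ln z) = ln u - ln (200 * L)" using u0 L0 by (simp add: z_def ln_div)
  have lnW: "ln (ln W) = ln L" by (simp add: W_def)
  \<comment> \<open>If \<open>W\<close> exceeds \<open>z\<close>, there is no prime to sieve by, but
    then the claimed lower bound is negative.\<close>
  have "(\<Sum>p\<in>Q. 1 / real p) \<ge> ln u - ln (200 * L) - ln L - 2 * C"
  proof (cases "W \<le> z")
    case True
    show ?thesis unfolding Q_def psum_diff[OF True] using C(2)[of z] C(2)[of W] lnz lnW z4 W by linarith
  next
    case False
    then have "ln (ln z) \<le> ln (ln W)" using z4 W by (subst ln_le_cancel_iff) auto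
    moreover have "(\<Sum>p\<in>Q. 1 / real p) \<ge> 0" by (intro sum_nonneg) auto
    ultimately show ?thesis using lnz lnW C by linarith
  qed
  moreover have "(\<Sum>p\<in>Q. 1 / real p) \<le> (\<Sum>p\<in>P \<union> BAD. 1 / real p)"
    using finP finBAD by (intro sum_mono2) (auto simp: P_def)
  moreover have "(\<Sum>p\<in>P \<union> BAD. 1 / real p) \<le> (\<Sum>p\<in>P. 1 / real p) + (\<Sum>p\<in>BAD. 1 / real p)"
    using sum.union_inter[OF finP finBAD, of "\<lambda>p. 1 / real p"] sum_nonneg[of "P \<inter> BAD" "\<lambda>p. 1 / real p"] by simp
  ultimately have sumP: "(\<Sum>p\<in>P. 1 / real p) \<ge> ln u - ln D"
    using sumBAD L0 by (simp add: D_def ln_mult power2_eq_square)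
  have D1: "D \<ge> 1"
  proof -
    have "1 \<le> L * L" using L mult_mono[of 1 L 1 L] by simp
    moreover have "1 \<le> exp (2 * C + 30)" using C by simp
    ultimately have "1 * 1 \<le> (200 * L\<^sup>2) * exp (2 * C + 30)"
      by (intro mult_mono) (auto simp: power2_eq_square)
    then show ?thesis by (simp add: D_def)
  qed
  have upow: "u ^ k \<le> exp (5 * L)" "u ^ k > 0"
  proof -
    have "u ^ k \<le> u ^ 5" using u L FS by (intro power_increasing) auto
    also have "\<dots> \<le> exp L ^ 5" using u u0 by (intro power_mono) auto
    finally show "u ^ k \<le> exp (5 * L)" by (simp flip: exp_of_nat_mult)
    show "u ^ k > 0" using u0 by simp
  qed
  \<comment> \<open>Since \<open>u \<le> exp L\<close> and \<open>k \<le> 5\<close>, dividing by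
    \<open>u ^ k\<close> costs at most \<open>exp (5 * L)\<close>: an error term is acceptable once
    its exponent is below \<open>u\<close> by \<open>5 * L\<close>.\<close>
  have small: "exp v \<le> exp u / u ^ k" if "v + 5 * L \<le> u" for v
  proof -
    have "exp v * u ^ k \<le> exp v * exp (5 * L)" using upow by (intro mult_left_mono) auto
    also have "\<dots> = exp (v + 5 * L)" by (simp add: exp_add)
    also have "\<dots> \<le> exp u" using that by simp
    finally show ?thesis using upow by (simp add: field_simps)
  qed
  have roots: "form_roots FS p \<subseteq> {..<p} \<and> card (form_roots FS p) = k" if p: "p \<in> P" for p
  proof -
    have pr: "prime p" "W < real p" and nb: "\<And>m. m \<in> MS \<Longrightarrow> \<not> int p dvd m"
      using p by (auto simp: P_def Q_def BAD_def bad_def)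
    have "card (form_roots FS p) = card FS"
    proof (rule card_form_roots_eq[OF pr(1) FS(1)])
      fix c d assume "(c, d) \<in> FS"
      then have "c \<in> MS" unfolding MS_def by force
      then show "\<not> int p dvd c" by (rule nb)
    next
      fix c d c' d' assume "(c, d) \<in> FS" "(c', d') \<in> FS" "(c, d) \<noteq> (c', d')"
      then have "((c, d), (c', d')) \<in> {(f, g) \<in> FS \<times> FS. f \<noteq> g}" by blast
      then have "c * d' - c' * d \<in> MS" unfolding MS_def by force
      then show "\<not> int p dvd c * d' - c' * d" by (rule nb)
    qed
    then show ?thesis using FS by (auto simp: form_roots_def)
  qed
  have primeP: "prime p" if "p \<in> P" for p using that by (auto simp: P_def Q_def)
  \<comment> \<open>A prime value divisible by a sieving prime \<open>p\<close> must equal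
    \<open>p\<close>. Such \<open>n\<close> escape the sieve, but they are at most
    \<open>p + 1\<close> with \<open>p \<le> z\<close> and are counted separately.\<close>
  have sub: "(prime_forms_le FS (exp u))
      \<subseteq> {n. n < Y \<and> (\<forall>p\<in>P. n mod p \<notin> form_roots FS p)} \<union> {..nat \<lceil>z\<rceil> + 1}"
  proof
    fix n assume n: "n \<in> (prime_forms_le FS (exp u))"
    show "n \<in> {n. n < Y \<and> (\<forall>p\<in>P. n mod p \<notin> form_roots FS p)} \<union> {..nat \<lceil>z\<rceil> + 1}"
    proof (cases "\<forall>p\<in>P. n mod p \<notin> form_roots FS p")
      case True
      have "n < Y" using n by (simp add: Y_def le_nat_floor less_Suc_eq_le)
      then show ?thesis using True by simp
    next
      case False
      then obtain p c d where p: "p \<in> P" "(c, d) \<in> FS" "int p dvd c * int (n mod p) + d"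
        by (auto simp: form_roots_def)
      have "int p dvd c * (int n - int (n mod p))"
        by (simp add: zmod_int minus_mod_eq_mult_div)
      then have "int p dvd (c * int (n mod p) + d) + c * (int n - int (n mod p))"
        using p(3) by (rule dvd_add[rotated])
      then have "int p dvd c * int n + d" by (simp add: algebra_simps)
      moreover have "prime (c * int n + d)" using n p by (auto simp: prime_forms_def)
      ultimately have eq: "int p = c * int n + d"
        using primeP[OF p(1)] by (metis prime_nat_int_transfer primes_dvd_imp_eq)
      have "int n \<le> c * int n" using FS(4)[OF p(2)] by (simp add: mult_le_cancel_right1)
      then have "n \<le> p + 1" using eq FS(4)[OF p(2)] by linarith
      moreover have "real p \<le> z" using p by (auto simp: P_def Q_def)
      ultimately have "n \<le> nat \<lceil>z\<rceil> + 1" by linarith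
      then show ?thesis by simp
    qed
  qed
  have "Y \<le> 2 * exp u"
  proof -
    have "real (nat \<lfloor>exp u\<rfloor>) \<le> exp u" by (simp add: of_nat_floor)
    moreover have "1 \<le> exp u" using u0 by simp
    moreover have "real Y = real (nat \<lfloor>exp u\<rfloor>) + 1" by (simp only: Y_def of_nat_add of_nat_1)
    ultimately show ?thesis by linarith
  qed
  note Y = this
  have kp: "real k \<le> real p" if "p \<in> P" for p
    using card_mono[of "{..<p}" "form_roots FS p"] roots[OF that] by simp
  have lnD: "ln D \<ge> 0" using D1 by simp
  have T1: "real Y * (\<Prod>p\<in>P. 1 - real k / real p) \<le> 2 * D ^ 5 * (exp u / u ^ k)"
  proof -
    have "(\<Prod>p\<in>P. 1 - real k / real p) \<le> (\<Prod>p\<in>P. exp (- (real k * (1 / real p))))"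
    proof (intro prod_mono conjI)
      fix p assume p: "p \<in> P"
      show "0 \<le> 1 - real k / real p" using kp[OF p] prime_gt_0_nat[OF primeP[OF p]] by simp
      show "1 - real k / real p \<le> exp (- (real k * (1 / real p)))"
        using exp_ge_add_one_self[of "- (real k * (1 / real p))"] by simp
    qed
    also have "\<dots> = exp (- (real k * (\<Sum>p\<in>P. 1 / real p)))"
      using finP by (simp add: exp_sum sum_distrib_left flip: sum_negf)
    also have "\<dots> \<le> exp (real k * (ln D - ln u))"
      using mult_left_mono[OF sumP, of "real k"] by (simp add: algebra_simps)
    also have "\<dots> = (D / u) ^ k"
      using D1 u0 by (simp add: exp_of_nat_mult exp_diff)
    also have "\<dots> = D ^ k / u ^ k" by (simp add: power_divide)
    also have "\<dots> \<le> D ^ 5 / u ^ k"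
      using D1 FS upow by (intro divide_right_mono power_increasing) auto
    finally have "(\<Prod>p\<in>P. 1 - real k / real p) \<le> D ^ 5 / u ^ k" .
    then have "real Y * (\<Prod>p\<in>P. 1 - real k / real p) \<le> (2 * exp u) * (D ^ 5 / u ^ k)"
      using Y D1 upow by (intro mult_mono' mult_nonneg_nonneg) 
        (auto intro!: prod_nonneg simp: prime_gt_0_nat[OF primeP] kp[unfolded of_nat_le_iff])
    then show ?thesis by (simp add: mult_ac)
  qed
  have T2: "real Y * (real k * (\<Sum>p\<in>P. 1 / real p)) ^ (2 * j + 1) / fact (2 * j + 1) \<le> exp u / u ^ k"
  proof -
    have "(\<Sum>p\<in>P. 1 / real p) \<le> psum z"
      unfolding psum_def by (intro sum_mono2) (auto simp: P_def Q_def)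
    also have "\<dots> \<le> ln (ln z) + C" using C(2)[of z] z4 by linarith
    also have "ln (ln z) \<le> ln u" using L by (simp add: lnz)
    also have "ln u \<le> L" using u u0 by (metis ln_exp ln_le_cancel_iff exp_gt_zero)
    finally have S: "(\<Sum>p\<in>P. 1 / real p) \<le> L + C" by simp
    have "real k * (\<Sum>p\<in>P. 1 / real p) \<le> 5 * (L + C)"
      using S FS(3) C L0 by (intro mult_mono) (auto intro!: sum_nonneg)
    also have "\<dots> \<le> 6 * L" using L by simp
    finally have S6: "real k * (\<Sum>p\<in>P. 1 / real p) \<le> 6 * L" .
    have r60: "real (2 * j + 1) \<ge> 60 * L" using L by (simp add: j_def) linarith
    have e2: "exp (1::real) * exp 1 \<le> 10"
    proof -
      have "exp (1::real) * exp 1 \<le> 2.72 * 2.72" using e_less_272 by (intro mult_mono) auto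
      then show ?thesis by simp
    qed
    have "6 * L \<le> 60 * L / (exp 1 * exp 1)"
      using e2 L0 by (simp add: field_simps)
    also have "\<dots> \<le> real (2 * j + 1) / (exp 1 * exp 1)" using r60 by (intro divide_right_mono) auto
    finally have "6 * L \<le> exp (- 1) * real (2 * j + 1) / exp 1"
      by (simp add: exp_minus field_simps)
    then have "(real k * (\<Sum>p\<in>P. 1 / real p)) ^ (2 * j + 1) / fact (2 * j + 1) \<le> exp (- 1) ^ (2 * j + 1)"
      using S6 by (intro power_div_fact_le mult_nonneg_nonneg sum_nonneg) auto
    also have "\<dots> = exp (- real (2 * j + 1))"
      by (metis exp_of_nat_mult mult_minus_right mult.right_neutral)
    also have "\<dots> \<le> exp (- 60 * L)" using r60 by simp
    finally have "real Y * ((real k * (\<Sum>p\<in>P. 1 / real p)) ^ (2 * j + 1) / fact (2 * j + 1)) \<le> (2 * exp u) * exp (- 60 * L)"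
      using Y by (intro mult_mono' divide_nonneg_nonneg zero_le_power mult_nonneg_nonneg sum_nonneg) auto
    also have "\<dots> \<le> exp L * exp u * exp (- 60 * L)"
      using W unfolding W_def by (intro mult_right_mono) auto
    also have "\<dots> = exp (u - 59 * L)" by (simp flip: exp_add)
    also have "\<dots> \<le> exp u / u ^ k" using L by (intro small) simp
    finally show ?thesis by simp
  qed
  have T3: "(1 + real k * real (card P)) ^ (2 * j) \<le> exp u / u ^ k"
  proof -
    have "P \<subseteq> {1..nat \<lfloor>z\<rfloor>}" using primeP
      by (auto simp: P_def Q_def le_nat_floor dest: prime_ge_1_nat)
    then have "card P \<le> nat \<lfloor>z\<rfloor>" using card_mono[of "{1..nat \<lfloor>z\<rfloor>}" P] by simp
    then have cP: "real (card P) \<le> z" using z4 by linarith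
    have "real k * real (card P) \<le> 5 * z" using FS cP by (intro mult_mono) auto
    then have "1 + real k * real (card P) \<le> 6 * z" using z4 by simp
    also have "6 * z \<le> exp 2 * z"
    proof -
      have "2.7 * 2.7 \<le> exp (1::real) * exp 1" using e_approx_32 by (intro mult_mono) (auto simp: abs_if split: if_splits)
      then have "6 \<le> exp (2::real)" by (simp flip: exp_add)
      then show ?thesis using z4 by (intro mult_right_mono) auto
    qed
    also have "\<dots> = exp (2 + u / (200 * L))" by (simp add: z_def exp_add)
    finally have "(1 + real k * real (card P)) ^ (2 * j) \<le> exp (2 + u / (200 * L)) ^ (2 * j)"
      by (intro power_mono) auto
    also have "\<dots> = exp (real (2 * j) * (2 + u / (200 * L)))" by (simp only: exp_of_nat_mult)
    also have "\<dots> \<le> exp (61 * L * (2 + u / (200 * L)))"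
    proof -
      have "real (2 * j) \<le> 61 * L" using L by (simp add: j_def) linarith
      then have "real (2 * j) * (2 + u / (200 * L)) \<le> 61 * L * (2 + u / (200 * L))"
        using uz by (intro mult_right_mono) auto
      then show ?thesis by simp
    qed
    also have "61 * L * (2 + u / (200 * L)) = 122 * L + 61 / 200 * u" using L0 by (simp add: field_simps)
    also have "exp (122 * L + 61 / 200 * u) \<le> exp u / u ^ k"
      using u L by (intro small) linarith
    finally show ?thesis .
  qed
  have T4: "real (card {..nat \<lceil>z\<rceil> + 1}) \<le> 2 * (exp u / u ^ k)"
  proof -
    have "real (card {..nat \<lceil>z\<rceil> + 1}) \<le> z + 3" using z4 by (simp, linarith)
    also have "\<dots> \<le> 2 * z" using z4 by simp
    also have "z \<le> exp u / u ^ k" unfolding z_def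
    proof (rule small)
      have "u * 1 \<le> u * L" using u0 L by (intro mult_left_mono) auto
      then have "u / (200 * L) \<le> u / 200" using L0 u0 by (simp add: field_simps)
      then show "u / (200 * L) + 5 * L \<le> u" using u L by linarith
    qed
    finally show ?thesis by simp
  qed
  have fin1: "finite {n. n < Y \<and> (\<forall>p\<in>P. n mod p \<notin> form_roots FS p)}"
    by (rule finite_subset[of _ "{..<Y}"]) auto
  have "card (prime_forms_le FS (exp u))
      \<le> card ({n. n < Y \<and> (\<forall>p\<in>P. n mod p \<notin> form_roots FS p)} \<union> {..nat \<lceil>z\<rceil> + 1})"
    using fin1 by (intro card_mono[OF _ sub]) auto
  also have "\<dots> \<le> card {n. n < Y \<and> (\<forall>p\<in>P. n mod p \<notin> form_roots FS p)} + card {..nat \<lceil>z\<rceil> + 1}"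
    by (rule card_Un_le)
  finally have "real (card (prime_forms_le FS (exp u)))
      \<le> real (card {n. n < Y \<and> (\<forall>p\<in>P. n mod p \<notin> form_roots FS p)}) + real (card {..nat \<lceil>z\<rceil> + 1})"
    by (simp only: of_nat_le_iff flip: of_nat_add)
  also have "\<dots> \<le> (2 * D ^ 5 * (exp u / u ^ k) + exp u / u ^ k + exp u / u ^ k) + 2 * (exp u / u ^ k)"
    using brun_sieve[OF finP primeP roots, of Y j] T1 T2 T3 T4 by linarith
  also have "\<dots> = (2 * D ^ 5 + 4) * (exp u / u ^ k)" by (simp add: algebra_simps)
  finally show ?thesis unfolding D_def .
qed

section \<open>Sums of reciprocals over prime values\<close>

lemma sum_inverse_Suc_upper: "(\<Sum>m=1..N. 1 / (real m + 1)) \<le> ln (real N + 1)"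
proof (induction N)
  case (Suc N)
  have "ln ((real N + 1) / (real N + 2)) \<le> (real N + 1) / (real N + 2) - 1"
    by (intro ln_le_minus_one) auto
  then have "1 / (real N + 2) \<le> ln (real N + 2) - ln (real N + 1)"
    by (simp add: ln_div field_simps)
  then show ?case using Suc by (simp add: add.commute)
qed simp

lemma sum_inverse_Suc_lower:
  assumes "M \<le> N"
  shows "(\<Sum>m=M..N. 1 / (real m + 1)) \<ge> ln (real N + 2) - ln (real M + 1)"
  using assms
proof (induction N rule: dec_induct)
  case base
  have "ln ((real M + 2) / (real M + 1)) \<le> (real M + 2) / (real M + 1) - 1"
    by (intro ln_le_minus_one) auto
  then show ?case by (simp add: ln_div field_simps)
next
  case (step N)
  have "ln ((real N + 3) / (real N + 2)) \<le> (real N + 3) / (real N + 2) - 1"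
    by (intro ln_le_minus_one) auto
  then have "ln (real N + 3) - ln (real N + 2) \<le> 1 / (real N + 2)"
    by (simp add: ln_div field_simps)
  then show ?case using step by (simp add: add.commute)
qed

section \<open>Abel summation for sums of reciprocals\<close>

lemma inverse_telescope:
  assumes "n \<ge> 1" "n \<le> N"
  shows "1 / real n = 1 / (real N + 1) + (\<Sum>m=n..N. 1 / (real m * (real m + 1)))"
  using assms(2)
proof (induction N rule: dec_induct)
  case base
  have "real n > 0" using assms by simp
  then show ?case by (simp add: divide_simps)
next
  case (step N)
  have "1 / (real N + 1) = 1 / (real N + 2) + 1 / ((real N + 1) * (real N + 2))"
    by (simp add: divide_simps)
  then show ?case using step by (simp add: add.commute)
qed

lemma abel_sum_inverse:
  assumes "S \<subseteq> {1..N}"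
  shows "(\<Sum>n\<in>S. 1 / real n)
    = real (card S) / (real N + 1) + (\<Sum>m=1..N. real (card {n\<in>S. n \<le> m}) / (real m * (real m + 1)))"
proof -
  have fin: "finite S" using assms finite_subset by blast
  have "(\<Sum>n\<in>S. 1 / real n) = (\<Sum>n\<in>S. 1 / (real N + 1) + (\<Sum>m=n..N. 1 / (real m * (real m + 1))))"
    using assms by (intro sum.cong refl inverse_telescope) auto
  also have "\<dots> = real (card S) / (real N + 1) + (\<Sum>n\<in>S. \<Sum>m=n..N. 1 / (real m * (real m + 1)))"
    by (simp add: sum.distrib)
  also have "(\<Sum>n\<in>S. \<Sum>m=n..N. 1 / (real m * (real m + 1)))
      = (\<Sum>n\<in>S. \<Sum>m | m \<in> {1..N} \<and> n \<le> m. 1 / (real m * (real m + 1)))"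
    using assms by (intro sum.cong refl) auto
  also have "\<dots> = (\<Sum>m\<in>{1..N}. \<Sum>n | n \<in> S \<and> n \<le> m. 1 / (real m * (real m + 1)))"
    by (rule sum.swap_restrict) (use fin in auto)
  finally show ?thesis by simp
qed

lemma abel_upper:
  assumes "S \<subseteq> {1..N}" "\<And>m. m \<in> {1..N} \<Longrightarrow> real (card {n\<in>S. n \<le> m}) \<le> K * real m" "K \<ge> 0"
  shows "(\<Sum>n\<in>S. 1 / real n) \<le> K * (1 + ln (real N + 1))"
proof (cases "N = 0")
  case False
  have "{n\<in>S. n \<le> N} = S" using assms(1) by auto
  then have "real (card S) \<le> K * real N" using assms(2)[of N] False by simp
  also have "\<dots> \<le> K * (real N + 1)" using assms(3) by (intro mult_left_mono) auto
  finally have 1: "real (card S) / (real N + 1) \<le> K" by (simp add: field_simps)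
  have "(\<Sum>m=1..N. real (card {n\<in>S. n \<le> m}) / (real m * (real m + 1))) \<le> (\<Sum>m=1..N. K * (1 / (real m + 1)))"
  proof (rule sum_mono)
    fix m assume m: "m \<in> {1..N}"
    have "real (card {n\<in>S. n \<le> m}) / (real m * (real m + 1)) \<le> (K * real m) / (real m * (real m + 1))"
      using m assms(2)[OF m] by (intro divide_right_mono) auto
    also have "\<dots> = K * (1 / (real m + 1))" using m by simp
    finally show "real (card {n\<in>S. n \<le> m}) / (real m * (real m + 1)) \<le> K * (1 / (real m + 1))" .
  qed
  also have "\<dots> \<le> K * ln (real N + 1)"
    unfolding sum_distrib_left [symmetric] using sum_inverse_Suc_upper assms(3) by (rule mult_left_mono)
  finally show ?thesis unfolding abel_sum_inverse[OF assms(1)] using 1 by (simp add: distrib_left)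
qed (use assms in simp)

lemma abel_lower:
  assumes "S \<subseteq> {1..N}" "\<And>m. m \<in> {M..N} \<Longrightarrow> real (card {n\<in>S. n \<le> m}) \<ge> K * real m"
    and "1 \<le> M" "M \<le> N" "K \<ge> 0"
  shows "(\<Sum>n\<in>S. 1 / real n) \<ge> K * (ln (real N + 2) - ln (real M + 1))"
proof -
  have "K * (ln (real N + 2) - ln (real M + 1)) \<le> (\<Sum>m=M..N. K * (1 / (real m + 1)))"
    unfolding sum_distrib_left [symmetric] using sum_inverse_Suc_lower[OF assms(4)] assms(5) by (rule mult_left_mono)
  also have "\<dots> \<le> (\<Sum>m=M..N. real (card {n\<in>S. n \<le> m}) / (real m * (real m + 1)))"
  proof (rule sum_mono)
    fix m assume m: "m \<in> {M..N}"
    then have "K * (1 / (real m + 1)) = (K * real m) / (real m * (real m + 1))" using assms(3) by simp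
    also have "\<dots> \<le> real (card {n\<in>S. n \<le> m}) / (real m * (real m + 1))"
      using m assms(2)[OF m] by (intro divide_right_mono) auto
    finally show "K * (1 / (real m + 1)) \<le> real (card {n\<in>S. n \<le> m}) / (real m * (real m + 1))" .
  qed
  also have "\<dots> \<le> (\<Sum>m=1..N. real (card {n\<in>S. n \<le> m}) / (real m * (real m + 1)))"
    using assms(3) by (intro sum_mono2) auto
  finally show ?thesis unfolding abel_sum_inverse[OF assms(1)]
    by (rule order.trans) simp
qed

text \<open>Small \<open>n\<close> are cut off because the sieve bound says nothing about them.\<close>

definition prime_form_set :: "(int \<times> int) set \<Rightarrow> real \<Rightarrow> nat set" where
  "prime_form_set FS v = {n. exp (v / 4) < real n \<and> real n \<le> exp v \<and> prime_forms FS n}"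

lemma finite_prime_form_set [simp]: "finite (prime_form_set FS v)"
proof -
  have "prime_form_set FS v \<subseteq> {..nat \<lfloor>exp v\<rfloor>}"
    by (auto simp: prime_form_set_def le_nat_floor)
  then show ?thesis by (rule finite_subset) simp
qed

lemma finite_prime_forms_le: "finite (prime_forms_le FS t)"
proof (cases "t \<ge> 0")
  case True
  then have "(prime_forms_le FS t) \<subseteq> {..nat \<lfloor>t\<rfloor>}"
    by (auto simp: le_nat_floor)
  then show ?thesis by (rule finite_subset) simp
next
  case False
  then have "(prime_forms_le FS t) = {}" by auto
  then show ?thesis by (simp only: finite.emptyI)
qed

lemma prime_form_set_sub: "prime_form_set FS v \<subseteq> (prime_forms_le FS (exp v))"
proof
  fix n assume "n \<in> prime_form_set FS v"
  then have n: "exp (v / 4) < real n" "real n \<le> exp v" "prime_forms FS n" by (auto simp: prime_form_set_def)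
  have "0 < real n" using n(1) exp_gt_zero[of "v / 4"] by linarith
  then show "n \<in> (prime_forms_le FS (exp v))" using n by simp
qed

lemma card_prime_form_set_upper:
  assumes "real (card (prime_forms_le FS (exp v))) \<le> B"
  shows "real (card (prime_form_set FS v)) \<le> B"
proof -
  have "card (prime_form_set FS v) \<le> card (prime_forms_le FS (exp v))"
    using finite_prime_forms_le by (rule card_mono[OF _ prime_form_set_sub])
  then show ?thesis using assms by linarith
qed

text \<open>The \<open>k\<close> primality conditions cost \<open>w ^ k\<close>, and the logarithmic
  range of summation gives one factor \<open>v\<close> back. The cut-off at
  \<open>exp (v / 4)\<close> ensures \<open>w \<ge> v / 4\<close>, which is where
  \<open>4 ^ k\<close> comes from.\<close>

lemma sum_prime_form_set_upper:
  assumes v: "v \<ge> 1" and K: "K \<ge> 0"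
    and up: "\<And>w. v / 4 \<le> w \<Longrightarrow> w \<le> v \<Longrightarrow>
      real (card (prime_forms_le FS (exp w))) \<le> K * (exp w / w ^ k)"
  shows "(\<Sum>n\<in>prime_form_set FS v. 1 / real n) \<le> 3 * K * 4 ^ k * (v / v ^ k)"
proof -
  define N where "N = nat \<lfloor>exp v\<rfloor>"
  define K' where "K' = K * (4 / v) ^ k"
  have N: "real N \<le> exp v" by (simp add: N_def of_nat_floor)
  have "(\<Sum>n\<in>prime_form_set FS v. 1 / real n) \<le> K' * (1 + ln (real N + 1))"
  proof (rule abel_upper)
    show "prime_form_set FS v \<subseteq> {1..N}"
    proof
      fix n assume "n \<in> prime_form_set FS v"
      then have "0 < n" "real n \<le> exp v" using prime_form_set_sub by blast+
      then show "n \<in> {1..N}" by (simp add: N_def le_nat_floor)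
    qed
    show "K' \<ge> 0" using K v by (simp add: K'_def)
    fix m assume m: "m \<in> {1..N}"
    show "real (card {n\<in>prime_form_set FS v. n \<le> m}) \<le> K' * real m"
    proof (cases "exp (v / 4) \<le> real m")
      case True
      define w where "w = ln (real m)"
      have w: "exp w = real m" using m by (simp add: w_def)
      have "v / 4 \<le> w" using True m unfolding w_def by (subst ln_ge_iff) auto
      moreover have "real m \<le> exp v" using m N by simp
      then have "w \<le> v" using w by (metis exp_le_cancel_iff)
      ultimately have "real (card (prime_forms_le FS (exp w))) \<le> K * (exp w / w ^ k)"
        by (rule up)
      moreover have "card {n\<in>prime_form_set FS v. n \<le> m} \<le> card (prime_forms_le FS (exp w))"
        using prime_form_set_sub[of FS v] by (intro card_mono finite_prime_forms_le) (auto simp: w)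
      moreover have "K * (exp w / w ^ k) \<le> K * (real m / (v / 4) ^ k)"
        using K v \<open>v / 4 \<le> w\<close> unfolding w by (intro mult_left_mono divide_left_mono power_mono) auto
      moreover have "K * (real m / (v / 4) ^ k) = K' * real m"
        by (simp add: K'_def power_divide)
      ultimately show ?thesis by linarith
    next
      case False
      have "\<not> n \<le> m" if "n \<in> prime_form_set FS v" for n
      proof
        assume "n \<le> m"
        then have "real n \<le> real m" by simp
        then show False using that False by (simp add: prime_form_set_def)
      qed
      then have "{n\<in>prime_form_set FS v. n \<le> m} = {}" by blast
      then have "real (card {n\<in>prime_form_set FS v. n \<le> m}) = 0" by (simp only: card.empty of_nat_0)
      also have "0 \<le> K' * real m" using K v by (simp add: K'_def)
      finally show ?thesis .
    qed
  qed
  also have "\<dots> \<le> K' * (3 * v)"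
  proof (rule mult_left_mono)
    have "1 \<le> exp v" using v by simp
    then have "real N + 1 \<le> 2 * exp v" using N by linarith
    then have "ln (real N + 1) \<le> ln (2 * exp v)" by (intro ln_mono) auto
    also have "\<dots> = ln 2 + v" by (simp add: ln_mult)
    finally show "1 + ln (real N + 1) \<le> 3 * v" using v ln_2_less_1 by linarith
  qed (use K v in \<open>simp add: K'_def\<close>)
  also have "\<dots> = 3 * K * 4 ^ k * (v / v ^ k)" by (simp add: K'_def power_divide)
  finally show ?thesis .
qed

text \<open>For \<open>m \<ge> exp (v / 2)\<close> the \<open>n\<close> removed by the cut-off at
  \<open>exp (v / 4)\<close> are too few to matter: by the second condition on \<open>v\<close>,
  half of the lower bound survives.\<close>

lemma card_prime_form_set_lower:
  assumes c: "c > 0" and v: "v \<ge> 1" "exp (v / 4) + 1 \<le> c / 2 * (exp (v / 2) / v ^ 3)"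
    and lo: "\<And>w. v / 4 \<le> w \<Longrightarrow> w \<le> v \<Longrightarrow>
      real (card (prime_forms_le FS (exp w))) \<ge> c * (exp w / w ^ 3)"
    and m: "exp (v / 2) \<le> m" "m \<le> exp v"
  shows "real (card {n\<in>prime_form_set FS v. real n \<le> m}) \<ge> c / 2 * (m / v ^ 3)"
proof -
  define w where "w = ln m"
  have m0: "m > 0" using m(1) exp_gt_zero[of "v / 2"] by linarith
  have w: "exp w = m" using m0 by (simp add: w_def)
  have "v / 2 \<le> w" using m m0 unfolding w_def by (subst ln_ge_iff)
  then have w4: "v / 4 \<le> w" "w > 0" using v by linarith+
  have wv: "w \<le> v" using m(2) w by (metis exp_le_cancel_iff)
  have "c * (m / v ^ 3) \<le> c * (exp w / w ^ 3)"
    unfolding w using c wv w4 m0 by (intro mult_left_mono divide_left_mono power_mono) auto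
  also have "\<dots> \<le> real (card (prime_forms_le FS (exp w)))"
    by (rule lo[OF w4(1) wv])
  also have "\<dots> \<le> real (card ({n\<in>prime_form_set FS v. real n \<le> m} \<union> {..nat \<lfloor>exp (v / 4)\<rfloor>}))"
  proof -
    have "(prime_forms_le FS (exp w)) \<subseteq> {n\<in>prime_form_set FS v. real n \<le> m} \<union> {..nat \<lfloor>exp (v / 4)\<rfloor>}"
    proof
      fix n assume n: "n \<in> (prime_forms_le FS (exp w))"
      show "n \<in> {n\<in>prime_form_set FS v. real n \<le> m} \<union> {..nat \<lfloor>exp (v / 4)\<rfloor>}"
      proof (cases "real n \<le> exp (v / 4)")
        case True
        then show ?thesis by (simp add: le_nat_floor)
      next
        case False
        then show ?thesis using n m(2) by (simp add: prime_form_set_def w)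
      qed
    qed
    then have "card (prime_forms_le FS (exp w)) \<le> card ({n\<in>prime_form_set FS v. real n \<le> m} \<union> {..nat \<lfloor>exp (v / 4)\<rfloor>})"
      by (intro card_mono) auto
    then show ?thesis by simp
  qed
  also have "\<dots> \<le> real (card {n\<in>prime_form_set FS v. real n \<le> m} + card {..nat \<lfloor>exp (v / 4)\<rfloor>})"
    by (simp only: of_nat_le_iff card_Un_le)
  also have "\<dots> = real (card {n\<in>prime_form_set FS v. real n \<le> m}) + real (nat \<lfloor>exp (v / 4)\<rfloor>) + 1"
    by simp
  also have "real (nat \<lfloor>exp (v / 4)\<rfloor>) \<le> exp (v / 4)" by (simp add: of_nat_floor)
  finally have 1: "c * (m / v ^ 3) \<le> real (card {n\<in>prime_form_set FS v. real n \<le> m}) + exp (v / 4) + 1" by simp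
  have "exp (v / 4) + 1 \<le> c / 2 * (m / v ^ 3)"
    using v c m by (intro order.trans[OF v(2)] mult_left_mono divide_right_mono) auto
  then show ?thesis using 1 by (simp add: field_simps)
qed

text \<open>Abel summation with the counts at \<open>m\<close> from \<open>exp (v / 2)\<close> to
  \<open>exp v\<close>. This range has logarithmic length about \<open>v / 2\<close>, which turns
  \<open>1 / v ^ 3\<close> into \<open>1 / v ^ 2\<close>.\<close>

lemma sum_prime_form_set_lower:
  assumes c: "c > 0" and v: "v \<ge> 16" "exp (v / 4) + 1 \<le> c / 2 * (exp (v / 2) / v ^ 3)"
    and lo: "\<And>w. v / 4 \<le> w \<Longrightarrow> w \<le> v \<Longrightarrow>
      real (card (prime_forms_le FS (exp w))) \<ge> c * (exp w / w ^ 3)"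
  shows "(\<Sum>n\<in>prime_form_set FS v. 1 / real n) \<ge> c / 8 * (1 / v ^ 2)"
proof -
  define N where "N = nat \<lfloor>exp v\<rfloor>"
  define M where "M = nat \<lceil>exp (v / 2)\<rceil>"
  have N: "real N \<le> exp v" "exp v < real N + 1" by (simp_all add: N_def of_nat_floor)
  have "1 \<le> exp (v / 2)" using v by simp
  then have M: "exp (v / 2) \<le> real M" "real M < exp (v / 2) + 1" "M \<ge> 1" unfolding M_def by linarith+
  have e8: "8 \<le> exp (v / 2)"
    using exp_ge_add_one_self[of "v / 2"] v by linarith
  have "exp v = exp (v / 2) * exp (v / 2)" by (simp flip: exp_add)
  also have "\<dots> \<ge> 8 * exp (v / 2)" using e8 by (intro mult_right_mono) auto
  finally have "8 * exp (v / 2) \<le> exp v" .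
  then have "real M \<le> real N" using M N e8 by linarith
  then have MN: "M \<le> N" by simp
  have "c / 2 / v ^ 3 * (ln (real N + 2) - ln (real M + 1)) \<le> (\<Sum>n\<in>prime_form_set FS v. 1 / real n)"
  proof (rule abel_lower[OF _ _ M(3) MN])
    show "prime_form_set FS v \<subseteq> {1..N}"
    proof
      fix n assume "n \<in> prime_form_set FS v"
      then have "0 < n" "real n \<le> exp v" using prime_form_set_sub by blast+
      then show "n \<in> {1..N}" by (simp add: N_def le_nat_floor)
    qed
    show "c / 2 / v ^ 3 \<ge> 0" using c v by simp
    fix m assume m: "m \<in> {M..N}"
    have m1: "real M \<le> real m" "real m \<le> real N" using m by auto
    have "c / 2 * (real m / v ^ 3) \<le> real (card {n\<in>prime_form_set FS v. real n \<le> real m})"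
      by (rule card_prime_form_set_lower) (use c v lo M N m1 in auto)
    then show "c / 2 / v ^ 3 * real m \<le> real (card {n\<in>prime_form_set FS v. n \<le> m})" by simp
  qed
  moreover have "c / 2 / v ^ 3 * (v / 4) \<le> c / 2 / v ^ 3 * (ln (real N + 2) - ln (real M + 1))"
  proof (rule mult_left_mono)
    have "v = ln (exp v)" by simp
    also have "\<dots> \<le> ln (real N + 2)" using N(2) by (intro ln_mono) auto
    finally have 1: "v \<le> ln (real N + 2)" .
    have "real M + 1 \<le> 2 * exp (v / 2)" using M e8 by linarith
    then have "ln (real M + 1) \<le> ln (2 * exp (v / 2))" by (intro ln_mono) auto
    also have "\<dots> = ln 2 + v / 2" by (simp add: ln_mult)
    finally show "v / 4 \<le> ln (real N + 2) - ln (real M + 1)" using 1 v ln_2_less_1 by linarith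
  qed (use c v in simp)
  moreover have "c / 2 / v ^ 3 * (v / 4) = c / 8 * (1 / v ^ 2)"
    using v by (simp add: power2_eq_square power3_eq_cube)
  ultimately show ?thesis by linarith
qed

text \<open>Cauchy-Schwarz for the function that counts the \<open>i\<close> with
  \<open>t \<in> T i\<close>, supported on the union.\<close>

lemma card_Union_second_moment:
  assumes "finite I" "\<And>i. i \<in> I \<Longrightarrow> finite (T i)"
  shows "(\<Sum>i\<in>I. real (card (T i)))\<^sup>2 \<le> real (card (\<Union>i\<in>I. T i)) * (\<Sum>i\<in>I. \<Sum>j\<in>I. real (card (T i \<inter> T j)))"
proof -
  define U where "U = (\<Union>i\<in>I. T i)"
  have fin: "finite U" using assms by (simp add: U_def)
  define e where "e i t = (if t \<in> T i then 1 else 0 :: real)" for i t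
  have card: "(\<Sum>t\<in>U. e i t) = real (card (T i))" if "i \<in> I" for i
  proof -
    have "U \<inter> T i = T i" using that by (auto simp: U_def)
    then show ?thesis using fin by (simp add: e_def sum.If_cases Int_def)
  qed
  have card2: "(\<Sum>t\<in>U. e i t * e j t) = real (card (T i \<inter> T j))" if "i \<in> I" for i j
  proof -
    have "(\<Sum>t\<in>U. e i t * e j t) = (\<Sum>t\<in>U. if t \<in> T i \<inter> T j then 1 else 0)"
      by (intro sum.cong) (auto simp: e_def)
    also have "\<dots> = real (card (U \<inter> (T i \<inter> T j)))" using fin by (simp add: sum.If_cases Int_def)
    also have "U \<inter> (T i \<inter> T j) = T i \<inter> T j" using that by (auto simp: U_def)
    finally show ?thesis .
  qed
  have "(\<Sum>i\<in>I. real (card (T i))) = (\<Sum>i\<in>I. \<Sum>t\<in>U. e i t)" by (intro sum.cong refl card [symmetric])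
  also have "\<dots> = (\<Sum>t\<in>U. 1 * (\<Sum>i\<in>I. e i t))" by (subst sum.swap) simp
  finally have "(\<Sum>i\<in>I. real (card (T i)))\<^sup>2 = (\<Sum>t\<in>U. 1 * (\<Sum>i\<in>I. e i t))\<^sup>2" by simp
  also have "\<dots> \<le> (\<Sum>t\<in>U. 1\<^sup>2) * (\<Sum>t\<in>U. (\<Sum>i\<in>I. e i t)\<^sup>2)" by (rule Cauchy_Schwarz_ineq_sum)
  also have "(\<Sum>t\<in>U. (\<Sum>i\<in>I. e i t)\<^sup>2) = (\<Sum>t\<in>U. \<Sum>i\<in>I. \<Sum>j\<in>I. e i t * e j t)"
    by (simp add: power2_eq_square sum_product)
  also have "\<dots> = (\<Sum>i\<in>I. \<Sum>t\<in>U. \<Sum>j\<in>I. e i t * e j t)" by (rule sum.swap)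
  also have "\<dots> = (\<Sum>i\<in>I. \<Sum>j\<in>I. \<Sum>t\<in>U. e i t * e j t)" by (intro sum.cong refl sum.swap)
  also have "\<dots> = (\<Sum>i\<in>I. \<Sum>j\<in>I. real (card (T i \<inter> T j)))" by (intro sum.cong refl card2)
  finally show ?thesis by (simp add: U_def)
qed

section \<open>The second moment\<close>

lemma prime_form_set_Un: "prime_form_set (FS \<union> FS') v = prime_form_set FS v \<inter> prime_form_set FS' v"
  by (auto simp: prime_form_set_def prime_forms_def)

text \<open>The cost of the additional primality condition when two forms with coefficients \<open>a\<close> and \<open>b\<close> are
  compared.\<close>

abbreviation wt :: "real \<Rightarrow> nat \<Rightarrow> nat \<Rightarrow> real" where
  "wt X a b \<equiv> if a = b then 1 else 1 / X"

text \<open>The two systems always share the form \<open>n\<close>, and a form with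
  \<open>+ 1\<close> never equals one with \<open>- 1\<close>. So the union has three forms and one
  more for each of \<open>a \<noteq> a'\<close> and \<open>b \<noteq> b'\<close>; each further form
  costs a factor \<open>X\<close>.\<close>

lemma pair_forms_Un_power:
  assumes "a > 0" "b > 0" "a' > 0" "b' > 0"
  shows "1 / (X::real) ^ card (pair_forms a b \<union> pair_forms a' b')
    = 1 / X ^ 3 * wt X a a' * wt X b b'"
proof -
  have eq: "pair_forms a b \<union> pair_forms a' b'
      = {(1, 0), (6 * int a, 1), (6 * int b, -1)} \<union> {(6 * int a', 1), (6 * int b', -1)}"
    by (auto simp: pair_forms_def)
  have "card (pair_forms a b \<union> pair_forms a' b') = 3 + (if a = a' then 0 else 1) + (if b = b' then 0 else 1)"
    unfolding eq using assms by (cases "a = a'"; cases "b = b'") (simp_all add: insert_commute card_insert_if)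
  then show ?thesis by (simp add: power_add power3_eq_cube)
qed

lemma pair_forms_Un_props:
  assumes ab: "a > 0" "b > 0" "a' > 0" "b' > 0"
    and le: "6 * real a \<le> B" "6 * real b \<le> B" "6 * real a' \<le> B" "6 * real b' \<le> B" "1 \<le> B"
  defines "FS \<equiv> pair_forms a b \<union> pair_forms a' b'"
  shows "finite FS" "card FS \<le> 5"
    "\<And>c d. (c, d) \<in> FS \<Longrightarrow> 0 < c \<and> real_of_int c \<le> B \<and> \<bar>d\<bar> \<le> 1"
    "\<And>c d c' d'. (c, d) \<in> FS \<Longrightarrow> (c', d') \<in> FS \<Longrightarrow> (c, d) \<noteq> (c', d') \<Longrightarrow> c * d' - c' * d \<noteq> 0"
proof -
  have eq: "FS = {(1, 0), (6 * int a, 1), (6 * int b, -1), (6 * int a', 1), (6 * int b', -1)}"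
    by (auto simp: FS_def pair_forms_def)
  show "finite FS" by (simp add: eq)
  show "card FS \<le> 5" unfolding eq by (simp add: card_insert_if)
  show "0 < c \<and> real_of_int c \<le> B \<and> \<bar>d\<bar> \<le> 1" if "(c, d) \<in> FS" for c d
    using that ab le unfolding eq by auto
  show "c * d' - c' * d \<noteq> 0" if "(c, d) \<in> FS" "(c', d') \<in> FS" "(c, d) \<noteq> (c', d')" for c d c' d'
    using that ab unfolding eq by auto
qed

lemma power_scale_le:
  assumes "X > 0" "r \<ge> 1" "v \<ge> X / r" "k \<le> (5::nat)"
  shows "1 / v ^ k \<le> r ^ 5 * (1 / X ^ k :: real)"
proof -
  have "1 / v ^ k \<le> 1 / (X / r) ^ k"
    using assms by (intro divide_left_mono power_mono mult_pos_pos zero_less_power) (auto intro: less_le_trans[of _ "X / r"])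
  also have "\<dots> = r ^ k * (1 / X ^ k)" by (simp add: power_divide)
  also have "\<dots> \<le> r ^ 5 * (1 / X ^ k)"
    using assms by (intro mult_right_mono power_increasing) auto
  finally show ?thesis .
qed

text \<open>The range of \<open>n1\<close> depends on \<open>n2\<close>, \<open>n3\<close> and ensures \<open>216 * m * n1 * n2 * n3 \<le> exp X\<close>.\<close>

definition form_triples :: "real \<Rightarrow> real \<Rightarrow> nat \<Rightarrow> (int \<times> int) set \<Rightarrow> (int \<times> int) set \<Rightarrow> (int \<times> int) set \<Rightarrow> (nat \<times> nat \<times> nat) set" where
  "form_triples X V m F1 F2 F3 =
    (SIGMA n3:prime_form_set F3 V. SIGMA n2:prime_form_set F2 (X / 10).
      prime_form_set F1 (X - ln (216 * real m) - ln (real n2) - ln (real n3)))"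

text \<open>The ranges depend on \<open>m\<close> but not on the forms. So triples that serve two
  representations are again triples of the same kind, with up to five forms per coordinate, and the
  same sieve bound applies.\<close>

lemma form_triples_Int:
  "form_triples X V m F1 F2 F3 \<inter> form_triples X V m G1 G2 G3
    = form_triples X V m (F1 \<union> G1) (F2 \<union> G2) (F3 \<union> G3)"
  by (auto simp: form_triples_def prime_form_set_Un)

lemma finite_form_triples [simp]: "finite (form_triples X V m F1 F2 F3)"
  unfolding form_triples_def by (intro finite_SigmaI) simp_all

lemma card_form_triples:
  "real (card (form_triples X V m F1 F2 F3)) = (\<Sum>n3\<in>prime_form_set F3 V. \<Sum>n2\<in>prime_form_set F2 (X / 10).
      real (card (prime_form_set F1 (X - ln (216 * real m) - ln (real n2) - ln (real n3)))))"
  unfolding form_triples_def by (simp add: card_SigmaI)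

lemma sum_sum_product:
  fixes E :: real
  shows "(\<Sum>a\<in>A. \<Sum>b\<in>B. E * f a * g b) = E * sum f A * sum g B"
  by (simp flip: sum_distrib_left sum_distrib_right)

text \<open>\<open>n1\<close> takes up what \<open>m\<close>, \<open>n2\<close> and
  \<open>n3\<close> leave of \<open>exp X\<close>. As these are small, \<open>v\<close> has the
  order of \<open>X\<close>, and the number of \<open>n1\<close> is proportional to
  \<open>1 / (n2 * n3)\<close>, so that the sums over \<open>n2\<close> and \<open>n3\<close>
  separate.\<close>

lemma top_range:
  assumes "n2 \<in> prime_form_set F2 (X / 10)" "n3 \<in> prime_form_set F3 V"
    and "0 < m" "216 * real m \<le> exp (X / 4)" "0 \<le> V" "V \<le> X / 10"
  defines "v \<equiv> X - ln (216 * real m) - ln (real n2) - ln (real n3)"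
  shows "X / 2 \<le> v" "v \<le> X" "exp v = exp X / (216 * real m) * (1 / real n2) * (1 / real n3)"
proof -
  have n: "real n2 > 0" "real n3 > 0" "real n2 \<ge> 1" "real n3 \<ge> 1" "real n2 \<le> exp (X / 10)" "real n3 \<le> exp V"
    using assms(1,2) prime_form_set_sub[of F2 "X / 10"] prime_form_set_sub[of F3 V] by force+
  have "ln (216 * real m) \<le> ln (exp (X / 4))" using assms(3,4) by (intro ln_mono) auto
  moreover have "ln (real n2) \<le> ln (exp (X / 10))" using n by (intro ln_mono) auto
  moreover have "ln (real n3) \<le> ln (exp V)" using n by (intro ln_mono) auto
  ultimately show "X / 2 \<le> v" using assms(5,6) unfolding v_def by simp
  have "ln (216 * real m) \<ge> 0" "ln (real n2) \<ge> 0" "ln (real n3) \<ge> 0" using n assms(3) by auto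
  then show "v \<le> X" unfolding v_def by linarith
  show "exp v = exp X / (216 * real m) * (1 / real n2) * (1 / real n3)"
    unfolding v_def using n assms(3) by (simp add: exp_diff)
qed

text \<open>What \<open>Hypothesis_UL\<close> supplies with \<open>A = 1\<close>, on the logarithmic
  scale. \<open>V / 4\<close> is the smallest scale that occurs, the lower cut-off for
  \<open>n3\<close>.\<close>

abbreviation (input) prime_pair_lower :: "real \<Rightarrow> real \<Rightarrow> prop" where
  "PROP prime_pair_lower c V \<equiv> (\<And>w a b. V / 4 \<le> w \<Longrightarrow> a > 0 \<Longrightarrow> b > 0 \<Longrightarrow> 6 * real a \<le> exp w \<Longrightarrow> 6 * real b \<le> exp w \<Longrightarrow>
      real (card (prime_forms_le (pair_forms a b) (exp w))) \<ge> c * (exp w / w ^ 3))"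

text \<open>What the sieve supplies. \<open>K\<close> may depend on \<open>X\<close> and will be of
  order \<open>(ln X) ^ 10\<close>; five forms arise when two representations are compared.\<close>

abbreviation (input) prime_forms_upper :: "real \<Rightarrow> real \<Rightarrow> real \<Rightarrow> prop" where
  "PROP prime_forms_upper K V X \<equiv> (\<And>w FS. V / 4 \<le> w \<Longrightarrow> w \<le> X \<Longrightarrow> finite FS \<Longrightarrow> card FS \<le> 5 \<Longrightarrow>
      (\<And>c d. (c, d) \<in> FS \<Longrightarrow> 0 < c \<and> real_of_int c \<le> exp X \<and> \<bar>d\<bar> \<le> 1) \<Longrightarrow>
      (\<And>c d c' d'. (c, d) \<in> FS \<Longrightarrow> (c', d') \<in> FS \<Longrightarrow> (c, d) \<noteq> (c', d') \<Longrightarrow> c * d' - c' * d \<noteq> 0) \<Longrightarrow>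
      real (card (prime_forms_le FS (exp w))) \<le> K * (exp w / w ^ card FS))"

text \<open>\<open>X ^ 5 * V ^ 2\<close> collects the primality costs: \<open>X ^ 3\<close> for
  \<open>n1\<close>, but only \<open>X ^ 2\<close> and \<open>V ^ 2\<close> for \<open>n2\<close>
  and \<open>n3\<close>, because summing their reciprocals over a logarithmic range gives one factor
  back.\<close>

lemma card_form_triples_lower:
  assumes c: "c > 0" and V: "V \<ge> 16" "V \<le> X / 10"
    and lo: "PROP prime_pair_lower c V"
    and small: "\<And>v. v \<ge> V \<Longrightarrow> exp (v / 4) + 1 \<le> c / 2 * (exp (v / 2) / v ^ 3)"
    and m: "0 < m" "216 * real m \<le> exp (X / 4)"
    and pos: "a1 > 0" "a2 > 0" "a3 > 0" "b1 > 0" "b2 > 0" "b3 > 0"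
    and le: "6 * real a1 \<le> exp (X / 40)" "6 * real b1 \<le> exp (X / 40)"
      "6 * real a2 \<le> exp (X / 40)" "6 * real b2 \<le> exp (X / 40)"
      "6 * real a3 \<le> exp (V / 4)" "6 * real b3 \<le> exp (V / 4)"
  shows "real (card (form_triples X V m (pair_forms a1 b1) (pair_forms a2 b2) (pair_forms a3 b3)))
    \<ge> c ^ 3 / 300 * (exp X / real m) / (X ^ 5 * V ^ 2)"
proof -
  have lo': "real (card (prime_forms_le (pair_forms a b) (exp w))) \<ge> c * (exp w / w ^ 3)"
    if "V \<le> v" "v / 4 \<le> w" "a > 0" "b > 0" "6 * real a \<le> exp (v / 4)" "6 * real b \<le> exp (v / 4)" for v w a b
  proof (rule lo)
    have "exp (v / 4) \<le> exp w" using that by simp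
    then show "6 * real a \<le> exp w" "6 * real b \<le> exp w" using that by linarith+
  qed (use that in auto)
  have 3: "(\<Sum>n\<in>prime_form_set (pair_forms a3 b3) V. 1 / real n) \<ge> c / 8 * (1 / V ^ 2)"
    by (rule sum_prime_form_set_lower[OF c V(1) small[OF order.refl] lo'[OF order.refl]]) (use pos le in auto)
  have X: "X / 10 \<ge> 16" "X \<ge> 160" using V by auto
  have 2: "(\<Sum>n\<in>prime_form_set (pair_forms a2 b2) (X / 10). 1 / real n) \<ge> c / 8 * (1 / (X / 10) ^ 2)"
    by (rule sum_prime_form_set_lower[OF c X(1) small[OF V(2)] lo'[OF V(2)]]) (use pos le in auto)
  define E where "E = c / 2 * (exp X / (216 * real m)) / X ^ 3"
  have E: "E \<ge> 0" using c m X by (simp add: E_def)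
  have "E * (c / 8 * (1 / V ^ 2)) * (c / 8 * (1 / (X / 10) ^ 2))
      \<le> E * (\<Sum>n\<in>prime_form_set (pair_forms a3 b3) V. 1 / real n) * (\<Sum>n\<in>prime_form_set (pair_forms a2 b2) (X / 10). 1 / real n)"
    using E c X V 2 3 by (intro mult_mono mult_left_mono mult_nonneg_nonneg) (auto intro!: sum_nonneg)
  also have "\<dots> = (\<Sum>n3\<in>prime_form_set (pair_forms a3 b3) V. \<Sum>n2\<in>prime_form_set (pair_forms a2 b2) (X / 10).
      E * (1 / real n3) * (1 / real n2))"
    by (rule sum_sum_product [symmetric])
  also have "\<dots> \<le> real (card (form_triples X V m (pair_forms a1 b1) (pair_forms a2 b2) (pair_forms a3 b3)))"
    unfolding card_form_triples
  proof (intro sum_mono)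
    fix n3 n2 assume n: "n3 \<in> prime_form_set (pair_forms a3 b3) V" "n2 \<in> prime_form_set (pair_forms a2 b2) (X / 10)"
    define v where "v = X - ln (216 * real m) - ln (real n2) - ln (real n3)"
    have "0 \<le> V" using V by simp
    note v = top_range[OF n(2,1) m this V(2), folded v_def]
    have vV: "V \<le> v" "v \<ge> 1" using v X V by linarith+
    have "exp (X / 40) \<le> exp (v / 4)" using v by simp
    then have le1: "6 * real a1 \<le> exp (v / 4)" "6 * real b1 \<le> exp (v / 4)" using le by linarith+
    have "c / 2 * (exp v / v ^ 3) \<le> real (card {n\<in>prime_form_set (pair_forms a1 b1) v. real n \<le> exp v})"
      by (rule card_prime_form_set_lower[OF c vV(2) small[OF vV(1)] lo'[OF vV(1)]]) (use pos le1 vV in auto)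
    also have "{n\<in>prime_form_set (pair_forms a1 b1) v. real n \<le> exp v} = prime_form_set (pair_forms a1 b1) v"
      by (auto simp: prime_form_set_def)
    finally have *: "c / 2 * (exp v / v ^ 3) \<le> real (card (prime_form_set (pair_forms a1 b1) v))" .
    have "E * (1 / real n3) * (1 / real n2) = c / 2 * (exp v / X ^ 3)" by (simp add: E_def v(3))
    also have "\<dots> \<le> c / 2 * (exp v / v ^ 3)"
      using v vV c X by (intro mult_left_mono divide_left_mono power_mono) auto
    finally show "E * (1 / real n3) * (1 / real n2) \<le> real (card (prime_form_set (pair_forms a1 b1)
        (X - ln (216 * real m) - ln (real n2) - ln (real n3))))"
      using * unfolding v_def by linarith
  qed
  finally have "E * (c / 8 * (1 / V ^ 2)) * (c / 8 * (1 / (X / 10) ^ 2)) \<le>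
    real (card (form_triples X V m (pair_forms a1 b1) (pair_forms a2 b2) (pair_forms a3 b3)))" .
  moreover have "c ^ 3 / 300 * (exp X / real m) / (X ^ 5 * V ^ 2) \<le> E * (c / 8 * (1 / V ^ 2)) * (c / 8 * (1 / (X / 10) ^ 2))"
  proof -
    have "E * (c / 8 * (1 / V ^ 2)) * (c / 8 * (1 / (X / 10) ^ 2))
        = 100 / 27648 * (c ^ 3 * (exp X / real m) / (X ^ 5 * V ^ 2))"
      by (simp add: E_def power2_eq_square power3_eq_cube power_divide eval_nat_numeral mult_ac)
    moreover have "1 / 300 * (c ^ 3 * (exp X / real m) / (X ^ 5 * V ^ 2)) \<le> 100 / 27648 * (c ^ 3 * (exp X / real m) / (X ^ 5 * V ^ 2))"
      using c X V by (intro mult_right_mono) auto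
    ultimately show ?thesis by simp
  qed
  ultimately show ?thesis by linarith
qed

text \<open>Apart from constants, this is the order of \<open>card_form_triples_lower\<close> times
  a factor for each coefficient that differs. The factors for the \<open>a\<close> and for the
  \<open>b\<close> are kept apart so that the second moment factors.\<close>

lemma card_form_triples_upper:
  assumes K: "K > 0" and V: "V \<ge> 16" "V \<le> X / 10"
    and up: "PROP prime_forms_upper K V X"
    and m: "0 < m" "216 * real m \<le> exp (X / 4)"
    and pos: "a1 > 0" "a2 > 0" "a3 > 0" "b1 > 0" "b2 > 0" "b3 > 0"
      "a1' > 0" "a2' > 0" "a3' > 0" "b1' > 0" "b2' > 0" "b3' > 0"
    and le: "\<And>a. a \<in> {a1, a2, a3, b1, b2, b3, a1', a2', a3', b1', b2', b3'} \<Longrightarrow> 6 * real a \<le> exp X"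
  shows "real (card (form_triples X V m (pair_forms a1 b1 \<union> pair_forms a1' b1')
      (pair_forms a2 b2 \<union> pair_forms a2' b2') (pair_forms a3 b3 \<union> pair_forms a3' b3')))
    \<le> 2 * 10 ^ 11 * K ^ 3 * (exp X / real m) / (X ^ 5 * V ^ 2)
      * (wt X a1 a1' * wt X a2 a2' * wt V a3 a3')
      * (wt X b1 b1' * wt X b2 b2' * wt V b3 b3')"
proof -
  have X: "X \<ge> 160" "exp X \<ge> 1" using V by auto
  define F1 where "F1 = pair_forms a1 b1 \<union> pair_forms a1' b1'"
  define F2 where "F2 = pair_forms a2 b2 \<union> pair_forms a2' b2'"
  define F3 where "F3 = pair_forms a3 b3 \<union> pair_forms a3' b3'"
  have le1: "6 * real a1 \<le> exp X" "6 * real b1 \<le> exp X" "6 * real a1' \<le> exp X" "6 * real b1' \<le> exp X"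
    and le2: "6 * real a2 \<le> exp X" "6 * real b2 \<le> exp X" "6 * real a2' \<le> exp X" "6 * real b2' \<le> exp X"
    and le3: "6 * real a3 \<le> exp X" "6 * real b3 \<le> exp X" "6 * real a3' \<le> exp X" "6 * real b3' \<le> exp X"
    by (auto intro!: le)
  note F1 = pair_forms_Un_props[OF pos(1,4,7,10) le1 X(2), folded F1_def]
  note F2 = pair_forms_Un_props[OF pos(2,5,8,11) le2 X(2), folded F2_def]
  note F3 = pair_forms_Un_props[OF pos(3,6,9,12) le3 X(2), folded F3_def]
  have up1: "real (card (prime_forms_le F1 (exp w))) \<le> K * (exp w / w ^ card F1)"
    if "V / 4 \<le> w" "w \<le> X" for w by (rule up[OF that F1])
  have up2: "real (card (prime_forms_le F2 (exp w))) \<le> K * (exp w / w ^ card F2)"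
    if "V / 4 \<le> w" "w \<le> X" for w by (rule up[OF that F2])
  have up3: "real (card (prime_forms_le F3 (exp w))) \<le> K * (exp w / w ^ card F3)"
    if "V / 4 \<le> w" "w \<le> X" for w by (rule up[OF that F3])
  have "(\<Sum>n\<in>prime_form_set F3 V. 1 / real n) \<le> 3 * K * 4 ^ card F3 * (V / V ^ card F3)"
    by (rule sum_prime_form_set_upper) (use V K up3 in auto)
  also have "\<dots> \<le> 3 * K * 4 ^ 5 * (V / V ^ card F3)"
    using F3(2) K V by (intro mult_right_mono mult_left_mono power_increasing) auto
  finally have 3: "(\<Sum>n\<in>prime_form_set F3 V. 1 / real n) \<le> 3072 * K * (V / V ^ card F3)" by simp
  have "(\<Sum>n\<in>prime_form_set F2 (X / 10). 1 / real n) \<le> 3 * K * 4 ^ card F2 * ((X / 10) / (X / 10) ^ card F2)"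
    by (rule sum_prime_form_set_upper) (use V K up2 in auto)
  also have "\<dots> \<le> 3 * K * 4 ^ 5 * ((X / 10) / (X / 10) ^ card F2)"
    using F2(2) K X by (intro mult_right_mono mult_left_mono power_increasing) auto
  also have "(X / 10) / (X / 10) ^ card F2 = X / 10 * (1 / (X / 10) ^ card F2)" by simp
  also have "1 / (X / 10) ^ card F2 \<le> 10 ^ 5 * (1 / X ^ card F2)"
    using X F2(2) by (intro power_scale_le) auto
  finally have 2: "(\<Sum>n\<in>prime_form_set F2 (X / 10). 1 / real n) \<le> 30720000 * K * (X / X ^ card F2)"
    using K X by (simp add: mult_left_mono)
  define E where "E = 32 * K * (exp X / (216 * real m)) / X ^ card F1"
  have E: "E \<ge> 0" using K m X by (simp add: E_def)
  have "real (card (form_triples X V m F1 F2 F3)) \<le> (\<Sum>n3\<in>prime_form_set F3 V. \<Sum>n2\<in>prime_form_set F2 (X / 10).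
      E * (1 / real n3) * (1 / real n2))"
    unfolding card_form_triples
  proof (intro sum_mono)
    fix n3 n2 assume n: "n3 \<in> prime_form_set F3 V" "n2 \<in> prime_form_set F2 (X / 10)"
    define v where "v = X - ln (216 * real m) - ln (real n2) - ln (real n3)"
    have "0 \<le> V" using V by simp
    note v = top_range[OF n(2,1) m this V(2), folded v_def]
    have vV: "V / 4 \<le> v" using v X V by linarith
    have "real (card (prime_form_set F1 v)) \<le> K * (exp v / v ^ card F1)"
      by (rule card_prime_form_set_upper[OF up1[OF vV v(2)]])
    also have "\<dots> = K * exp v * (1 / v ^ card F1)" by simp
    also have "\<dots> \<le> K * exp v * (2 ^ 5 * (1 / X ^ card F1))"
      using K X v F1(2) by (intro mult_left_mono power_scale_le) auto
    also have "\<dots> = E * (1 / real n3) * (1 / real n2)" by (simp add: E_def v(3))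
    finally show "real (card (prime_form_set F1 (X - ln (216 * real m) - ln (real n2) - ln (real n3))))
      \<le> E * (1 / real n3) * (1 / real n2)" unfolding v_def .
  qed
  also have "\<dots> = E * (\<Sum>n\<in>prime_form_set F3 V. 1 / real n) * (\<Sum>n\<in>prime_form_set F2 (X / 10). 1 / real n)"
    by (rule sum_sum_product)
  also have "\<dots> \<le> E * (3072 * K * (V / V ^ card F3)) * (30720000 * K * (X / X ^ card F2))"
    using E K X V 2 3 by (intro mult_mono mult_left_mono mult_nonneg_nonneg) (auto intro!: sum_nonneg)
  also have "\<dots> = 32 / 216 * 3072 * 30720000 * K ^ 3 * (exp X / real m) * X * V
      * (1 / X ^ card F1) * (1 / X ^ card F2) * (1 / V ^ card F3)"
    by (simp add: E_def power3_eq_cube mult_ac)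
  also have "\<dots> = 32 / 216 * 3072 * 30720000 * (K ^ 3 * (exp X / real m) / (X ^ 5 * V ^ 2)
      * (wt X a1 a1' * wt X a2 a2' * wt V a3 a3')
      * (wt X b1 b1' * wt X b2 b2' * wt V b3 b3'))"
    unfolding F1_def F2_def F3_def pair_forms_Un_power[OF pos(1,4,7,10)] pair_forms_Un_power[OF pos(2,5,8,11)]
      pair_forms_Un_power[OF pos(3,6,9,12)]
    using X V by (simp add: divide_simps) (simp add: eval_nat_numeral)
  also have "\<dots> \<le> 2 * 10 ^ 11 * (K ^ 3 * (exp X / real m) / (X ^ 5 * V ^ 2)
      * (wt X a1 a1' * wt X a2 a2' * wt V a3 a3')
      * (wt X b1 b1' * wt X b2 b2' * wt V b3 b3'))"
    using K X V by (intro mult_right_mono mult_nonneg_nonneg divide_nonneg_nonneg) auto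
  finally show ?thesis unfolding F1_def F2_def F3_def by (simp only: mult.assoc divide_inverse)
qed

text \<open>The first index supplies the coefficients for the totient, the second those for the
  divisor sum. With \<open>Z\<close> and \<open>N\<close> from the proof, the first moment is at
  least of order \<open>c ^ 3 * Z * N\<^sup>2\<close>, and since the weights factor, the second is
  at most of order \<open>K ^ 3 * Z * (N * G)\<^sup>2\<close>. The claim is the quotient of the
  squared first moment by the second.\<close>

lemma card_form_triples_Union:
  fixes I :: "'i set" and a1 a2 a3 :: "'i \<Rightarrow> nat"
  assumes I: "finite I" "I \<noteq> {}" and c: "c > 0" and K: "K > 0" and G: "G > 0" and V: "V \<ge> 16" "V \<le> X / 10"
    and lo: "PROP prime_pair_lower c V"
    and small: "\<And>v. v \<ge> V \<Longrightarrow> exp (v / 4) + 1 \<le> c / 2 * (exp (v / 2) / v ^ 3)"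
    and up: "PROP prime_forms_upper K V X"
    and m: "0 < m" "216 * real m \<le> exp (X / 4)"
    and pos: "\<And>i. i \<in> I \<Longrightarrow> a1 i > 0 \<and> a2 i > 0 \<and> a3 i > 0"
    and le: "\<And>i. i \<in> I \<Longrightarrow> 6 * real (a1 i) \<le> exp (X / 40)" "\<And>i. i \<in> I \<Longrightarrow> 6 * real (a2 i) \<le> exp (X / 40)"
      "\<And>i. i \<in> I \<Longrightarrow> 6 * real (a3 i) \<le> exp (V / 4)"
    and wt: "\<And>i. i \<in> I \<Longrightarrow> (\<Sum>j\<in>I. wt X (a1 i) (a1 j) * wt X (a2 i) (a2 j)
        * wt V (a3 i) (a3 j)) \<le> G"
  shows "real (card (\<Union>(i, j)\<in>I \<times> I. form_triples X V m (pair_forms (a1 i) (a1 j)) (pair_forms (a2 i) (a2 j)) (pair_forms (a3 i) (a3 j))))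
    \<ge> c ^ 6 / (2 * 10 ^ 16 * K ^ 3 * G ^ 2) * real (card I) ^ 2 * (exp X / real m) / (X ^ 5 * V ^ 2)"
proof -
  define T where "T = (\<lambda>(i, j). form_triples X V m (pair_forms (a1 i) (a1 j)) (pair_forms (a2 i) (a2 j)) (pair_forms (a3 i) (a3 j)))"
  define w where "w i j = wt X (a1 i) (a1 j) * wt X (a2 i) (a2 j)
        * wt V (a3 i) (a3 j)" for i j
  define Z where "Z = (exp X / real m) / (X ^ 5 * V ^ 2)"
  define N where "N = real (card I)"
  have X: "X \<ge> 160" using V by auto
  have Z: "Z > 0" using m X V by (simp add: Z_def)
  have N: "N > 0" using I by (simp add: N_def card_gt_0_iff)
  have w0: "w i j \<ge> 0" for i j using X V by (simp add: w_def)
  define U where "U = real (card (\<Union>k\<in>I \<times> I. T k))"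
  have leX: "6 * real (a1 i) \<le> exp X \<and> 6 * real (a2 i) \<le> exp X \<and> 6 * real (a3 i) \<le> exp X" if "i \<in> I" for i
  proof -
    have "exp (X / 40) \<le> exp X" "exp (V / 4) \<le> exp X" using X V by auto
    then show ?thesis using le[OF that] by linarith
  qed
  have lower: "c ^ 3 / 300 * Z \<le> real (card (T k))" if k: "k \<in> I \<times> I" for k
  proof -
    obtain i j where ij: "k = (i, j)" "i \<in> I" "j \<in> I" using k by auto
    have "c ^ 3 / 300 * (exp X / real m) / (X ^ 5 * V ^ 2) \<le> real (card (T k))"
      unfolding T_def ij(1) prod.case
      using pos[OF ij(2)] pos[OF ij(3)] le[OF ij(2)] le[OF ij(3)]
      by (intro card_form_triples_lower[OF c V lo small m]) auto
    then show ?thesis by (simp add: Z_def)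
  qed
  have upper: "real (card (T k \<inter> T k')) \<le> 2 * 10 ^ 11 * K ^ 3 * Z * (w (fst k) (fst k') * w (snd k) (snd k'))"
    if kk: "k \<in> I \<times> I" "k' \<in> I \<times> I" for k k'
  proof -
    obtain i j where ij: "k = (i, j)" "i \<in> I" "j \<in> I" using kk by auto
    obtain i' j' where ij': "k' = (i', j')" "i' \<in> I" "j' \<in> I" using kk by auto
    have "real (card (T k \<inter> T k')) \<le> 2 * 10 ^ 11 * K ^ 3 * (exp X / real m) / (X ^ 5 * V ^ 2) * w i i' * w j j'"
      unfolding T_def ij(1) ij'(1) prod.case form_triples_Int w_def
      using pos[OF ij(2)] pos[OF ij(3)] pos[OF ij'(2)] pos[OF ij'(3)] leX[OF ij(2)] leX[OF ij(3)] leX[OF ij'(2)] leX[OF ij'(3)]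
      by (intro card_form_triples_upper[OF K V up m]) auto
    then show ?thesis by (simp add: Z_def ij(1) ij'(1) mult.assoc)
  qed
  have "(c ^ 3 / 300 * Z * N ^ 2) = (\<Sum>k\<in>I \<times> I. c ^ 3 / 300 * Z)"
    by (simp add: card_cartesian_product N_def power2_eq_square)
  also have "\<dots> \<le> (\<Sum>k\<in>I \<times> I. real (card (T k)))" by (rule sum_mono[OF lower])
  finally have "(c ^ 3 / 300 * Z * N ^ 2)\<^sup>2 \<le> (\<Sum>k\<in>I \<times> I. real (card (T k)))\<^sup>2"
    using c Z by (intro power_mono) auto
  also have "\<dots> \<le> U * (\<Sum>k\<in>I \<times> I. \<Sum>k'\<in>I \<times> I. real (card (T k \<inter> T k')))"
    unfolding U_def by (rule card_Union_second_moment) (use I in \<open>auto simp: T_def\<close>)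
  also have "\<dots> \<le> U * (2 * 10 ^ 11 * K ^ 3 * Z * (N * G) ^ 2)"
  proof (rule mult_left_mono)
    have "(\<Sum>k\<in>I \<times> I. \<Sum>k'\<in>I \<times> I. real (card (T k \<inter> T k')))
        \<le> (\<Sum>k\<in>I \<times> I. \<Sum>k'\<in>I \<times> I. 2 * 10 ^ 11 * K ^ 3 * Z * (w (fst k) (fst k') * w (snd k) (snd k')))"
      by (intro sum_mono upper)
    also have "\<dots> = 2 * 10 ^ 11 * K ^ 3 * Z * (\<Sum>k\<in>I \<times> I. \<Sum>k'\<in>I \<times> I. w (fst k) (fst k') * w (snd k) (snd k'))"
      by (simp only: sum_distrib_left)
    also have "(\<Sum>k\<in>I \<times> I. \<Sum>k'\<in>I \<times> I. w (fst k) (fst k') * w (snd k) (snd k'))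
        = (\<Sum>i\<in>I. \<Sum>j\<in>I. \<Sum>i'\<in>I. \<Sum>j'\<in>I. w i i' * w j j')"
      by (simp add: sum.cartesian_product')
    also have "\<dots> = (\<Sum>i\<in>I. \<Sum>j\<in>I. (\<Sum>i'\<in>I. w i i') * (\<Sum>j'\<in>I. w j j'))"
      by (simp only: sum_product)
    also have "\<dots> = (\<Sum>i\<in>I. \<Sum>i'\<in>I. w i i') * (\<Sum>j\<in>I. \<Sum>j'\<in>I. w j j')"
      by (simp only: sum_product)
    also have "\<dots> = (\<Sum>i\<in>I. \<Sum>i'\<in>I. w i i') ^ 2" by (simp add: power2_eq_square)
    also have "\<dots> \<le> (N * G) ^ 2"
    proof (rule power_mono)
      have "(\<Sum>i\<in>I. \<Sum>i'\<in>I. w i i') \<le> (\<Sum>i\<in>I. G)" unfolding w_def by (rule sum_mono[OF wt])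
      then show "(\<Sum>i\<in>I. \<Sum>i'\<in>I. w i i') \<le> N * G" by (simp add: N_def)
    qed (intro sum_nonneg w0)
    finally show "(\<Sum>k\<in>I \<times> I. \<Sum>k'\<in>I \<times> I. real (card (T k \<inter> T k'))) \<le> 2 * 10 ^ 11 * K ^ 3 * Z * (N * G) ^ 2"
      using K Z by (simp add: mult_left_mono)
  qed (simp add: U_def)
  finally have main: "(c ^ 3 / 300 * Z * N ^ 2)\<^sup>2 \<le> U * (2 * 10 ^ 11 * K ^ 3 * Z * (N * G) ^ 2)" .
  define D where "D = 2 * 10 ^ 11 * K ^ 3 * Z * (N * G) ^ 2"
  have D: "D > 0" using K Z N G by (simp add: D_def)
  have "(c ^ 3 / 300 * Z * N ^ 2)\<^sup>2 / D \<le> U"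
    using main D unfolding D_def [symmetric] by (simp add: pos_divide_le_eq)
  moreover have "(c ^ 3 / 300 * Z * N ^ 2)\<^sup>2 / D = c ^ 6 / (18 * 10 ^ 15 * K ^ 3 * G ^ 2) * N ^ 2 * Z"
    unfolding D_def using Z N K G by (simp add: power_mult_distrib power_divide power2_eq_square eval_nat_numeral divide_simps)
  moreover have "c ^ 6 / (2 * 10 ^ 16 * K ^ 3 * G ^ 2) * N ^ 2 * Z \<le> c ^ 6 / (18 * 10 ^ 15 * K ^ 3 * G ^ 2) * N ^ 2 * Z"
    using c K G Z by (intro mult_right_mono divide_left_mono mult_pos_pos) auto
  ultimately have "c ^ 6 / (2 * 10 ^ 16 * K ^ 3 * G ^ 2) * N ^ 2 * Z \<le> U" by linarith
  then show ?thesis unfolding U_def T_def Z_def N_def by simp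
qed

section \<open>Factorisations into three parts\<close>

lemma prod_primes_dvd_iff:
  fixes S :: "nat set"
  assumes "finite S" "\<And>p. p \<in> S \<Longrightarrow> prime p" "prime r"
  shows "r dvd \<Prod>S \<longleftrightarrow> r \<in> S"
proof
  assume "r dvd \<Prod>S"
  then obtain p where p: "p \<in> S" "r dvd p" using assms by (auto simp: prime_dvd_prod_iff)
  then have "r = p" using assms(2,3) primes_dvd_imp_eq by blast
  then show "r \<in> S" using p by simp
next
  assume "r \<in> S"
  then show "r dvd \<Prod>S" using assms(1) by (rule dvd_prodI[rotated])
qed

lemma prod_primes_inj:
  fixes S T :: "nat set"
  assumes "finite S" "\<And>p. p \<in> S \<Longrightarrow> prime p" "finite T" "\<And>p. p \<in> T \<Longrightarrow> prime p" "\<Prod>S = \<Prod>T"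
  shows "S = T"
proof (rule Set.set_eqI)
  fix r show "r \<in> S \<longleftrightarrow> r \<in> T"
    using prod_primes_dvd_iff[of S r] prod_primes_dvd_iff[of T r] assms by metis
qed

text \<open>A triple \<open>(U, X, Y)\<close> encodes the factorisation \<open>m = a1 * a2 * a3\<close> in which the large prime factors \<open>M1\<close>
  are split evenly between \<open>a1\<close> and \<open>a2\<close>, and the small prime factors \<open>M2\<close> evenly between all three.\<close>

definition splits :: "nat set \<Rightarrow> nat set \<Rightarrow> nat \<Rightarrow> nat \<Rightarrow> (nat set \<times> nat set \<times> nat set) set" where
  "splits M1 M2 s1 s2 = {(U, X, Y). U \<subseteq> M1 \<and> card U = s1 \<and> X \<subseteq> M2 \<and> card X = s2 \<and> Y \<subseteq> M2 - X \<and> card Y = s2}"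

definition part1 :: "nat set \<times> nat set \<times> nat set \<Rightarrow> nat" where
  "part1 = (\<lambda>(U, X, Y). \<Prod>(U \<union> X))"

definition part2 :: "nat set \<Rightarrow> nat set \<times> nat set \<times> nat set \<Rightarrow> nat" where
  "part2 M1 = (\<lambda>(U, X, Y). \<Prod>((M1 - U) \<union> Y))"

definition part3 :: "nat set \<Rightarrow> nat set \<times> nat set \<times> nat set \<Rightarrow> nat" where
  "part3 M2 = (\<lambda>(U, X, Y). \<Prod>(M2 - X - Y))"

context
  fixes M1 M2 :: "nat set" and s1 s2 :: nat
  assumes fin: "finite M1" "finite M2" and disj: "M1 \<inter> M2 = {}"
    and pr: "\<And>p. p \<in> M1 \<Longrightarrow> prime p" "\<And>p. p \<in> M2 \<Longrightarrow> prime p"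
    and cM: "card M1 = 2 * s1" "card M2 = 3 * s2"
begin

lemma finite_splits: "finite (splits M1 M2 s1 s2)"
proof -
  have "splits M1 M2 s1 s2 \<subseteq> Pow M1 \<times> Pow M2 \<times> Pow M2" by (auto simp: splits_def)
  then show ?thesis by (rule finite_subset) (simp add: fin)
qed

lemma card_splits: "card (splits M1 M2 s1 s2) = ((2 * s1) choose s1) * (((3 * s2) choose s2) * ((2 * s2) choose s2))"
proof -
  have eq: "splits M1 M2 s1 s2 = {U. U \<subseteq> M1 \<and> card U = s1} \<times> (SIGMA X:{X. X \<subseteq> M2 \<and> card X = s2}. {Y. Y \<subseteq> M2 - X \<and> card Y = s2})"
    by (auto simp: splits_def)
  have "card (SIGMA X:{X. X \<subseteq> M2 \<and> card X = s2}. {Y. Y \<subseteq> M2 - X \<and> card Y = s2})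
      = (\<Sum>X\<in>{X. X \<subseteq> M2 \<and> card X = s2}. card {Y. Y \<subseteq> M2 - X \<and> card Y = s2})"
    using fin by (intro card_SigmaI) auto
  also have "\<dots> = (\<Sum>X\<in>{X. X \<subseteq> M2 \<and> card X = s2}. (2 * s2) choose s2)"
  proof (rule sum.cong[OF refl])
    fix X assume X: "X \<in> {X. X \<subseteq> M2 \<and> card X = s2}"
    then have "card (M2 - X) = 2 * s2"
      using fin cM finite_subset by (subst card_Diff_subset) auto
    then show "card {Y. Y \<subseteq> M2 - X \<and> card Y = s2} = (2 * s2) choose s2"
      using n_subsets[of "M2 - X" s2] fin by simp
  qed
  also have "\<dots> = ((3 * s2) choose s2) * ((2 * s2) choose s2)"
    using n_subsets[of M2 s2] fin cM by simp
  finally show ?thesis unfolding eq using n_subsets[of M1 s1] fin cM by (simp add: card_cartesian_product)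
qed

lemma splitsD:
  assumes "(U, X, Y) \<in> splits M1 M2 s1 s2"
  shows "U \<subseteq> M1" "X \<subseteq> M2" "Y \<subseteq> M2" "X \<inter> Y = {}" "finite U" "finite X" "finite Y"
    "card U = s1" "card X = s2" "card Y = s2"
proof -
  show *: "U \<subseteq> M1" "X \<subseteq> M2" "Y \<subseteq> M2" "X \<inter> Y = {}" "card U = s1" "card X = s2" "card Y = s2"
    using assms by (auto simp: splits_def)
  show "finite U" "finite X" "finite Y" using * fin finite_subset by blast+
qed

lemma prime_subsets: "S \<subseteq> M1 \<union> M2 \<Longrightarrow> finite S \<and> (\<forall>p\<in>S. prime p)"
  using fin pr finite_subset[of S "M1 \<union> M2"] by blast

lemma prod_subset_inj: "S \<subseteq> M1 \<union> M2 \<Longrightarrow> T \<subseteq> M1 \<union> M2 \<Longrightarrow> \<Prod>S = \<Prod>T \<Longrightarrow> S = T"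
  using prime_subsets[of S] prime_subsets[of T] prod_primes_inj[of S T] by blast

lemma prod_subset_pos: "S \<subseteq> M1 \<union> M2 \<Longrightarrow> \<Prod>S > 0"
  using prime_subsets[of S] prime_gt_0_nat by (intro prod_pos) blast

lemma part1_eqD:
  assumes "(U, X, Y) \<in> splits M1 M2 s1 s2" "(U', X', Y') \<in> splits M1 M2 s1 s2"
    "part1 (U, X, Y) = part1 (U', X', Y')"
  shows "U' = U" "X' = X"
proof -
  note d = splitsD[OF assms(1)] splitsD[OF assms(2)]
  have "U \<union> X = U' \<union> X'"
    using assms(3) d by (intro prod_subset_inj) (auto simp: part1_def)
  then show "U' = U" "X' = X" using d disj by blast+
qed

lemma part2_eqD:
  assumes "(U, X, Y) \<in> splits M1 M2 s1 s2" "(U', X', Y') \<in> splits M1 M2 s1 s2"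
    "part2 M1 (U, X, Y) = part2 M1 (U', X', Y')"
  shows "U' = U" "Y' = Y"
proof -
  note d = splitsD[OF assms(1)] splitsD[OF assms(2)]
  have "(M1 - U) \<union> Y = (M1 - U') \<union> Y'"
    using assms(3) d by (intro prod_subset_inj) (auto simp: part2_def)
  then show "U' = U" "Y' = Y" using d disj by blast+
qed

text \<open>The third component does not involve \<open>U\<close> and sees \<open>X\<close> and
  \<open>Y\<close> only through their union. Sharing it is therefore the weakest coincidence and
  leaves up to \<open>4 ^ (s1 + s2)\<close> splits.\<close>

lemma part3_eqD:
  assumes "(U, X, Y) \<in> splits M1 M2 s1 s2" "(U', X', Y') \<in> splits M1 M2 s1 s2"
    "part3 M2 (U, X, Y) = part3 M2 (U', X', Y')"
  shows "X' \<union> Y' = X \<union> Y"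
proof -
  note d = splitsD[OF assms(1)] splitsD[OF assms(2)]
  have "M2 - X - Y = M2 - X' - Y'"
    using assms(3) d by (intro prod_subset_inj) (auto simp: part3_def)
  then show ?thesis using d by blast
qed

lemma parts_pos:
  assumes "i \<in> splits M1 M2 s1 s2"
  shows "part1 i > 0 \<and> part2 M1 i > 0 \<and> part3 M2 i > 0"
proof -
  obtain U X Y where [simp]: "i = (U, X, Y)" by (cases i) auto
  have "\<Prod>(U \<union> X) > 0" "\<Prod>((M1 - U) \<union> Y) > 0" "\<Prod>(M2 - X - Y) > 0"
    using splitsD[OF assms[unfolded \<open>i = (U, X, Y)\<close>]] by (intro prod_subset_pos; blast)+
  then show ?thesis by (simp add: part1_def part2_def part3_def)
qed

lemma parts_prod:
  assumes "i \<in> splits M1 M2 s1 s2"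
  shows "part1 i * part2 M1 i * part3 M2 i = \<Prod>M1 * \<Prod>M2"
proof -
  obtain U X Y where [simp]: "i = (U, X, Y)" by (cases i) auto
  note d = splitsD[OF assms[unfolded \<open>i = (U, X, Y)\<close>]]
  have 1: "\<Prod>(U \<union> X) = \<Prod>U * \<Prod>X" using d disj by (intro prod.union_disjoint) auto
  have 2: "\<Prod>((M1 - U) \<union> Y) = \<Prod>(M1 - U) * \<Prod>Y"
    using d disj fin by (intro prod.union_disjoint) auto
  have 3: "\<Prod>M1 = \<Prod>(M1 - U) * \<Prod>U" using d fin by (intro prod.subset_diff) auto
  have 4: "\<Prod>M2 = \<Prod>(M2 - X) * \<Prod>X" using d fin by (intro prod.subset_diff) auto
  have 5: "\<Prod>(M2 - X) = \<Prod>(M2 - X - Y) * \<Prod>Y" using d fin by (intro prod.subset_diff) auto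
  show ?thesis unfolding \<open>i = (U, X, Y)\<close> part1_def part2_def part3_def prod.case 1 2 3 4 5 by simp
qed

text \<open>Sort the splits \<open>j\<close> by the components they share with \<open>i\<close>.
  Those sharing none are at most \<open>Xr ^ 2 * V\<close> many, of weight
  \<open>1 / (Xr ^ 2 * V)\<close>. Sharing only the first, or only the second, fixes
  \<open>U\<close> and one of \<open>X\<close>, \<open>Y\<close>: at most \<open>4 ^ s2\<close>
  splits of weight \<open>1 / (Xr * V)\<close>. Sharing only the third: at most
  \<open>4 ^ (s1 + s2)\<close> of weight \<open>1 / Xr ^ 2\<close>. Sharing two forces
  \<open>j = i\<close>. By the size conditions each of the five groups contributes at most
  1.\<close>

lemma splits_weight:
  fixes Xr V :: real
  assumes X: "Xr \<ge> 1" "V \<ge> 1"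
    and F: "real (card (splits M1 M2 s1 s2)) \<le> Xr ^ 2 * V"
    and s: "4 ^ s2 \<le> Xr * V" "4 ^ (s1 + s2) \<le> Xr ^ 2"
    and i: "i \<in> splits M1 M2 s1 s2"
  shows "(\<Sum>j\<in>splits M1 M2 s1 s2. wt Xr (part1 i) (part1 j) * wt Xr (part2 M1 i) (part2 M1 j)
        * wt V (part3 M2 i) (part3 M2 j)) \<le> 5"
proof -
  let ?I = "splits M1 M2 s1 s2"
  obtain U X Y where iU: "i = (U, X, Y)" by (cases i) auto
  note i' = i[unfolded iU]
  note d = splitsD[OF i']
  define J1 where "J1 = {j \<in> ?I. part1 i = part1 j}"
  define J2 where "J2 = {j \<in> ?I. part2 M1 i = part2 M1 j}"
  define J3 where "J3 = {j \<in> ?I. part3 M2 i = part3 M2 j}"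
  have cMX: "card (M2 - X) = 2 * s2" "card (M2 - Y) = 2 * s2"
    using d cM by (auto simp: card_Diff_subset)
  have four: "2 ^ (2 * n) = (4::nat) ^ n" for n by (simp add: power_mult)
  have "J1 \<subseteq> (\<lambda>Y'. (U, X, Y')) ` Pow (M2 - X)"
  proof
    fix j assume j: "j \<in> J1"
    obtain U' X' Y' where jU: "j = (U', X', Y')" by (cases j) auto
    have j': "(U', X', Y') \<in> ?I" "part1 (U, X, Y) = part1 (U', X', Y')" using j by (auto simp: J1_def jU iU)
    have "U' = U" "X' = X" by (rule part1_eqD[OF i' j'])+
    moreover have "Y' \<subseteq> M2 - X'" using splitsD[OF j'(1)] by blast
    ultimately show "j \<in> (\<lambda>Y'. (U, X, Y')) ` Pow (M2 - X)" unfolding jU by blast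
  qed
  then have "card J1 \<le> card ((\<lambda>Y'. (U, X, Y')) ` Pow (M2 - X))"
    using fin by (intro card_mono) auto
  also have "\<dots> \<le> card (Pow (M2 - X))" using fin by (intro card_image_le) auto
  finally have J1: "card J1 \<le> 4 ^ s2" using fin by (simp add: card_Pow cMX four)
  have "J2 \<subseteq> (\<lambda>X'. (U, X', Y)) ` Pow (M2 - Y)"
  proof
    fix j assume j: "j \<in> J2"
    obtain U' X' Y' where jU: "j = (U', X', Y')" by (cases j) auto
    have j': "(U', X', Y') \<in> ?I" "part2 M1 (U, X, Y) = part2 M1 (U', X', Y')" using j by (auto simp: J2_def jU iU)
    have "U' = U" "Y' = Y" by (rule part2_eqD[OF i' j'])+
    moreover have "X' \<subseteq> M2 - Y'" using splitsD[OF j'(1)] by blast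
    ultimately show "j \<in> (\<lambda>X'. (U, X', Y)) ` Pow (M2 - Y)" unfolding jU by blast
  qed
  then have "card J2 \<le> card ((\<lambda>X'. (U, X', Y)) ` Pow (M2 - Y))"
    using fin by (intro card_mono) auto
  also have "\<dots> \<le> card (Pow (M2 - Y))" using fin by (intro card_image_le) auto
  finally have J2: "card J2 \<le> 4 ^ s2" using fin by (simp add: card_Pow cMX four)
  have "J3 \<subseteq> (\<lambda>(U', X'). (U', X', (X \<union> Y) - X')) ` (Pow M1 \<times> Pow (X \<union> Y))"
  proof
    fix j assume j: "j \<in> J3"
    obtain U' X' Y' where jU: "j = (U', X', Y')" by (cases j) auto
    have j': "(U', X', Y') \<in> ?I" "part3 M2 (U, X, Y) = part3 M2 (U', X', Y')" using j by (auto simp: J3_def jU iU)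
    have eq: "X' \<union> Y' = X \<union> Y" by (rule part3_eqD[OF i' j'])
    note d' = splitsD[OF j'(1)]
    have "Y' = (X \<union> Y) - X'" using eq d' by blast
    moreover have "X' \<subseteq> X \<union> Y" using eq by blast
    ultimately show "j \<in> (\<lambda>(U', X'). (U', X', (X \<union> Y) - X')) ` (Pow M1 \<times> Pow (X \<union> Y))"
      unfolding jU using d' by (intro image_eqI[of _ _ "(U', X')"]) auto
  qed
  then have "card J3 \<le> card ((\<lambda>(U', X'). (U', X', (X \<union> Y) - X')) ` (Pow M1 \<times> Pow (X \<union> Y)))"
    using fin d by (intro card_mono) auto
  also have "\<dots> \<le> card (Pow M1 \<times> Pow (X \<union> Y))" using fin d by (intro card_image_le) auto
  also have "\<dots> = 4 ^ (s1 + s2)"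
    using fin d cM by (simp add: card_cartesian_product card_Pow card_Un_disjoint power_add four flip: mult_2)
  finally have J3: "card J3 \<le> 4 ^ (s1 + s2)" .
  have all: "j = i" if "j \<in> ?I" "(part1 i = part1 j \<and> part2 M1 i = part2 M1 j) \<or>
      (part1 i = part1 j \<and> part3 M2 i = part3 M2 j) \<or> (part2 M1 i = part2 M1 j \<and> part3 M2 i = part3 M2 j)" for j
  proof -
    obtain U' X' Y' where jU: "j = (U', X', Y')" by (cases j) auto
    note j = that[unfolded jU iU]
    note d' = splitsD[OF j(1)]
    have "U' = U \<and> X' = X \<and> Y' = Y"
      using j(2)
    proof (elim disjE conjE)
      assume "part1 (U, X, Y) = part1 (U', X', Y')" "part2 M1 (U, X, Y) = part2 M1 (U', X', Y')"
      then show ?thesis using part1_eqD[OF i' j(1)] part2_eqD[OF i' j(1)] by blast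
    next
      assume a: "part1 (U, X, Y) = part1 (U', X', Y')" "part3 M2 (U, X, Y) = part3 M2 (U', X', Y')"
      show ?thesis using part1_eqD[OF i' j(1) a(1)] part3_eqD[OF i' j(1) a(2)] d d' by blast
    next
      assume a: "part2 M1 (U, X, Y) = part2 M1 (U', X', Y')" "part3 M2 (U, X, Y) = part3 M2 (U', X', Y')"
      show ?thesis using part2_eqD[OF i' j(1) a(1)] part3_eqD[OF i' j(1) a(2)] d d' by blast
    qed
    then show ?thesis by (simp add: jU iU)
  qed
  have "(\<Sum>j\<in>?I. wt Xr (part1 i) (part1 j) * wt Xr (part2 M1 i) (part2 M1 j)
        * wt V (part3 M2 i) (part3 M2 j))
      \<le> (\<Sum>j\<in>?I. 1 / (Xr ^ 2 * V) + (if part1 i = part1 j then 1 / (Xr * V) else 0)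
        + (if part2 M1 i = part2 M1 j then 1 / (Xr * V) else 0)
        + (if part3 M2 i = part3 M2 j then 1 / Xr ^ 2 else 0) + (if j = i then 1 else 0))"
  proof (rule sum_mono)
    fix j assume j: "j \<in> ?I"
    have nn: "1 / (Xr ^ 2 * V) \<ge> 0" "1 / (Xr * V) \<ge> 0" "1 / Xr ^ 2 \<ge> 0" using X by auto
    show "wt Xr (part1 i) (part1 j) * wt Xr (part2 M1 i) (part2 M1 j)
        * wt V (part3 M2 i) (part3 M2 j)
      \<le> 1 / (Xr ^ 2 * V) + (if part1 i = part1 j then 1 / (Xr * V) else 0)
        + (if part2 M1 i = part2 M1 j then 1 / (Xr * V) else 0)
        + (if part3 M2 i = part3 M2 j then 1 / Xr ^ 2 else 0) + (if j = i then 1 else 0)"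
    proof (cases "j = i")
      case True
      have "0 \<le> 1 / (Xr ^ 2 * V) + 1 / (Xr * V) + 1 / (Xr * V) + 1 / Xr ^ 2" by (intro add_nonneg_nonneg nn)
      then show ?thesis using True by simp
    next
      case False
      then show ?thesis using all[OF j] nn
        by (cases "part1 i = part1 j"; cases "part2 M1 i = part2 M1 j"; cases "part3 M2 i = part3 M2 j")
           (simp_all add: power2_eq_square)
    qed
  qed
  also have "\<dots> = real (card ?I) / (Xr ^ 2 * V) + real (card J1) / (Xr * V) + real (card J2) / (Xr * V)
      + real (card J3) / Xr ^ 2 + 1"
    using finite_splits i unfolding J1_def J2_def J3_def
    by (simp add: sum.distrib sum.delta sum.inter_filter [symmetric])
  also have "\<dots> \<le> 1 + 1 + 1 + 1 + 1"
  proof (intro add_mono)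
    have pos: "0 < Xr ^ 2 * V" "0 < Xr * V" "0 < Xr ^ 2" using X by auto
    have "real (card J1) \<le> real (4 ^ s2)" "real (card J2) \<le> real (4 ^ s2)" "real (card J3) \<le> real (4 ^ (s1 + s2))"
      using J1 J2 J3 by (simp_all only: of_nat_le_iff)
    then have "real (card J1) \<le> Xr * V" "real (card J2) \<le> Xr * V" "real (card J3) \<le> Xr ^ 2"
      unfolding of_nat_power of_nat_numeral using s by linarith+
    then show "real (card J1) / (Xr * V) \<le> 1" "real (card J2) / (Xr * V) \<le> 1" "real (card J3) / Xr ^ 2 \<le> 1"
      using pos by simp_all
    show "real (card ?I) / (Xr ^ 2 * V) \<le> 1" using F pos by simp
  qed simp
  finally show ?thesis by simp
qed

end

section \<open>Common values\<close>

lemma totient_three_primes: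
  fixes p q r :: nat
  assumes "prime p" "prime q" "prime r" "p \<noteq> q" "p \<noteq> r" "q \<noteq> r"
  shows "totient (p * q * r) = (p - 1) * (q - 1) * (r - 1)"
proof -
  have "coprime p q" "coprime (p * q) r" using assms by (auto intro!: primes_coprime simp: coprime_mult_left_iff)
  then show ?thesis using assms by (simp add: totient_mult_coprime totient_prime)
qed

lemma divisor_sigma_prime_mult:
  assumes "prime p" "\<not> p dvd n" "n > 0"
  shows "divisor_sigma (p * n) = (p + 1) * divisor_sigma n"
proof -
  have p: "p > 0" using assms prime_gt_0_nat by blast
  have fin: "finite {d. d dvd n}" using assms by simp
  have eq: "{d. d dvd p * n} = {d. d dvd n} \<union> (\<lambda>d. p * d) ` {d. d dvd n}"
  proof (rule equalityI; rule subsetI)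
    fix d assume "d \<in> {d. d dvd p * n}"
    then have d: "d dvd p * n" by simp
    show "d \<in> {d. d dvd n} \<union> (\<lambda>d. p * d) ` {d. d dvd n}"
    proof (cases "p dvd d")
      case True
      then obtain e where e: "d = p * e" by (elim dvdE)
      then have "e dvd n" using d p by simp
      then show ?thesis using e by blast
    next
      case False
      then have "coprime d p" using assms(1) by (metis coprime_commute prime_imp_coprime)
      then have "d dvd n" using d by (simp add: coprime_dvd_mult_right_iff)
      then show ?thesis by simp
    qed
  next
    fix d assume "d \<in> {d. d dvd n} \<union> (\<lambda>d. p * d) ` {d. d dvd n}"
    then show "d \<in> {d. d dvd p * n}" by (auto intro: dvd_mult)
  qed
  have "{d. d dvd n} \<inter> (\<lambda>d. p * d) ` {d. d dvd n} = {}"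
    using assms(2) dvd_mult_left by blast
  then have "divisor_sigma (p * n) = divisor_sigma n + (\<Sum>d\<in>(\<lambda>d. p * d) ` {d. d dvd n}. d)"
    unfolding divisor_sigma_def eq using fin by (subst sum.union_disjoint) auto
  also have "(\<Sum>d\<in>(\<lambda>d. p * d) ` {d. d dvd n}. d) = p * divisor_sigma n"
    using p by (subst sum.reindex) (auto simp: inj_on_def divisor_sigma_def sum_distrib_left)
  finally show ?thesis by simp
qed

lemma divisor_sigma_three_primes:
  fixes p q r :: nat
  assumes "prime p" "prime q" "prime r" "p \<noteq> q" "p \<noteq> r" "q \<noteq> r"
  shows "divisor_sigma (p * q * r) = (p + 1) * (q + 1) * (r + 1)"
proof -
  have pos: "p > 0" "q > 0" "r > 0" using assms prime_gt_0_nat by blast+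
  have "{d. d dvd Suc 0} = {1}" by auto
  then have 1: "divisor_sigma 1 = 1" by (simp add: divisor_sigma_def)
  have nd: "\<not> p dvd q * r" "\<not> q dvd r" "\<not> r dvd 1"
    using assms by (auto simp: prime_dvd_mult_iff dest: primes_dvd_imp_eq)
  have "divisor_sigma (p * (q * (r * 1))) = (p + 1) * ((q + 1) * ((r + 1) * divisor_sigma 1))"
    using divisor_sigma_prime_mult[OF assms(1), of "q * r"] divisor_sigma_prime_mult[OF assms(2), of r]
      divisor_sigma_prime_mult[OF assms(3), of 1] nd pos by simp
  then show ?thesis by (simp only: 1 mult_1_right mult.assoc)
qed

text \<open>The last equation undoes the truncated subtraction on \<open>nat\<close>, so that the
  factor \<open>q + 1\<close> in the divisor sum can be read as \<open>6 * b * n\<close>.\<close>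

lemma prime_forms_pairD:
  assumes "prime_forms (pair_forms a b) n" "b > 0"
  shows "prime n" "prime (6 * a * n + 1)" "prime (6 * b * n - 1)" "6 * b * n - 1 + 1 = 6 * b * n"
proof -
  have p: "prime (int n)" "prime (6 * int a * int n + 1)" "prime (6 * int b * int n + - 1)"
    using assms by (auto simp: prime_forms_def pair_forms_def)
  show "prime n" using p(1) by simp
  then have n: "n > 0" using prime_gt_0_nat by blast
  have "6 * int a * int n + 1 = int (6 * a * n + 1)" by simp
  then show "prime (6 * a * n + 1)" using p(2) by (metis prime_nat_int_transfer)
  have "6 * b * n \<ge> 1" using n assms(2) by simp
  then have "6 * int b * int n + - 1 = int (6 * b * n - 1)" by (simp add: of_nat_diff)
  then show "prime (6 * b * n - 1)" using p(3) by (metis prime_nat_int_transfer)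
  show "6 * b * n - 1 + 1 = 6 * b * n" using n assms(2) by simp
qed

lemma form_triplesD:
  assumes "(n3, n2, n1) \<in> form_triples X V m F1 F2 F3"
    and "0 < m" "216 * real m \<le> exp (X / 4)" "0 < V" "V \<le> X / 10"
  shows "prime_forms F1 n1" "prime_forms F2 n2" "prime_forms F3 n3"
    and "exp (V / 4) < real n3" "real n3 \<le> exp V" "exp (X / 40) < real n2" "real n2 \<le> exp (X / 10)"
    and "exp (X / 10) < real n1" "216 * real m * real n1 * real n2 * real n3 \<le> exp X"
proof -
  define v where "v = X - ln (216 * real m) - ln (real n2) - ln (real n3)"
  have n: "n3 \<in> prime_form_set F3 V" "n2 \<in> prime_form_set F2 (X / 10)" "n1 \<in> prime_form_set F1 v"
    using assms(1) by (auto simp: form_triples_def v_def)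
  show "prime_forms F1 n1" "prime_forms F2 n2" "prime_forms F3 n3" using n by (simp_all add: prime_form_set_def)
  show n': "exp (V / 4) < real n3" "real n3 \<le> exp V" "exp (X / 40) < real n2" "real n2 \<le> exp (X / 10)"
    using n by (simp_all add: prime_form_set_def)
  have "0 \<le> V" using assms(4) by simp
  note v = top_range[OF n(2,1) assms(2,3) this assms(5), folded v_def]
  have n1: "exp (v / 4) < real n1" "real n1 \<le> exp v" using n(3) by (simp_all add: prime_form_set_def)
  have "exp (X / 10) \<le> exp (v / 4)" using v assms by simp
  then show "exp (X / 10) < real n1" using n1 by linarith
  have pos: "real n2 > 0" "real n3 > 0"
    using n' exp_gt_zero[of "V / 4"] exp_gt_zero[of "X / 40"] by linarith+
  have "216 * real m * real n1 * real n2 * real n3 \<le> 216 * real m * exp v * real n2 * real n3"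
    using n1 pos by (intro mult_right_mono mult_left_mono) auto
  also have "\<dots> = exp X" unfolding v(3) using pos assms(2) by simp
  finally show "216 * real m * real n1 * real n2 * real n3 \<le> exp X" .
qed

lemma exp_le_exp_mult_nat:
  fixes a n :: nat
  assumes "6 * real a \<le> exp u" "real n \<le> exp v"
  shows "6 * real a * real n \<le> exp (u + v)"
  unfolding exp_add using assms by (intro mult_mono) auto

text \<open>The formulas for three primes need them distinct. The third is below \<open>n2\<close>
  and hence below the other two. The first two differ because \<open>n1\<close> is a prime other
  than \<open>n2\<close> and larger than the second coefficient \<open>a'\<close>, so it cannot
  divide \<open>a' * n2\<close>. The factor 216 is \<open>6 ^ 3\<close>.\<close>

lemma form_triples_value:
  assumes t: "(n3, n2, n1) \<in> form_triples X V m (pair_forms a1 b1) (pair_forms a2 b2) (pair_forms a3 b3)"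
    and m: "0 < m" "216 * real m \<le> exp (X / 4)" and V: "V \<ge> 16" "V \<le> X / 100"
    and pos: "a1 > 0" "a2 > 0" "a3 > 0" "b1 > 0" "b2 > 0" "b3 > 0"
    and prod: "a1 * a2 * a3 = m" "b1 * b2 * b3 = m"
    and le: "6 * real a2 \<le> exp (X / 40)" "6 * real b2 \<le> exp (X / 40)"
      "6 * real a3 \<le> exp (V / 4)" "6 * real b3 \<le> exp (V / 4)"
  shows "216 * m * n1 * n2 * n3 \<in> {v::nat. 0 < v \<and> real v \<le> exp X \<and>
             (\<exists>n>0. totient n = v) \<and> (\<exists>m>0. divisor_sigma m = v)}"
proof -
  have V': "0 < V" "V \<le> X / 10" using V by auto
  note t' = form_triplesD[OF t m V']
  note f1 = prime_forms_pairD[OF t'(1) pos(4)] and f2 = prime_forms_pairD[OF t'(2) pos(5)]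
    and f3 = prime_forms_pairD[OF t'(3) pos(6)]
  have n0: "n1 > 0" "n2 > 0" "n3 > 0" using f1(1) f2(1) f3(1) prime_gt_0_nat by blast+
  have small3: "6 * a * n3 + 1 < n2" if "6 * real a \<le> exp (V / 4)" for a
  proof -
    have "6 * real a * real n3 \<le> exp (V / 4 + V)" by (rule exp_le_exp_mult_nat[OF that t'(5)])
    also have "\<dots> + 1 \<le> exp (V / 4 + V) * exp 1"
    proof -
      have "1 \<le> exp (V / 4 + V)" "2 \<le> exp (1::real)" using V exp_ge_add_one_self[of "1::real"] by (auto simp del: exp_ge_add_one_self)
      then have "exp (V / 4 + V) * 2 \<le> exp (V / 4 + V) * exp 1" by (intro mult_left_mono) auto
      then show ?thesis using \<open>1 \<le> exp (V / 4 + V)\<close> by linarith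
    qed
    also have "\<dots> = exp (V / 4 + V + 1)" by (simp add: exp_add)
    also have "\<dots> \<le> exp (X / 40)" using V by simp
    also have "\<dots> < real n2" by (rule t'(6))
    finally have "real (6 * a * n3 + 1) < real n2" by simp
    then show ?thesis by (simp only: of_nat_less_iff)
  qed
  have n12: "n1 \<noteq> n2" using t'(7,8) by auto
  have neq: "a * n1 \<noteq> a' * n2" if "6 * real a' \<le> exp (X / 40)" "a' > 0" for a a'
  proof
    assume "a * n1 = a' * n2"
    then have "n1 dvd a' * n2" by (metis dvd_triv_right)
    then have "n1 dvd a'" using f1(1) f2(1) n12 by (auto simp: prime_dvd_mult_iff dest: primes_dvd_imp_eq)
    then have "n1 \<le> a'" using that by (intro dvd_imp_le) auto
    then have "real n1 \<le> real a'" by simp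
    moreover have "exp (X / 40) \<le> exp (X / 10)" using V by simp
    ultimately show False using t'(8) that(1) by linarith
  qed
  have ge: "n \<le> 6 * a * n - 1" "n \<le> 6 * a * n + 1" if "a > 0" "n > 0" for a n :: nat
  proof -
    have "n \<le> a * n" using that by simp
    then show "n \<le> 6 * a * n - 1" "n \<le> 6 * a * n + 1" unfolding mult.assoc using that by linarith+
  qed
  have n21: "n2 < n1" using t'(7,8) by linarith
  have "6 * a1 * n1 + 1 \<noteq> 6 * a2 * n2 + 1" using neq[OF le(1) pos(2), of a1] by simp
  moreover have "6 * a3 * n3 + 1 < 6 * a2 * n2 + 1" "6 * a3 * n3 + 1 < 6 * a1 * n1 + 1"
    using small3[OF le(3)] ge(2)[OF pos(2) n0(2)] ge(2)[OF pos(1) n0(1)] n21 by linarith+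
  ultimately have "totient ((6 * a1 * n1 + 1) * (6 * a2 * n2 + 1) * (6 * a3 * n3 + 1))
      = (6 * a1 * n1) * (6 * a2 * n2) * (6 * a3 * n3)"
    using totient_three_primes[OF f1(2) f2(2) f3(2)] by simp
  also have "\<dots> = 216 * m * n1 * n2 * n3" unfolding prod(1) [symmetric] by simp
  finally have tot: "totient ((6 * a1 * n1 + 1) * (6 * a2 * n2 + 1) * (6 * a3 * n3 + 1)) = 216 * m * n1 * n2 * n3" .
  have "6 * b1 * n1 - 1 \<noteq> 6 * b2 * n2 - 1"
    using neq[OF le(2) pos(5), of b1] f1(4) f2(4) by (metis mult.assoc mult_left_cancel zero_neq_numeral)
  moreover have "6 * b3 * n3 - 1 < 6 * b2 * n2 - 1" "6 * b3 * n3 - 1 < 6 * b1 * n1 - 1"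
    using small3[OF le(4)] ge(1)[OF pos(5) n0(2)] ge(1)[OF pos(4) n0(1)] n21 by linarith+
  ultimately have "divisor_sigma ((6 * b1 * n1 - 1) * (6 * b2 * n2 - 1) * (6 * b3 * n3 - 1))
      = (6 * b1 * n1) * (6 * b2 * n2) * (6 * b3 * n3)"
    using divisor_sigma_three_primes[OF f1(3) f2(3) f3(3)] unfolding f1(4) f2(4) f3(4) by auto
  also have "\<dots> = 216 * m * n1 * n2 * n3" unfolding prod(2) [symmetric] by simp
  finally have sig: "divisor_sigma ((6 * b1 * n1 - 1) * (6 * b2 * n2 - 1) * (6 * b3 * n3 - 1)) = 216 * m * n1 * n2 * n3" .
  have "(6 * b1 * n1 - 1) * (6 * b2 * n2 - 1) * (6 * b3 * n3 - 1) > 0"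
    using f1(3) f2(3) f3(3) by (simp only: nat_0_less_mult_iff prime_gt_0_nat simp_thms)
  moreover have "(6 * a1 * n1 + 1) * (6 * a2 * n2 + 1) * (6 * a3 * n3 + 1) > 0" by simp
  moreover have "real (216 * m * n1 * n2 * n3) \<le> exp X" using t'(9) by simp
  moreover have "216 * m * n1 * n2 * n3 > 0" using m n0 by simp
  ultimately show ?thesis using tot sig by blast
qed

text \<open>The factor 216 contributes only the primes 2 and 3. The larger prime divisors fall into
  five ranges separated by \<open>exp (V / 4)\<close>, \<open>exp V\<close>,
  \<open>exp (X / 40)\<close> and \<open>exp (X / 10)\<close>, which belong in this order to
  \<open>M2\<close>, \<open>n3\<close>, \<open>M1\<close>, \<open>n2\<close> and \<open>n1\<close>;
  so the value determines all five.\<close>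

lemma decode_value:
  fixes M1 M2 :: "nat set"
  assumes V: "V \<ge> 16" "V \<le> X / 100"
    and M1: "finite M1" "\<And>p. p \<in> M1 \<Longrightarrow> prime p \<and> exp V < real p \<and> real p \<le> exp (X / 40)"
    and M2: "finite M2" "\<And>p. p \<in> M2 \<Longrightarrow> prime p \<and> 3 < p \<and> real p \<le> exp (V / 4)"
    and n: "prime n1" "prime n2" "prime n3" "exp (V / 4) < real n3" "real n3 \<le> exp V"
      "exp (X / 40) < real n2" "real n2 \<le> exp (X / 10)" "exp (X / 10) < real n1"
  defines "D \<equiv> {r. prime r \<and> 3 < r \<and> r dvd 216 * (\<Prod>M1 * \<Prod>M2) * n1 * n2 * n3}"
  shows "M1 = {r \<in> D. exp V < real r \<and> real r \<le> exp (X / 40)}"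
    "M2 = {r \<in> D. real r \<le> exp (V / 4)}"
    "{n3} = {r \<in> D. exp (V / 4) < real r \<and> real r \<le> exp V}"
    "{n2} = {r \<in> D. exp (X / 40) < real r \<and> real r \<le> exp (X / 10)}"
    "{n1} = {r \<in> D. exp (X / 10) < real r}"
proof -
  have e: "exp (V / 4) < exp V" "exp V < exp (X / 40)" "exp (X / 40) < exp (X / 10)" using V by auto
  have e3: "3 < exp (V / 4)" using exp_ge_add_one_self[of "V / 4"] V by linarith
  have dvd: "r dvd 216 * (\<Prod>M1 * \<Prod>M2) * n1 * n2 * n3 \<longleftrightarrow> r \<in> M1 \<or> r \<in> M2 \<or> r = n1 \<or> r = n2 \<or> r = n3"
    if r: "prime r" "3 < r" for r
  proof -
    have "\<not> r dvd 216"
    proof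
      assume "r dvd 216"
      then have "r dvd 2 ^ 3 * 3 ^ 3" by simp
      then have "r dvd 2 ^ 3 \<or> r dvd 3 ^ 3" by (rule prime_dvd_multD[OF r(1)])
      then have "r dvd 2 \<or> r dvd 3" using prime_dvd_power[OF r(1)] by blast
      then show False using r(2) dvd_imp_le[of r 2] dvd_imp_le[of r 3] by linarith
    qed
    moreover have "r dvd \<Prod>M1 \<longleftrightarrow> r \<in> M1" using M1 r by (intro prod_primes_dvd_iff) auto
    moreover have "r dvd \<Prod>M2 \<longleftrightarrow> r \<in> M2" using M2 r by (intro prod_primes_dvd_iff) auto
    moreover have "r dvd n1 \<longleftrightarrow> r = n1" "r dvd n2 \<longleftrightarrow> r = n2" "r dvd n3 \<longleftrightarrow> r = n3"
      using primes_dvd_imp_eq[OF r(1) n(1)] primes_dvd_imp_eq[OF r(1) n(2)] primes_dvd_imp_eq[OF r(1) n(3)]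
      by (metis dvd_refl)+
    ultimately show ?thesis using r(1) by (auto simp only: prime_dvd_mult_iff)
  qed
  have gt3: "3 < r" if "exp (V / 4) < real r" for r
    using that e3 by linarith
  have mem: "r \<in> D \<longleftrightarrow> prime r \<and> 3 < r \<and> (r \<in> M1 \<or> r \<in> M2 \<or> r = n1 \<or> r = n2 \<or> r = n3)" for r
    unfolding D_def using dvd[of r] by blast
  have lt: "exp (V / 4) < real n1" "exp (V / 4) < real n2" using e n by linarith+
  show "M1 = {r \<in> D. exp V < real r \<and> real r \<le> exp (X / 40)}"
  proof (rule Set.set_eqI)
    fix r
    show "r \<in> M1 \<longleftrightarrow> r \<in> {r \<in> D. exp V < real r \<and> real r \<le> exp (X / 40)}"
      using M1(2)[of r] M2(2)[of r] mem[of r] gt3[of r] e n by (smt (verit) mem_Collect_eq)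
  qed
  show "M2 = {r \<in> D. real r \<le> exp (V / 4)}"
  proof (rule Set.set_eqI)
    fix r
    show "r \<in> M2 \<longleftrightarrow> r \<in> {r \<in> D. real r \<le> exp (V / 4)}"
      using M1(2)[of r] M2(2)[of r] mem[of r] lt e n by (smt (verit) mem_Collect_eq)
  qed
  show "{n3} = {r \<in> D. exp (V / 4) < real r \<and> real r \<le> exp V}"
  proof (rule Set.set_eqI)
    fix r
    show "r \<in> {n3} \<longleftrightarrow> r \<in> {r \<in> D. exp (V / 4) < real r \<and> real r \<le> exp V}"
      using M1(2)[of r] M2(2)[of r] mem[of r] gt3[of r] e n by (smt (verit) mem_Collect_eq singleton_iff)
  qed
  show "{n2} = {r \<in> D. exp (X / 40) < real r \<and> real r \<le> exp (X / 10)}"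
  proof (rule Set.set_eqI)
    fix r
    show "r \<in> {n2} \<longleftrightarrow> r \<in> {r \<in> D. exp (X / 40) < real r \<and> real r \<le> exp (X / 10)}"
      using M1(2)[of r] M2(2)[of r] mem[of r] gt3[of r] e n by (smt (verit) mem_Collect_eq singleton_iff)
  qed
  show "{n1} = {r \<in> D. exp (X / 10) < real r}"
  proof (rule Set.set_eqI)
    fix r
    show "r \<in> {n1} \<longleftrightarrow> r \<in> {r \<in> D. exp (X / 10) < real r}"
      using M1(2)[of r] M2(2)[of r] mem[of r] gt3[of r] e n by (smt (verit) mem_Collect_eq singleton_iff)
  qed
qed

lemma esym_inverse:
  "esym (\<lambda>p. 1 / real p) r P = (\<Sum>I | I \<subseteq> P \<and> card I = r. 1 / real (\<Prod>I))"
  unfolding esym_def by (intro sum.cong refl) (simp add: prod_dividef)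

abbreviation split_triples where
  "split_triples X V M1 M2 i j \<equiv> form_triples X V (\<Prod>M1 * \<Prod>M2) (pair_forms (part1 i) (part1 j))
    (pair_forms (part2 M1 i) (part2 M1 j)) (pair_forms (part3 M2 i) (part3 M2 j))"

text \<open>For fixed \<open>M1\<close> and \<open>M2\<close> the number of triples is at least a
  constant times \<open>1 / (\<Prod>M1 * \<Prod>M2)\<close>. By \<open>decode_value\<close> distinct
  data give distinct values, so these counts add up, and the reciprocals sum to the two
  \<open>esym\<close>. The summands 2 in the size conditions absorb the coefficient 6, as
  \<open>6 \<le> exp 2\<close>.\<close>

lemma V_phi_sigma_lower:
  fixes P1 P2 :: "nat set" and s1 s2 :: nat
  assumes c: "c > 0" and K: "K > 0" and V: "V \<ge> 16" "V \<le> X / 100"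
    and lo: "PROP prime_pair_lower c V"
    and small: "\<And>v. v \<ge> V \<Longrightarrow> exp (v / 4) + 1 \<le> c / 2 * (exp (v / 2) / v ^ 3)"
    and up: "PROP prime_forms_upper K V X"
    and P1: "finite P1" "\<And>p. p \<in> P1 \<Longrightarrow> prime p \<and> exp V < real p \<and> real p \<le> exp b1"
    and P2: "finite P2" "\<And>p. p \<in> P2 \<Longrightarrow> prime p \<and> 3 < p \<and> real p \<le> exp b2"
    and b: "b1 \<le> X / 40" "b2 \<le> V / 4" "2 + real s1 * b1 + real s2 * b2 \<le> X / 40" "2 + real s2 * b2 \<le> V / 4"
    and F: "F = ((2 * s1) choose s1) * (((3 * s2) choose s2) * ((2 * s2) choose s2))" "real F \<le> X ^ 2 * V"
    and s: "4 ^ s2 \<le> X * V" "4 ^ (s1 + s2) \<le> X ^ 2"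
  shows "real (V_phi_sigma (exp X)) \<ge> c ^ 6 / (5 * 10 ^ 17 * K ^ 3) * real F ^ 2 * exp X / (X ^ 5 * V ^ 2)
    * (esym (\<lambda>p. 1 / real p) (2 * s1) P1 * esym (\<lambda>p. 1 / real p) (3 * s2) P2)"
proof -
  have X: "X \<ge> 1600" using V by simp
  have V': "0 < V" "V \<le> X / 10" using V by auto
  have V1: "V \<le> X / 10" using V by auto
  define MM1 where "MM1 = {M. M \<subseteq> P1 \<and> card M = 2 * s1}"
  define MM2 where "MM2 = {M. M \<subseteq> P2 \<and> card M = 3 * s2}"
  define T where "T M1 M2 = (\<Union>(i, j)\<in>splits M1 M2 s1 s2 \<times> splits M1 M2 s1 s2.
      split_triples X V M1 M2 i j)" for M1 M2
  define \<Omega> where "\<Omega> = (SIGMA M1:MM1. SIGMA M2:MM2. T M1 M2)"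
  define f where "f = (\<lambda>(M1, M2, n3, n2, n1). 216 * (\<Prod>M1 * \<Prod>M2) * n1 * n2 * (n3::nat))"
  define VS where "VS = {v::nat. 0 < v \<and> real v \<le> exp X \<and> (\<exists>n>0. totient n = v) \<and> (\<exists>m>0. divisor_sigma m = v)}"
  have fMM: "finite MM1" "finite MM2"
    unfolding MM1_def MM2_def using P1(1) P2(1) by simp_all
  have ctx: "finite M1" "finite M2" "M1 \<inter> M2 = {}" "\<And>p. p \<in> M1 \<Longrightarrow> prime p" "\<And>p. p \<in> M2 \<Longrightarrow> prime p"
    "card M1 = 2 * s1" "card M2 = 3 * s2" "\<And>p. p \<in> M1 \<Longrightarrow> exp V < real p \<and> real p \<le> exp b1"
    "\<And>p. p \<in> M2 \<Longrightarrow> 3 < p \<and> real p \<le> exp b2"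
    if "M1 \<in> MM1" "M2 \<in> MM2" for M1 M2
  proof -
    have sub: "M1 \<subseteq> P1" "M2 \<subseteq> P2" "card M1 = 2 * s1" "card M2 = 3 * s2" using that by (auto simp: MM1_def MM2_def)
    show "card M1 = 2 * s1" "card M2 = 3 * s2" by (rule sub)+
    show "finite M1" "finite M2" using sub(1,2) P1(1) P2(1) finite_subset by blast+
    show "prime p" "exp V < real p \<and> real p \<le> exp b1" if "p \<in> M1" for p using P1(2) sub(1) that by blast+
    show "prime p" "3 < p \<and> real p \<le> exp b2" if "p \<in> M2" for p using P2(2) sub(2) that by blast+
    have "exp b2 \<le> exp V" using b V by simp
    then have "\<not> (real p \<le> exp b2 \<and> exp V < real p)" for p :: nat by linarith
    then show "M1 \<inter> M2 = {}" using P1(2) P2(2) sub(1,2) by blast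
  qed
  have e2: "6 \<le> exp (2::real)"
  proof -
    have "2.7 * 2.7 \<le> exp (1::real) * exp 1" using e_approx_32 by (intro mult_mono) (auto simp: abs_if split: if_splits)
    then show ?thesis by (simp flip: exp_add)
  qed
  have parts: "6 * real (part1 i) \<le> exp (X / 40)" "6 * real (part2 M1 i) \<le> exp (X / 40)" "6 * real (part3 M2 i) \<le> exp (V / 4)"
    "part1 i > 0" "part2 M1 i > 0" "part3 M2 i > 0" "part1 i * part2 M1 i * part3 M2 i = \<Prod>M1 * \<Prod>M2"
    if M: "M1 \<in> MM1" "M2 \<in> MM2" and i: "i \<in> splits M1 M2 s1 s2" for M1 M2 i
  proof -
    note fin = ctx(1,2)[OF M] and disj = ctx(3)[OF M]
    have bd: "\<And>p. p \<in> M1 \<Longrightarrow> real p \<le> exp b1" "\<And>p. p \<in> M2 \<Longrightarrow> real p \<le> exp b2"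
      using ctx(8,9)[OF M] by blast+
    show "part1 i > 0" "part2 M1 i > 0" "part3 M2 i > 0"
      using parts_pos[OF ctx(1-7)[OF M] i] by blast+
    show "part1 i * part2 M1 i * part3 M2 i = \<Prod>M1 * \<Prod>M2" by (rule parts_prod[OF ctx(1-7)[OF M] i])
    obtain U A B where iU: "i = (U, A, B)" by (cases i) auto
    note d = splitsD[OF ctx(1-7)[OF M] i[unfolded iU]]
    have pe: "real (\<Prod>S) \<le> exp (real (card S) * b)" if "\<And>p. p \<in> S \<Longrightarrow> real p \<le> exp b" for S :: "nat set" and b
    proof -
      have "real (\<Prod>S) = (\<Prod>p\<in>S. real p)" by simp
      also have "\<dots> \<le> (\<Prod>p\<in>S. exp b)" using that by (intro prod_mono) auto
      also have "\<dots> = exp (real (card S) * b)" by (simp add: exp_of_nat_mult)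
      finally show ?thesis .
    qed
    have two: "6 * (real (\<Prod>S) * real (\<Prod>S')) \<le> exp (X / 40)"
      if "S \<subseteq> M1" "S' \<subseteq> M2" "card S = s1" "card S' = s2" for S S'
    proof -
      have "6 * (real (\<Prod>S) * real (\<Prod>S')) \<le> exp 2 * (exp (real s1 * b1) * exp (real s2 * b2))"
        using pe[of S b1] pe[of S' b2] bd that e2
        by (intro mult_mono mult_nonneg_nonneg) (auto simp: subset_eq intro!: prod_nonneg)
      also have "\<dots> = exp (2 + real s1 * b1 + real s2 * b2)" by (simp add: exp_add)
      also have "\<dots> \<le> exp (X / 40)" using b by simp
      finally show ?thesis .
    qed
    have "part1 i = \<Prod>U * \<Prod>A"
      unfolding part1_def iU prod.case using d disj by (intro prod.union_disjoint) auto
    then show "6 * real (part1 i) \<le> exp (X / 40)" using two[of U A] d by simp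
    have "part2 M1 i = \<Prod>(M1 - U) * \<Prod>B"
      unfolding part2_def iU prod.case using d disj fin by (intro prod.union_disjoint) auto
    moreover have "card (M1 - U) = s1" using d fin ctx(6,7)[OF M] by (simp add: card_Diff_subset)
    ultimately show "6 * real (part2 M1 i) \<le> exp (X / 40)" using two[of "M1 - U" B] d by simp
    have c3: "card (M2 - A - B) = s2"
    proof -
      have "card (M2 - A) = 2 * s2" using d fin ctx(6,7)[OF M] by (simp add: card_Diff_subset)
      moreover have "B \<subseteq> M2 - A" using d by blast
      ultimately show ?thesis using d by (simp add: card_Diff_subset)
    qed
    have "6 * real (\<Prod>(M2 - A - B)) \<le> exp 2 * exp (real s2 * b2)"
      using pe[of "M2 - A - B" b2] bd e2 c3 by (intro mult_mono) (auto intro!: prod_nonneg)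
    also have "\<dots> = exp (2 + real s2 * b2)" by (simp add: exp_add)
    also have "\<dots> \<le> exp (V / 4)" using b by simp
    finally show "6 * real (part3 M2 i) \<le> exp (V / 4)" by (simp add: part3_def iU)
  qed
  have m: "0 < \<Prod>M1 * \<Prod>M2" "216 * real (\<Prod>M1 * \<Prod>M2) \<le> exp (X / 4)" "splits M1 M2 s1 s2 \<noteq> {}"
    if M: "M1 \<in> MM1" "M2 \<in> MM2" for M1 M2
  proof -
    have "(2 * s1) choose s1 > 0" "(3 * s2) choose s2 > 0" "(2 * s2) choose s2 > 0" by simp_all
    then have "card (splits M1 M2 s1 s2) \<noteq> 0"
      using card_splits[OF ctx(1-7)[OF M]] by (metis mult_eq_0_iff less_irrefl)
    then show ne: "splits M1 M2 s1 s2 \<noteq> {}" by (metis card.empty)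
    then obtain i where i: "i \<in> splits M1 M2 s1 s2" by blast
    note p = parts[OF M i]
    show "0 < \<Prod>M1 * \<Prod>M2" unfolding p(7) [symmetric] using p(4-6) by simp
    have "216 * real (\<Prod>M1 * \<Prod>M2) = 6 * real (part1 i) * (6 * real (part2 M1 i)) * (6 * real (part3 M2 i))"
      unfolding p(7) [symmetric] by simp
    also have "\<dots> \<le> exp (X / 40) * exp (X / 40) * exp (V / 4)"
      using p(1-3) by (intro mult_mono) auto
    also have "\<dots> = exp (X / 40 + X / 40 + V / 4)" by (simp only: exp_add)
    also have "\<dots> \<le> exp (X / 4)" using V X by simp
    finally show "216 * real (\<Prod>M1 * \<Prod>M2) \<le> exp (X / 4)" .
  qed
  \<comment> \<open>\<open>5 ^ 2\<close> is \<open>G ^ 2\<close> for the bound 5 of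
    \<open>splits_weight\<close>.\<close>
  define C where "C = c ^ 6 / (2 * 10 ^ 16 * K ^ 3 * 5 ^ 2) * real F ^ 2 * exp X / (X ^ 5 * V ^ 2)"
  have T: "real (card (T M1 M2)) \<ge> C * (1 / real (\<Prod>M1) * (1 / real (\<Prod>M2)))" if M: "M1 \<in> MM1" "M2 \<in> MM2" for M1 M2
  proof -
    have cs: "card (splits M1 M2 s1 s2) = F" using card_splits[OF ctx(1-7)[OF M]] F(1) by (rule trans[OF _ sym])
    have "real (card (T M1 M2)) \<ge> c ^ 6 / (2 * 10 ^ 16 * K ^ 3 * 5 ^ 2) * real (card (splits M1 M2 s1 s2)) ^ 2
        * (exp X / real (\<Prod>M1 * \<Prod>M2)) / (X ^ 5 * V ^ 2)"
      unfolding T_def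
    proof (rule card_form_triples_Union[OF finite_splits[OF ctx(1-7)[OF M]] m(3)[OF M] c K _ V(1) V1 lo small up m(1,2)[OF M]])
      fix i assume i: "i \<in> splits M1 M2 s1 s2"
      note p = parts[OF M i]
      show "0 < part1 i \<and> 0 < part2 M1 i \<and> 0 < part3 M2 i" using p by simp
      show "6 * real (part1 i) \<le> exp (X / 40)" "6 * real (part2 M1 i) \<le> exp (X / 40)" "6 * real (part3 M2 i) \<le> exp (V / 4)"
        by (rule p)+
      show "(\<Sum>j\<in>splits M1 M2 s1 s2. wt X (part1 i) (part1 j) * wt X (part2 M1 i) (part2 M1 j)
        * wt V (part3 M2 i) (part3 M2 j)) \<le> 5"
        by (rule splits_weight[OF ctx(1-7)[OF M] _ _ _ s i]) (use X V F cs in auto)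
    qed auto
    then show ?thesis unfolding cs C_def by (simp add: mult_ac)
  qed
  have fin\<Omega>: "finite \<Omega>"
    unfolding \<Omega>_def T_def
  proof (intro finite_SigmaI fMM finite_UN_I finite_cartesian_product)
    fix M1 M2 assume M: "M1 \<in> MM1" "M2 \<in> MM2"
    show "finite (splits M1 M2 s1 s2)" by (rule finite_splits[OF ctx(1-7)[OF M]])
    then show "finite (splits M1 M2 s1 s2)" .
  qed (auto split: prod.splits)
  have "C * (esym (\<lambda>p. 1 / real p) (2 * s1) P1 * esym (\<lambda>p. 1 / real p) (3 * s2) P2)
      = (\<Sum>M1\<in>MM1. \<Sum>M2\<in>MM2. C * (1 / real (\<Prod>M1) * (1 / real (\<Prod>M2))))"
    unfolding esym_inverse MM1_def [symmetric] MM2_def [symmetric] sum_product by (simp only: sum_distrib_left)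
  also have "\<dots> \<le> (\<Sum>M1\<in>MM1. \<Sum>M2\<in>MM2. real (card (T M1 M2)))"
    by (intro sum_mono T)
  also have "\<dots> = real (card \<Omega>)"
  proof -
    have fT: "finite (T M1 M2)" if "M1 \<in> MM1" "M2 \<in> MM2" for M1 M2
    proof -
      have "T M1 M2 = (\<lambda>(M1, M2, t). t) ` {\<omega> \<in> \<Omega>. fst \<omega> = M1 \<and> fst (snd \<omega>) = M2}"
        using that by (force simp: \<Omega>_def)
      then show ?thesis using fin\<Omega> by simp
    qed
    have "card (SIGMA M2:MM2. T M1 M2) = (\<Sum>M2\<in>MM2. card (T M1 M2))" if "M1 \<in> MM1" for M1
      using fMM fT[OF that] by (intro card_SigmaI) auto
    moreover have "card \<Omega> = (\<Sum>M1\<in>MM1. card (SIGMA M2:MM2. T M1 M2))"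
      unfolding \<Omega>_def using fMM fT by (intro card_SigmaI) auto
    ultimately show ?thesis by simp
  qed
  also have "card \<Omega> \<le> card VS"
  proof (rule card_inj_on_le)
    have finVS: "VS \<subseteq> {..nat \<lfloor>exp X\<rfloor>}" by (auto simp: VS_def le_nat_floor)
    show "finite VS" by (rule finite_subset[OF finVS]) simp
    show "f ` \<Omega> \<subseteq> VS"
    proof
      fix v assume "v \<in> f ` \<Omega>"
      then obtain M1 M2 n3 n2 n1 where M: "M1 \<in> MM1" "M2 \<in> MM2" "(n3, n2, n1) \<in> T M1 M2" and v: "v = f (M1, M2, n3, n2, n1)"
        unfolding \<Omega>_def by (elim imageE) auto
      obtain i j where ij: "i \<in> splits M1 M2 s1 s2" "j \<in> splits M1 M2 s1 s2"
        and t: "(n3, n2, n1) \<in> split_triples X V M1 M2 i j" using M(3) unfolding T_def by blast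
      note p = parts[OF M(1,2) ij(1)] and q = parts[OF M(1,2) ij(2)]
      show "v \<in> VS" unfolding v f_def prod.case VS_def
        by (rule form_triples_value[OF t m(1,2)[OF M(1,2)] V p(4-6) q(4-6) p(7) q(7) p(2) q(2) p(3) q(3)])
    qed
    show "inj_on f \<Omega>"
    proof (rule inj_onI)
      fix \<omega> \<omega>' assume w: "\<omega> \<in> \<Omega>" "\<omega>' \<in> \<Omega>" "f \<omega> = f \<omega>'"
      define D where "D v = {r. prime r \<and> 3 < r \<and> r dvd v}" for v :: nat
      have dec: "M1 = {r \<in> D (f \<omega>). exp V < real r \<and> real r \<le> exp (X / 40)} \<and>
          M2 = {r \<in> D (f \<omega>). real r \<le> exp (V / 4)} \<and>
          {n3} = {r \<in> D (f \<omega>). exp (V / 4) < real r \<and> real r \<le> exp V} \<and>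
          {n2} = {r \<in> D (f \<omega>). exp (X / 40) < real r \<and> real r \<le> exp (X / 10)} \<and>
          {n1} = {r \<in> D (f \<omega>). exp (X / 10) < real r}"
        if "\<omega> \<in> \<Omega>" "\<omega> = (M1, M2, n3, n2, n1)" for \<omega> M1 M2 n3 n2 n1
      proof -
        have M: "M1 \<in> MM1" "M2 \<in> MM2" "(n3, n2, n1) \<in> T M1 M2" using that by (auto simp: \<Omega>_def)
        obtain i j where ij: "i \<in> splits M1 M2 s1 s2" "j \<in> splits M1 M2 s1 s2"
          and t: "(n3, n2, n1) \<in> split_triples X V M1 M2 i j" using M(3) unfolding T_def by blast
        note t' = form_triplesD[OF t m(1,2)[OF M(1,2)] V']
        note q = parts[OF M(1,2) ij(2)]
        have pn: "prime n1" "prime n2" "prime n3"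
          using prime_forms_pairD(1)[OF t'(1) q(4)] prime_forms_pairD(1)[OF t'(2) q(5)] prime_forms_pairD(1)[OF t'(3) q(6)] by blast+
        have M1: "finite M1" "\<And>p. p \<in> M1 \<Longrightarrow> prime p \<and> exp V < real p \<and> real p \<le> exp (X / 40)"
          and M2: "finite M2" "\<And>p. p \<in> M2 \<Longrightarrow> prime p \<and> 3 < p \<and> real p \<le> exp (V / 4)"
        proof -
          have "exp b1 \<le> exp (X / 40)" "exp b2 \<le> exp (V / 4)" using b by auto
          then show "finite M1" "\<And>p. p \<in> M1 \<Longrightarrow> prime p \<and> exp V < real p \<and> real p \<le> exp (X / 40)"
            "finite M2" "\<And>p. p \<in> M2 \<Longrightarrow> prime p \<and> 3 < p \<and> real p \<le> exp (V / 4)"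
            using ctx(1,2,4,5,8,9)[OF M(1,2)] by (blast intro: order_trans)+
        qed
        have fw: "f \<omega> = 216 * (\<Prod>M1 * \<Prod>M2) * n1 * n2 * n3" by (simp add: f_def that(2))
        show ?thesis unfolding D_def fw
          using decode_value[OF V M1 M2 pn t'(4-8)] by blast
      qed
      obtain M1 M2 n3 n2 n1 where 1: "\<omega> = (M1, M2, n3, n2, n1)" by (cases \<omega>) auto
      obtain M1' M2' n3' n2' n1' where 2: "\<omega>' = (M1', M2', n3', n2', n1')" by (cases \<omega>') auto
      have "M1 = M1'" "M2 = M2'" "{n3} = {n3'}" "{n2} = {n2'}" "{n1} = {n1'}"
        using dec[OF w(1) 1] dec[OF w(2) 2] unfolding w(3) by argo+
      then show "\<omega> = \<omega>'" by (simp add: 1 2)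
    qed
  qed
  also have "card VS = V_phi_sigma (exp X)" unfolding V_phi_sigma_def VS_def ..
  finally show ?thesis by (simp add: C_def)
qed

section \<open>Choice of parameters\<close>

lemma fact_lower: "(real n / exp 1) ^ n \<le> fact n"
proof -
  have "real n ^ n / fact n \<le> exp (real n)" by (rule power_le_exp_fact) simp
  then have "real n ^ n \<le> exp (real n) * fact n" by (simp add: pos_divide_le_eq)
  also have "exp (real n) = exp 1 ^ n" by (simp flip: exp_of_nat_mult)
  finally show ?thesis by (simp add: power_divide field_simps)
qed

text \<open>The induction step needs \<open>(n / (n + 1)) ^ (n + 1) \<le> 1 / e\<close>, which comes
  from \<open>1 - y \<le> exp (- y)\<close>. The surplus factor \<open>e * n\<close> is affordable,
  since a bounded number of such factors costs only a power of \<open>L\<close>.\<close>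

lemma fact_upper:
  assumes "n \<ge> 1"
  shows "fact n \<le> exp 1 * real n * (real n / exp 1) ^ n"
  using assms
proof (induction n rule: dec_induct)
  case (step n)
  have n: "real n > 0" using step by simp
  have "1 - 1 / (real n + 1) \<le> exp (- (1 / (real n + 1)))"
    using exp_ge_add_one_self[of "- (1 / (real n + 1))"] by simp
  also have "1 - 1 / (real n + 1) = real n / (real n + 1)" by (simp add: field_simps)
  finally have "(real n / (real n + 1)) ^ Suc n \<le> exp (- (1 / (real n + 1))) ^ Suc n"
    by (intro power_mono) auto
  also have "\<dots> = exp (real (Suc n) * (- (1 / (real n + 1))))" by (simp only: exp_of_nat_mult)
  also have "real (Suc n) * (- (1 / (real n + 1))) = - 1" by (simp add: field_simps)
  finally have "real n ^ Suc n / (real n + 1) ^ Suc n \<le> 1 / exp 1"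
    by (simp only: power_divide exp_minus inverse_eq_divide)
  moreover have "(real n + 1) ^ Suc n > 0" using n by (intro zero_less_power) simp
  ultimately have "real n ^ Suc n \<le> 1 / exp 1 * (real n + 1) ^ Suc n"
    by (simp only: pos_divide_le_eq)
  then have "real n ^ Suc n * exp 1 \<le> 1 / exp 1 * (real n + 1) ^ Suc n * exp 1"
    by (intro mult_right_mono) simp_all
  then have "real n ^ Suc n * exp 1 \<le> (real n + 1) ^ Suc n" by simp
  then have *: "real n * (real n / exp 1) ^ n \<le> ((real n + 1) / exp 1) ^ Suc n"
    by (simp add: power_divide field_simps)
  have "fact (Suc n) = (real n + 1) * fact n" by simp
  also have "\<dots> \<le> (real n + 1) * (exp 1 * real n * (real n / exp 1) ^ n)"
    using step by (intro mult_left_mono) auto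
  also have "\<dots> = (real n + 1) * exp 1 * (real n * (real n / exp 1) ^ n)" by simp
  also have "\<dots> \<le> (real n + 1) * exp 1 * ((real n + 1) / exp 1) ^ Suc n"
    using * by (intro mult_left_mono) auto
  finally show ?case by (simp add: add.commute mult.commute)
qed simp

text \<open>The left-hand quotient is the square of the multinomial coefficient
  \<open>fact (d * s) / fact s ^ d\<close>, for two independent factorisations of \<open>m\<close>,
  times \<open>T ^ (d * s) / fact (d * s)\<close>, for the sum of \<open>1 / m\<close>. After
  Stirling the high powers of \<open>s\<close> cancel.\<close>

lemma fact_ratio_lower:
  assumes "s \<ge> 1" "q > 0" "T \<ge> q * real s"
  shows "fact (d * s) * T ^ (d * s) / fact s ^ (2 * d) \<ge> (real d * exp 1 * q) ^ (d * s) / (exp 1 * real s) ^ (2 * d)"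
proof -
  have s: "real s > 0" using assms by simp
  have "(real d * exp 1 * q) ^ (d * s) / (exp 1 * real s) ^ (2 * d)
      = (real (d * s) / exp 1) ^ (d * s) * (q * real s) ^ (d * s) / (exp 1 * real s * (real s / exp 1) ^ s) ^ (2 * d)"
  proof -
    have "((real s / exp 1) ^ s) ^ (2 * d) = ((real s / exp 1) ^ 2) ^ (d * s)"
      by (simp flip: power_mult add: mult_ac)
    moreover have "(real (d * s) / exp 1) ^ (d * s) * (q * real s) ^ (d * s)
        = (real d * exp 1 * q) ^ (d * s) * ((real s / exp 1) ^ 2) ^ (d * s)"
      by (simp flip: power_mult_distrib add: power2_eq_square mult_ac)
    moreover have "(exp 1 * real s * (real s / exp 1) ^ s) ^ (2 * d) = (exp 1 * real s) ^ (2 * d) * ((real s / exp 1) ^ s) ^ (2 * d)"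
      by (rule power_mult_distrib)
    moreover have "((real s / exp 1) ^ 2) ^ (d * s) \<noteq> 0" using s by simp
    ultimately show ?thesis by (metis mult_divide_mult_cancel_right)
  qed
  also have "\<dots> \<le> fact (d * s) * T ^ (d * s) / fact s ^ (2 * d)"
  proof (rule frac_le)
    show "(real (d * s) / exp 1) ^ (d * s) * (q * real s) ^ (d * s) \<le> fact (d * s) * T ^ (d * s)"
      using assms by (intro mult_mono fact_lower power_mono) auto
    show "fact s ^ (2 * d) \<le> (exp 1 * real s * (real s / exp 1) ^ s) ^ (2 * d)"
      using fact_upper[OF assms(1)] by (intro power_mono) auto
    show "0 \<le> fact (d * s) * T ^ (d * s)" using assms s by (intro mult_nonneg_nonneg zero_le_power) (auto intro: order_trans[rotated])
  qed simp
  finally show ?thesis .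
qed

lemma multinomial_eq:
  "real (((2 * s1) choose s1) * (((3 * s2) choose s2) * ((2 * s2) choose s2)))
    = fact (2 * s1) / fact s1 ^ 2 * (fact (3 * s2) / fact s2 ^ 3)"
proof -
  have 1: "real ((2 * n) choose n) = fact (2 * n) / (fact n * fact n)" for n
    by (subst binomial_fact) (auto simp: mult_2)
  have 2: "real ((3 * s2) choose s2) = fact (3 * s2) / (fact s2 * fact (2 * s2))"
    by (subst binomial_fact) auto
  show ?thesis by (simp add: 1 2 power2_eq_square power3_eq_cube)
qed

text \<open>The trinomial coefficient times \<open>2 ^ n\<close>-type bounds is read off from a
  single term of \<open>(1 + 2) ^ (3 * s2)\<close>. The bases 4 and 27 are the true growth rates, as
  they must be: they enter the balance behind \<open>scale_exp\<close>.\<close>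

lemma multinomial_upper:
  "((2 * s1) choose s1) * (((3 * s2) choose s2) * ((2 * s2) choose s2)) \<le> 4 ^ s1 * 27 ^ s2"
proof (rule mult_le_mono)
  have b: "(2 * n) choose n \<le> 4 ^ n" for n
    using binomial_le_pow2[of "2 * n" n] by (simp add: power_mult)
  show "(2 * s1) choose s1 \<le> 4 ^ s1" by (rule b)
  have "((3 * s2) choose s2) * ((2 * s2) choose s2) \<le> ((3 * s2) choose s2) * 4 ^ s2"
    using b by (rule mult_le_mono2)
  also have "\<dots> = ((3 * s2) choose s2) * 1 ^ s2 * 2 ^ (3 * s2 - s2)"
    by (simp add: power_mult)
  also have "\<dots> \<le> (\<Sum>k\<le>3 * s2. ((3 * s2) choose k) * 1 ^ k * 2 ^ (3 * s2 - k))"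
    by (rule member_le_sum) auto
  also have "\<dots> = (1 + 2) ^ (3 * s2)" using binomial_ring[of "1::nat" 2 "3 * s2"] by simp
  also have "(1 + 2 :: nat) = 3" by simp
  also have "(3::nat) ^ (3 * s2) = (3 ^ 3) ^ s2" by (simp only: power_mult)
  also have "(3 ^ 3 :: nat) = 27" by simp
  finally show "((3 * s2) choose s2) * ((2 * s2) choose s2) \<le> 27 ^ s2" .
qed

text \<open>The scale at which the number of factors changes from two to three: it makes the number
  of factorisations of \<open>m\<close>, about \<open>exp ((2 + \<theta>) L)\<close>, equal to the inverse of the probability that three given
  linear forms of sizes \<open>exp L, exp L, exp (\<theta> L)\<close> on the logarithmic scale are prime.\<close>

definition scale_exp :: real where
  "scale_exp = (2 - 2 * ln 2) / (3 * ln 3 - 2 * ln 2 - 1)"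

text \<open>Positivity amounts to \<open>2 * ln 2 < 2\<close>, the upper bound to
  \<open>3 * ln 3 > 3\<close>.\<close>

lemma scale_exp:
  "0 < scale_exp" "scale_exp < 1"
  "2 * (1 - scale_exp) * ln 2 + 3 * scale_exp * ln 3 = 2 + scale_exp"
proof -
  have "exp (1::real) < 3" using e_less_272 by linarith
  then have "ln (exp 1) < ln (3::real)" by (subst ln_less_cancel_iff) auto
  then have l3: "ln 3 > (1::real)" by simp
  have l2: "ln 2 < (1::real)" using ln_2_less_1 .
  have d: "3 * ln 3 - 2 * ln 2 - 1 > (0::real)" using l3 l2 by linarith
  show "0 < scale_exp" unfolding scale_exp_def using d l2 by simp
  show "scale_exp < 1" unfolding scale_exp_def using d l3 by simp
  have "scale_exp * (3 * ln 3 - 2 * ln 2 - 1) = 2 - 2 * ln 2"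
    unfolding scale_exp_def using d by simp
  then show "2 * (1 - scale_exp) * ln 2 + 3 * scale_exp * ln 3 = 2 + scale_exp"
    by (simp add: algebra_simps)
qed

lemma exp_dominates:
  assumes "d > (0::real)"
  shows "\<forall>\<^sub>F L in at_top. C * L ^ n \<le> exp (d * L)"
proof -
  have "((\<lambda>L. L ^ n / exp L) \<longlongrightarrow> 0) (at_top :: real filter)" by (rule tendsto_power_div_exp_0)
  moreover have "filterlim (\<lambda>L. d * L) at_top (at_top :: real filter)"
    using assms by (intro filterlim_tendsto_pos_mult_at_top[OF tendsto_const] filterlim_ident)
  ultimately have "((\<lambda>L. (d * L) ^ n / exp (d * L)) \<longlongrightarrow> 0) (at_top :: real filter)"
    by (rule filterlim_compose)
  moreover have "d ^ n / (\<bar>C\<bar> + 1) > 0" using assms by (intro divide_pos_pos) auto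
  ultimately have "\<forall>\<^sub>F L in at_top. (d * L) ^ n / exp (d * L) < d ^ n / (\<bar>C\<bar> + 1)"
    by (rule order_tendstoD(2))
  then show ?thesis using eventually_ge_at_top[of 0]
  proof eventually_elim
    case (elim L)
    have "(d * L) ^ n < d ^ n / (\<bar>C\<bar> + 1) * exp (d * L)"
      using elim(1) by (simp add: pos_divide_less_eq)
    then have "d ^ n * ((\<bar>C\<bar> + 1) * L ^ n) < d ^ n * exp (d * L)"
      by (simp add: power_mult_distrib field_simps)
    then have "(\<bar>C\<bar> + 1) * L ^ n < exp (d * L)" using assms by simp
    moreover have "C * L ^ n \<le> (\<bar>C\<bar> + 1) * L ^ n" using elim(2) by (intro mult_right_mono) auto
    ultimately show ?case by linarith
  qed
qed

text \<open>In the condition on \<open>T\<close>, \<open>2 * C\<close> pays for Mertens at both ends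
  of the range, and 1 for the primes already chosen: fewer than \<open>s\<close> of them, each with
  reciprocal at most \<open>1 / s\<close>.\<close>

lemma esym_primes_lower:
  assumes C: "\<And>t. t \<ge> 4 \<Longrightarrow> \<bar>psum t - ln (ln t)\<bar> \<le> C"
    and st: "4 \<le> s" "s \<le> t" and T: "0 \<le> T" "T + 1 + 2 * C \<le> ln (ln t) - ln (ln s)" and r: "real r \<le> s"
  shows "esym (\<lambda>p. 1 / real p) r {p. prime p \<and> s < real p \<and> real p \<le> t} \<ge> T ^ r / fact r"
proof (rule esym_lower[where e = "1 / s"])
  let ?P = "{p. prime p \<and> s < real p \<and> real p \<le> t}"
  show "finite ?P" by (rule finite_subset[OF _ finite_primes_le_real[of t]]) auto
  show "T \<ge> 0" by (rule T)
  have sum: "(\<Sum>p\<in>?P. 1 / real p) \<ge> T + 1"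
    unfolding psum_diff[OF st(2)] using C[of s] C[of t] st T by linarith
  show "T \<le> (\<Sum>p\<in>?P. 1 / real p) - real i * (1 / s)" if "i < r" for i
  proof -
    have "real i \<le> s" using that r by linarith
    then have "real i * (1 / s) \<le> 1" using st by simp
    then show ?thesis using sum by linarith
  qed
qed (use st in \<open>auto intro!: divide_left_mono\<close>)

lemma ln_leI: "0 < x \<Longrightarrow> x \<le> exp y \<Longrightarrow> ln x \<le> (y::real)"
  using ln_mono[of x "exp y"] by simp

text \<open>\<open>(3 * L) ^ 10\<close> collects the ten Stirling losses
  \<open>e * s \<le> 3 * L\<close> from \<open>fact s1 ^ 4\<close> and \<open>fact s2 ^ 6\<close>.
  For \<open>s1\<close>, \<open>s2\<close> near \<open>(1 - \<theta>) * L\<close>,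
  \<open>\<theta> * L\<close> and \<open>q\<close> near 1, the numerator is about
  \<open>exp ((4 + 2 * \<theta>) * L)\<close> by the choice of \<open>scale_exp\<close>.\<close>

lemma main_term_lower:
  fixes s1 s2 :: nat
  assumes q: "0 < q" and s: "s1 \<ge> 1" "s2 \<ge> 1" and L: "real s1 \<le> L" "real s2 \<le> L"
    and T: "T1 \<ge> q * real s1" "T2 \<ge> q * real s2"
    and F: "F = ((2 * s1) choose s1) * (((3 * s2) choose s2) * ((2 * s2) choose s2))"
    and E: "E1 \<ge> T1 ^ (2 * s1) / fact (2 * s1)" "E2 \<ge> T2 ^ (3 * s2) / fact (3 * s2)"
  shows "real F ^ 2 * (E1 * E2) \<ge> (2 * exp 1 * q) ^ (2 * s1) * (3 * exp 1 * q) ^ (3 * s2) / (3 * L) ^ 10"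
proof -
  have T0: "T1 \<ge> 0" "T2 \<ge> 0" using T q s by (auto intro: order_trans[rotated])
  have e3: "exp (1::real) \<le> 3" using e_less_272 by linarith
  have L0: "L \<ge> 1" using s L by linarith
  have den: "(exp 1 * real n) ^ k \<le> (3 * L) ^ k" if "real n \<le> L" for n k
    using that e3 L0 by (intro power_mono mult_mono) auto
  have r1: "(2 * exp 1 * q) ^ (2 * s1) / (3 * L) ^ 4 \<le> fact (2 * s1) * T1 ^ (2 * s1) / fact s1 ^ 4"
  proof -
    have "(2 * exp 1 * q) ^ (2 * s1) / (3 * L) ^ 4 \<le> (2 * exp 1 * q) ^ (2 * s1) / (exp 1 * real s1) ^ 4"
      by (rule divide_left_mono[OF den[OF L(1)]]) (use q s L0 in auto)
    also have "\<dots> \<le> fact (2 * s1) * T1 ^ (2 * s1) / fact s1 ^ 4"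
      using fact_ratio_lower[OF s(1) q T(1), of 2] by simp
    finally show ?thesis .
  qed
  have r2: "(3 * exp 1 * q) ^ (3 * s2) / (3 * L) ^ 6 \<le> fact (3 * s2) * T2 ^ (3 * s2) / fact s2 ^ 6"
  proof -
    have "(3 * exp 1 * q) ^ (3 * s2) / (3 * L) ^ 6 \<le> (3 * exp 1 * q) ^ (3 * s2) / (exp 1 * real s2) ^ 6"
      by (rule divide_left_mono[OF den[OF L(2)]]) (use q s L0 in auto)
    also have "\<dots> \<le> fact (3 * s2) * T2 ^ (3 * s2) / fact s2 ^ 6"
      using fact_ratio_lower[OF s(2) q T(2), of 3] by simp
    finally show ?thesis .
  qed
  define A where "A = (2 * exp 1 * q) ^ (2 * s1)"
  define B where "B = (3 * exp 1 * q) ^ (3 * s2)"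
  have AB: "A > 0" "B > 0" using q by (simp_all add: A_def B_def)
  have "A * B / (3 * L) ^ 10 = (A / (3 * L) ^ 4) * (B / (3 * L) ^ 6)"
    by (simp flip: power_add)
  also have "\<dots> \<le> (fact (2 * s1) * T1 ^ (2 * s1) / fact s1 ^ 4) * (fact (3 * s2) * T2 ^ (3 * s2) / fact s2 ^ 6)"
    using r1 r2 q L0 T0 unfolding A_def B_def by (intro mult_mono) auto
  also have "\<dots> = real F ^ 2 * (T1 ^ (2 * s1) / fact (2 * s1) * (T2 ^ (3 * s2) / fact (3 * s2)))"
  proof -
    define a b c d where "a = (fact (2 * s1) :: real)" and "b = (fact (3 * s2) :: real)"
      and "c = (fact s1 :: real)" and "d = (fact s2 :: real)"
    have "a \<noteq> 0" "b \<noteq> 0" "c \<noteq> 0" "d \<noteq> 0" by (simp_all add: a_def b_def c_def d_def)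
    then have "(a * T1 ^ (2 * s1) / c ^ 4) * (b * T2 ^ (3 * s2) / d ^ 6)
      = (a / c ^ 2 * (b / d ^ 3)) ^ 2 * (T1 ^ (2 * s1) / a * (T2 ^ (3 * s2) / b))"
      by (simp add: power_mult_distrib power_divide power2_eq_square eval_nat_numeral mult_ac)
    then show ?thesis unfolding F multinomial_eq a_def b_def c_def d_def .
  qed
  also have "\<dots> \<le> real F ^ 2 * (E1 * E2)"
    using E T0 by (intro mult_left_mono mult_mono) (auto intro: order_trans[rotated])
  finally show ?thesis unfolding A_def B_def .
qed

section \<open>The lower bound with a fixed exponent \<open>1 + \<delta>\<close>\<close>

lemma V_phi_sigma_eventually:
  assumes UL: Hypothesis_UL and \<delta>: "0 < \<delta>" "\<delta> \<le> 1"
  shows "\<forall>\<^sub>F L in at_top. real (V_phi_sigma (exp (exp L))) \<ge> exp (exp L) * exp (- (1 + \<delta>) * L)"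
proof -
  define \<theta> where "\<theta> = scale_exp"
  note \<theta> = scale_exp[folded \<theta>_def]
  \<comment> \<open>\<open>q\<close> is the fraction of the Mertens mass of the prime ranges that is
    kept. It costs \<open>(2 + \<theta>) * \<delta> / 6 \<le> \<delta> / 2\<close> in the exponent;
    the other half of \<open>\<delta>\<close> will absorb the powers of \<open>L\<close>.\<close>
  define q where "q = exp (- \<delta> / 6)"
  have q: "0 < q" "q < 1" "ln q = - \<delta> / 6" using \<delta> by (simp_all add: q_def)
  \<comment> \<open>Lowering the upper ends \<open>b1\<close> and \<open>b2\<close> by a factor
    \<open>exp (\<eta> * L)\<close> makes room for products of up to \<open>L\<close> primes, at a
    cost of \<open>\<eta> * L\<close> in the sum of reciprocals. The value keeps this cost within
    half of what \<open>q\<close> gives away in either range.\<close>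
  define \<eta> where "\<eta> = (1 - q) * (1 - \<theta>) * \<theta> / 2"
  have \<eta>0: "\<eta> > 0" using q \<theta> by (simp add: \<eta>_def)
  have \<eta>1: "2 * \<eta> \<le> (1 - q) * (1 - \<theta>)" "2 * \<eta> \<le> (1 - q) * \<theta>"
  proof -
    have "(1 - q) * (1 - \<theta>) * \<theta> \<le> (1 - q) * (1 - \<theta>) * 1" using q \<theta> by (intro mult_left_mono) auto
    moreover have "2 * \<eta> = (1 - q) * (1 - \<theta>) * \<theta>" by (simp add: \<eta>_def)
    ultimately show "2 * \<eta> \<le> (1 - q) * (1 - \<theta>)" by (simp only: mult_1_right)
    have "(1 - q) * \<theta> * (1 - \<theta>) \<le> (1 - q) * \<theta> * 1" using q \<theta> by (intro mult_left_mono) auto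
    moreover have "2 * \<eta> = (1 - q) * \<theta> * (1 - \<theta>)" by (simp add: \<eta>_def)
    ultimately show "2 * \<eta> \<le> (1 - q) * \<theta>" by (simp only: mult_1_right)
  qed
  have \<eta>\<theta>: "\<eta> \<le> \<theta>" "\<eta> \<le> 1 - \<theta>"
  proof -
    have "(1 - q) * \<theta> \<le> 1 * \<theta>" "(1 - q) * (1 - \<theta>) \<le> 1 * (1 - \<theta>)" using q \<theta> by (intro mult_right_mono; simp)+
    then have "2 * \<eta> \<le> \<theta>" "2 * \<eta> \<le> 1 - \<theta>"
      using order_trans[OF \<eta>1(1)] order_trans[OF \<eta>1(2)] by (simp_all only: mult_1_left)
    then show "\<eta> \<le> \<theta>" "\<eta> \<le> 1 - \<theta>" using \<eta>0 by linarith+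
  qed
  obtain C where C: "C > 0" "\<And>t. t \<ge> 4 \<Longrightarrow> \<bar>psum t - ln (ln t)\<bar> \<le> C" using mertens by blast
  obtain c Y0 where c: "c > 0" and Y0: "\<And>Y a b. Y \<ge> Y0 \<Longrightarrow> a > 0 \<Longrightarrow> b > 0 \<Longrightarrow> 6 * real a \<le> Y powr 1 \<Longrightarrow> 6 * real b \<le> Y powr 1 \<Longrightarrow>
     real (card (prime_forms_le (pair_forms a b) Y)) \<ge> c * (Y / ln Y ^ 3)"
  proof -
    obtain c where c: "c > 0" and ev: "\<forall>\<^sub>F Y in at_top. \<forall>a b. a > 0 \<longrightarrow> b > 0 \<longrightarrow> 6 * real a \<le> Y powr 1 \<longrightarrow> 6 * real b \<le> Y powr 1 \<longrightarrow>
       real (card (prime_forms_le (pair_forms a b) Y)) \<ge> c * (Y / ln Y ^ 3)"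
      using UL_pair_lower[OF UL zero_less_one] by blast
    from ev obtain Y0 where "\<forall>Y\<ge>Y0. \<forall>a b. a > 0 \<longrightarrow> b > 0 \<longrightarrow> 6 * real a \<le> Y powr 1 \<longrightarrow> 6 * real b \<le> Y powr 1 \<longrightarrow>
       real (card (prime_forms_le (pair_forms a b) Y)) \<ge> c * (Y / ln Y ^ 3)"
      unfolding eventually_at_top_linorder by (elim exE)
    then show thesis using c by (intro that[of c Y0]) blast+
  qed
  have "\<forall>\<^sub>F v in at_top. exp (v / 4) + 1 \<le> c / 2 * (exp (v / 2) / v ^ 3)"
    using c by real_asymp
  then obtain v0 where v0: "\<And>v. v \<ge> v0 \<Longrightarrow> exp (v / 4) + 1 \<le> c / 2 * (exp (v / 2) / v ^ 3)"
    unfolding eventually_at_top_linorder by blast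
  define K0 where "K0 = 2 * (200 * exp (2 * C + 30)) ^ 5 + 4"
  \<comment> \<open>\<open>exp 13\<close> pays for rounding \<open>s1\<close> and \<open>s2\<close>
    down, through \<open>2 * \<alpha> + 3 * \<beta> \<le> 13\<close> below. All losses together are
    \<open>Z * L ^ 40\<close>: 30 powers from \<open>K ^ 3\<close> with
    \<open>K \<le> K0 * L ^ 10\<close>, and 10 from \<open>main_term_lower\<close>.\<close>
  define Z where "Z = 5 * 10 ^ 17 * K0 ^ 3 * 3 ^ 10 * exp 13 / c ^ 6"
  have K0: "K0 > 0" by (simp add: K0_def add_pos_pos)
  have d: "(1 - q) * (1 - \<theta>) / 2 > 0" "(1 - q) * \<theta> / 4 > 0" "1 - \<theta> > 0" "\<delta> / 2 > 0"
    using q \<theta> \<delta> by auto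
  show ?thesis
    using exp_dominates[OF \<theta>(1), of "max 16 (max (4 * \<bar>Y0\<bar>) \<bar>v0\<bar>)" 0] exp_dominates[OF \<theta>(1), of 4000 1]
      exp_dominates[OF d(3), of 100 0] exp_dominates[OF \<eta>0, of 160 1] exp_dominates[OF d(2), of 1 1]
      exp_dominates[OF d(4), of Z 40]
      eventually_ge_at_top[of "max 10 (5 * C)"]
      eventually_ge_at_top[of "(2 * C + 1) / ((1 - q) * (1 - \<theta>) / 2)"]
      eventually_ge_at_top[of "(2 * C + 1) / ((1 - q) * \<theta> / 4)"]
      eventually_ge_at_top[of "1 / \<theta>"] eventually_ge_at_top[of "1 / (1 - \<theta>)"]
  proof eventually_elim
    case (elim L)
    define X where "X = exp L"
    define V where "V = exp (\<theta> * L)"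
    define b1 where "b1 = exp ((1 - \<eta>) * L)"
    define b2 where "b2 = exp ((\<theta> - \<eta>) * L)"
    define s1 where "s1 = nat \<lfloor>(1 - \<theta>) * L\<rfloor>"
    define s2 where "s2 = nat \<lfloor>\<theta> * L\<rfloor>"
    define P1 where "P1 = {p. prime p \<and> exp V < real p \<and> real p \<le> exp b1}"
    \<comment> \<open>Starting at \<open>X\<close> makes the single reciprocals small enough for
      \<open>esym_primes_lower\<close>, which needs \<open>3 * s2\<close> to be at most the left
      end. The price is \<open>ln (ln X) = ln L\<close>, small against \<open>L\<close>.\<close>
    define P2 where "P2 = {p. prime p \<and> X < real p \<and> real p \<le> exp b2}"
    define F where "F = ((2 * s1) choose s1) * (((3 * s2) choose s2) * ((2 * s2) choose s2))"
    define K where "K = 2 * (200 * L\<^sup>2 * exp (2 * C + 30)) ^ 5 + 4"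
    have L: "L \<ge> 10" "L \<ge> 5 * C" using elim(7) by auto
    have V: "V \<ge> 16" "V \<ge> 4 * \<bar>Y0\<bar>" "V \<ge> v0" using elim(1) by (auto simp: V_def)
    have VL: "V \<ge> 4000 * L" using elim(2) by (simp add: V_def)
    have VX: "V \<le> X / 100"
    proof -
      have "V * 100 \<le> V * exp ((1 - \<theta>) * L)" using elim(3) by (intro mult_left_mono) (auto simp: V_def)
      also have "\<dots> = X" by (simp add: V_def X_def algebra_simps flip: exp_add)
      finally show ?thesis by simp
    qed
    have sL: "real s1 \<le> (1 - \<theta>) * L" "real s2 \<le> \<theta> * L" "real s1 \<ge> (1 - \<theta>) * L - 1" "real s2 \<ge> \<theta> * L - 1"
      using L \<theta> unfolding s1_def s2_def by (simp_all add: of_nat_floor)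
    have s1: "s1 \<ge> 1" "s2 \<ge> 1"
    proof -
      have "(1 - \<theta>) * L \<ge> 1" "\<theta> * L \<ge> 1" using elim(10,11) \<theta> by (simp_all add: field_simps)
      then show "s1 \<ge> 1" "s2 \<ge> 1" unfolding s1_def s2_def by (simp_all add: le_nat_floor)
    qed
    have sL': "real s1 \<le> L" "real s2 \<le> L"
    proof -
      have "(1 - \<theta>) * L \<le> 1 * L" "\<theta> * L \<le> 1 * L" using L \<theta> by (intro mult_right_mono; simp)+
      then show "real s1 \<le> L" "real s2 \<le> L" using sL by linarith+
    qed
    have b1X: "b1 * (160 * L) \<le> X"
    proof -
      have "b1 * (160 * L) \<le> b1 * exp (\<eta> * L)" using elim(4) by (intro mult_left_mono) (auto simp: b1_def)
      also have "\<dots> = X" by (simp add: b1_def X_def algebra_simps flip: exp_add)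
      finally show ?thesis .
    qed
    have b2V: "b2 * (160 * L) \<le> V"
    proof -
      have "b2 * (160 * L) \<le> b2 * exp (\<eta> * L)" using elim(4) by (intro mult_left_mono) (auto simp: b2_def)
      also have "\<dots> = V" by (simp add: b2_def V_def algebra_simps flip: exp_add)
      finally show ?thesis .
    qed
    have b21: "1 \<le> b2" "b2 \<le> b1" "V \<le> b1" using \<eta>\<theta> \<theta> L by (auto simp: b1_def b2_def V_def intro!: mult_right_mono)
    have Lb: "b1 * 10 \<le> b1 * L" "b2 * 10 \<le> b2 * L" "b2 * L \<le> b1 * L"
      using L b21 by (intro mult_left_mono mult_right_mono; simp)+
    have sb: "real s1 * b1 \<le> b1 * L" "real s2 * b2 \<le> b2 * L"
      using sL' b21 by (subst mult.commute, intro mult_left_mono; simp)+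
    have main: "real (V_phi_sigma (exp X)) \<ge> c ^ 6 / (5 * 10 ^ 17 * K ^ 3) * real F ^ 2 * exp X / (X ^ 5 * V ^ 2)
      * (esym (\<lambda>p. 1 / real p) (2 * s1) P1 * esym (\<lambda>p. 1 / real p) (3 * s2) P2)"
    proof (rule V_phi_sigma_lower[OF c])
      show "K > 0" using L by (simp add: K_def add_nonneg_pos)
      show "V \<ge> 16" "V \<le> X / 100" by (rule V VX)+
      show "exp (v / 4) + 1 \<le> c / 2 * (exp (v / 2) / v ^ 3)" if "v \<ge> V" for v using v0 V that by simp
      show "real (card (prime_forms_le (pair_forms a b) (exp w))) \<ge> c * (exp w / w ^ 3)"
        if "V / 4 \<le> w" "a > 0" "b > 0" "6 * real a \<le> exp w" "6 * real b \<le> exp w" for w a b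
      proof -
        have "Y0 \<le> exp w" using V(2) that(1) exp_ge_add_one_self[of w] by linarith
        then show ?thesis using Y0[of "exp w" a b] that by simp
      qed
      show "real (card (prime_forms_le FS (exp w))) \<le> K * (exp w / w ^ card FS)"
        if w: "V / 4 \<le> w" "w \<le> X" and FS: "finite FS" "card FS \<le> 5"
          "\<And>c d. (c, d) \<in> FS \<Longrightarrow> 0 < c \<and> real_of_int c \<le> exp X \<and> \<bar>d\<bar> \<le> 1"
          "\<And>c d c' d'. (c, d) \<in> FS \<Longrightarrow> (c', d') \<in> FS \<Longrightarrow> (c, d) \<noteq> (c', d') \<Longrightarrow> c * d' - c' * d \<noteq> 0" for w FS
        unfolding K_def
        by (rule sieve_forms_upper[OF C L _ _ FS(1) refl FS(2) FS(3)[unfolded X_def] FS(4)])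
           (use w VL in \<open>auto simp: X_def\<close>)
      show "finite P1" unfolding P1_def by (rule finite_subset[OF _ finite_primes_le_real[of "exp b1"]]) auto
      show "finite P2" unfolding P2_def by (rule finite_subset[OF _ finite_primes_le_real[of "exp b2"]]) auto
      show "prime p \<and> exp V < real p \<and> real p \<le> exp b1" if "p \<in> P1" for p using that by (simp add: P1_def)
      show "prime p \<and> 3 < p \<and> real p \<le> exp b2" if "p \<in> P2" for p using that VX V by (auto simp: P2_def)
      show "b1 \<le> X / 40" "b2 \<le> V / 4" using b1X b2V Lb b21 by linarith+
      show "2 + real s1 * b1 + real s2 * b2 \<le> X / 40" using b1X sb Lb b21 by linarith
      show "2 + real s2 * b2 \<le> V / 4" using b2V sb Lb b21 by linarith
      show "F = ((2 * s1) choose s1) * (((3 * s2) choose s2) * ((2 * s2) choose s2))" by (rule F_def)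
      have pw: "a ^ n \<le> exp (ln a * t)" if "a \<ge> 1" "real n \<le> t" for a t :: real and n
      proof -
        have "a ^ n = exp (real n * ln a)" using that by (simp add: exp_of_nat_mult)
        also have "\<dots> \<le> exp (t * ln a)" using that by (simp add: mult_right_mono)
        finally show ?thesis by (simp add: mult.commute)
      qed
      have l4: "ln 4 = 2 * ln (2::real)" using ln_realpow[of 2 2] by simp
      have l27: "ln 27 = 3 * ln (3::real)" using ln_realpow[of 3 3] by simp
      have "real F \<le> real (4 ^ s1 * 27 ^ s2)" unfolding F_def using multinomial_upper by (simp only: of_nat_le_iff)
      also have "\<dots> = 4 ^ s1 * 27 ^ s2" by simp
      also have "\<dots> \<le> exp (ln 4 * ((1 - \<theta>) * L)) * exp (ln 27 * (\<theta> * L))"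
        using sL by (intro mult_mono pw) auto
      also have "\<dots> = exp ((2 * (1 - \<theta>) * ln 2 + 3 * \<theta> * ln 3) * L)"
        by (simp add: l4 l27 algebra_simps flip: exp_add)
      also have "\<dots> = X ^ 2 * V"
        unfolding \<theta>(3) by (simp add: X_def V_def power2_eq_square algebra_simps flip: exp_add)
      finally show "real F \<le> X ^ 2 * V" .
      have l2: "ln 2 \<le> (1::real)" "ln 2 \<ge> (0::real)" using ln_2_less_1 by auto
      have "4 ^ s2 \<le> exp (ln 4 * (\<theta> * L))" using sL by (intro pw) auto
      also have "\<dots> \<le> exp (L + \<theta> * L)"
      proof -
        have "\<theta> * L \<le> 1 * L" using \<theta> L by (intro mult_right_mono) auto
        moreover have "2 * ln 2 * (\<theta> * L) \<le> 2 * 1 * (\<theta> * L)" using l2 \<theta> L by (intro mult_right_mono mult_left_mono) auto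
        ultimately show ?thesis by (simp add: l4)
      qed
      also have "\<dots> = X * V" by (simp add: X_def V_def exp_add)
      finally show "4 ^ s2 \<le> X * V" .
      have "4 ^ (s1 + s2) \<le> exp (ln 4 * L)" using sL by (intro pw) (auto simp: algebra_simps)
      also have "\<dots> \<le> exp (2 * L)" using l2 L by (simp add: l4)
      also have "\<dots> = X ^ 2" by (simp add: X_def power2_eq_square flip: exp_add)
      finally show "4 ^ (s1 + s2) \<le> X ^ 2" .
    qed
    have X4: "X \<ge> 4" "X \<ge> 3 * L" "X \<ge> 1" using VX V VL L by linarith+
    have eV: "exp V \<ge> V" using exp_ge_add_one_self[of V] by linarith
    have T1: "esym (\<lambda>p. 1 / real p) (2 * s1) P1 \<ge> (q * ((1 - \<theta>) * L)) ^ (2 * s1) / fact (2 * s1)"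
      unfolding P1_def
    proof (rule esym_primes_lower[OF C(2)])
      show "4 \<le> exp V" "real (2 * s1) \<le> exp V" using eV V VL sL' L by simp_all
      show "exp V \<le> exp b1" using b21 by simp
      show "0 \<le> q * ((1 - \<theta>) * L)" using q \<theta> L by simp
      have "2 * C + 1 \<le> (1 - q) * (1 - \<theta>) / 2 * L" using elim(8) d(1) by (simp add: field_simps)
      moreover have "\<eta> * L \<le> (1 - q) * (1 - \<theta>) / 2 * L" using \<eta>1 L by (intro mult_right_mono) auto
      ultimately show "q * ((1 - \<theta>) * L) + 1 + 2 * C \<le> ln (ln (exp b1)) - ln (ln (exp V))"
        by (simp add: b1_def V_def algebra_simps)
    qed
    have T2: "esym (\<lambda>p. 1 / real p) (3 * s2) P2 \<ge> (q * (\<theta> * L)) ^ (3 * s2) / fact (3 * s2)"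
      unfolding P2_def
    proof (cases "X \<le> exp b2")
      case True
      show "esym (\<lambda>p. 1 / real p) (3 * s2) {p. prime p \<and> X < real p \<and> real p \<le> exp b2} \<ge> (q * (\<theta> * L)) ^ (3 * s2) / fact (3 * s2)"
      proof (rule esym_primes_lower[OF C(2)])
        show "4 \<le> X" "real (3 * s2) \<le> X" using X4 sL' L by simp_all
        show "X \<le> exp b2" by (rule True)
        show "0 \<le> q * (\<theta> * L)" using q \<theta> L by simp
        have "2 * C + 1 \<le> (1 - q) * \<theta> / 4 * L" using elim(9) d(2) by (simp add: field_simps)
        moreover have "\<eta> * L \<le> (1 - q) * \<theta> / 2 * L" using \<eta>1 L by (intro mult_right_mono) auto
        moreover have "ln L \<le> (1 - q) * \<theta> / 4 * L"
          using elim(5) L by (intro ln_leI) auto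
        ultimately show "q * (\<theta> * L) + 1 + 2 * C \<le> ln (ln (exp b2)) - ln (ln X)"
          by (simp add: b2_def X_def algebra_simps)
      qed
    next
      case False
      then have "exp b2 < exp L" by (simp add: X_def)
      then have "b2 < L" by simp
      then have "ln b2 < ln L" using b21 by (subst ln_less_cancel_iff) auto
      moreover have "ln L \<le> (1 - q) * \<theta> / 4 * L"
        using elim(5) L by (intro ln_leI) auto
      moreover have "\<eta> * L \<le> (1 - q) * \<theta> / 2 * L" using \<eta>1 L by (intro mult_right_mono) auto
      moreover have "(1 - q) * (\<theta> * L) \<le> 1 * (\<theta> * L)" using q \<theta> L by (intro mult_right_mono) auto
      moreover have "\<theta> * L > 0" using \<theta> L by simp
      ultimately have False by (simp add: b2_def algebra_simps)
      then show "esym (\<lambda>p. 1 / real p) (3 * s2) {p. prime p \<and> X < real p \<and> real p \<le> exp b2} \<ge> (q * (\<theta> * L)) ^ (3 * s2) / fact (3 * s2)" ..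
    qed
    define E1 where "E1 = esym (\<lambda>p. 1 / real p) (2 * s1) P1"
    define E2 where "E2 = esym (\<lambda>p. 1 / real p) (3 * s2) P2"
    have FE1: "(2 * exp 1 * q) ^ (2 * s1) * (3 * exp 1 * q) ^ (3 * s2) / (3 * L) ^ 10 \<le> real F ^ 2 * (E1 * E2)"
      using q sL by (intro main_term_lower[OF q(1) s1 sL' _ _ F_def T1[folded E1_def] T2[folded E2_def]] mult_left_mono) auto
    have FE2: "exp ((4 + 2 * \<theta> - \<delta> / 2) * L - 13) \<le> (2 * exp 1 * q) ^ (2 * s1) * (3 * exp 1 * q) ^ (3 * s2)"
    proof -
      define \<alpha> where "\<alpha> = ln 2 + 1 + ln q"
      define \<beta> where "\<beta> = ln 3 + 1 + ln q"
      have "exp (1::real) * exp 1 \<ge> 2.7 * 2.7" using e_approx_32 by (intro mult_mono) (auto simp: abs_if split: if_splits)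
      then have "3 \<le> exp (2::real)" by (simp flip: exp_add)
      then have "ln 3 \<le> (2::real)" by (intro ln_leI) auto
      moreover have "ln 2 \<le> (1::real)" "ln 2 \<ge> (0::real)" "ln 3 \<ge> (0::real)" using ln_2_less_1 by auto
      ultimately have \<alpha>: "0 \<le> \<alpha>" "\<alpha> \<le> 2" "0 \<le> \<beta>" "\<beta> \<le> 3"
        unfolding \<alpha>_def \<beta>_def using q(3) \<delta> by linarith+
      have e: "exp (real n * \<gamma>) = exp \<gamma> ^ n" for n \<gamma> by (simp add: exp_of_nat_mult)
      have p1: "(2 * exp 1 * q) ^ (2 * s1) = exp (real (2 * s1) * \<alpha>)"
        unfolding e \<alpha>_def exp_add using q(1) by simp
      have p2: "(3 * exp 1 * q) ^ (3 * s2) = exp (real (3 * s2) * \<beta>)"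
        unfolding e \<beta>_def exp_add using q(1) by simp
      have "((1 - \<theta>) * L - 1) * (2 * \<alpha>) \<le> real s1 * (2 * \<alpha>)" "(\<theta> * L - 1) * (3 * \<beta>) \<le> real s2 * (3 * \<beta>)"
        using sL \<alpha> by (intro mult_right_mono; simp)+
      moreover have "((1 - \<theta>) * L - 1) * (2 * \<alpha>) + (\<theta> * L - 1) * (3 * \<beta>)
          = ((2 * (1 - \<theta>) * ln 2 + 3 * \<theta> * ln 3) + (2 + \<theta>) * (1 + ln q)) * L - 2 * \<alpha> - 3 * \<beta>"
        by (simp add: \<alpha>_def \<beta>_def algebra_simps)
      moreover have "((2 * (1 - \<theta>) * ln 2 + 3 * \<theta> * ln 3) + (2 + \<theta>) * (1 + ln q)) * L \<ge> (4 + 2 * \<theta> - \<delta> / 2) * L"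
      proof (rule mult_right_mono)
        have "(2 + \<theta>) * (\<delta> / 6) \<le> 3 * (\<delta> / 6)" using \<theta> \<delta> by (intro mult_right_mono) auto
        then show "4 + 2 * \<theta> - \<delta> / 2 \<le> (2 * (1 - \<theta>) * ln 2 + 3 * \<theta> * ln 3) + (2 + \<theta>) * (1 + ln q)"
          unfolding \<theta>(3) q(3) by (simp add: algebra_simps)
      qed (use L in simp)
      ultimately have "(4 + 2 * \<theta> - \<delta> / 2) * L - 13 \<le> real (2 * s1) * \<alpha> + real (3 * s2) * \<beta>"
        using \<alpha> by simp
      then show ?thesis unfolding p1 p2 by (simp flip: exp_add)
    qed
    have FE: "exp ((4 + 2 * \<theta> - \<delta> / 2) * L - 13) / (3 * L) ^ 10 \<le> real F ^ 2 * (E1 * E2)"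
      by (rule order.trans[OF divide_right_mono[OF FE2] FE1]) (use L in simp)
    have KL: "0 < K" "K \<le> K0 * L ^ 10"
    proof -
      show "0 < K" using L by (simp add: K_def add_nonneg_pos)
      have "1 \<le> L ^ 10" using L by (intro one_le_power) auto
      moreover have "(200 * L\<^sup>2 * exp (2 * C + 30)) ^ 5 = (200 * exp (2 * C + 30)) ^ 5 * L ^ 10"
        by (simp add: power_mult_distrib flip: power_mult)
      ultimately show "K \<le> K0 * L ^ 10" by (simp add: K_def K0_def algebra_simps)
    qed
    have XV: "X ^ 5 * V ^ 2 = exp ((5 + 2 * \<theta>) * L)"
      unfolding X_def V_def by (simp flip: exp_of_nat_mult exp_add) (simp add: algebra_simps)
    define R where "R = 5 * 10 ^ 17 * K ^ 3 * (3 * L) ^ 10 * exp 13 / c ^ 6"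
    have R: "0 < R" "R \<le> exp (\<delta> / 2 * L)"
    proof -
      show "0 < R" using KL c L by (simp add: R_def)
      have "K ^ 3 \<le> (K0 * L ^ 10) ^ 3" using KL by (intro power_mono) auto
      then have "R \<le> 5 * 10 ^ 17 * (K0 * L ^ 10) ^ 3 * (3 * L) ^ 10 * exp 13 / c ^ 6"
        unfolding R_def using c L by (intro divide_right_mono mult_right_mono mult_left_mono) auto
      also have "\<dots> = Z * L ^ 40"
        by (simp add: Z_def power_mult_distrib flip: power_mult power_add)
      also have "\<dots> \<le> exp (\<delta> / 2 * L)" by (rule elim(6))
      finally show "R \<le> exp (\<delta> / 2 * L)" .
    qed
    \<comment> \<open>The exponent \<open>4 + 2 * \<theta>\<close> gained from the factorisations
      and \<open>5 + 2 * \<theta>\<close> lost to primality differ by 1, the exponent in the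
      theorem. One half of \<open>\<delta>\<close> went into \<open>q\<close>, the other pays for
      \<open>R\<close>.\<close>
    have "exp X * exp (- (1 + \<delta>) * L) = exp X * exp (- (1 + \<delta> / 2) * L) / exp (\<delta> / 2 * L)"
      by (simp add: algebra_simps flip: exp_add exp_diff)
    also have "\<dots> \<le> exp X * exp (- (1 + \<delta> / 2) * L) / R"
      using R by (intro divide_left_mono) auto
    also have "\<dots> = c ^ 6 / (5 * 10 ^ 17 * K ^ 3) * exp X / exp ((5 + 2 * \<theta>) * L) * (exp ((4 + 2 * \<theta> - \<delta> / 2) * L - 13) / (3 * L) ^ 10)"
    proof -
      have "exp (- (1 + \<delta> / 2) * L) * exp ((5 + 2 * \<theta>) * L) = exp ((4 + 2 * \<theta> - \<delta> / 2) * L - 13) * exp 13"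
        by (simp add: algebra_simps flip: exp_add)
      then have "exp (- (1 + \<delta> / 2) * L) = exp ((4 + 2 * \<theta> - \<delta> / 2) * L - 13) * exp 13 / exp ((5 + 2 * \<theta>) * L)"
        by (simp add: nonzero_eq_divide_eq)
      then show ?thesis using KL c L by (simp add: R_def mult_ac)
    qed
    also have "\<dots> \<le> c ^ 6 / (5 * 10 ^ 17 * K ^ 3) * exp X / exp ((5 + 2 * \<theta>) * L) * (real F ^ 2 * (E1 * E2))"
      using FE KL c by (intro mult_left_mono) auto
    also have "\<dots> = c ^ 6 / (5 * 10 ^ 17 * K ^ 3) * real F ^ 2 * exp X / (X ^ 5 * V ^ 2) * (E1 * E2)"
      unfolding XV by simp
    also have "\<dots> \<le> real (V_phi_sigma (exp X))" using main unfolding E1_def E2_def .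
    finally show ?case by (simp add: X_def)
  qed
qed

theorem theorem1:
  assumes "Hypothesis_UL"
  shows "\<exists>\<epsilon> :: real \<Rightarrow> real. (\<epsilon> \<longlongrightarrow> 0) at_top \<and>
           (\<forall>\<^sub>F x in at_top. real (V_phi_sigma x) \<ge> x / ln x powr (1 + \<epsilon> x))"
proof -
  have ev: "\<forall>\<^sub>F x in at_top. real (V_phi_sigma x) \<ge> x / ln x powr (1 + \<delta>)" if \<delta>: "0 < \<delta>" "\<delta> \<le> 1" for \<delta>
  proof -
    have "filterlim (\<lambda>x. ln (ln x)) at_top (at_top :: real filter)"
      by (rule filterlim_compose[OF ln_at_top ln_at_top])
    from eventually_compose_filterlim[OF V_phi_sigma_eventually[OF assms \<delta>] this]
    have "\<forall>\<^sub>F x in at_top. real (V_phi_sigma (exp (exp (ln (ln x))))) \<ge> exp (exp (ln (ln x))) * exp (- (1 + \<delta>) * ln (ln x))" .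
    then show ?thesis using eventually_gt_at_top[of 1]
    proof eventually_elim
      case (elim x)
      have "exp (exp (ln (ln x))) = x" using elim(2) by simp
      moreover have "x / ln x powr (1 + \<delta>) = x * exp (- (1 + \<delta>) * ln (ln x))"
        using elim(2) by (simp add: powr_def divide_inverse algebra_simps flip: exp_minus)
      ultimately show ?case using elim(1) by simp
    qed
  qed
  \<comment> \<open>\<open>1 + \<rho> x\<close> is the exponent at which the bound becomes an
    equality. It need not approach 1 from below, so \<open>\<epsilon>\<close> takes the positive
    part; a larger exponent only weakens the bound, as \<open>ln x > 1\<close>.\<close>
  define \<rho> where "\<rho> x = ln (x / real (V_phi_sigma x)) / ln (ln x) - 1" for x
  define \<epsilon> where "\<epsilon> x = max 0 (\<rho> x)" for x
  have *: "\<forall>\<^sub>F x in at_top. \<rho> x \<le> \<delta> \<and> real (V_phi_sigma x) \<ge> x / ln x powr (1 + \<epsilon> x)"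
    if \<delta>: "0 < \<delta>" "\<delta> \<le> 1" for \<delta>
    using ev[OF \<delta>] eventually_gt_at_top[of "exp 1"]
  proof eventually_elim
    case (elim x)
    have x: "x > 0" "ln x > 1"
    proof -
      show "x > 0" using elim(2) exp_gt_zero[of "1::real"] by linarith
      then have "ln (exp 1) < ln x" using elim(2) by (subst ln_less_cancel_iff) auto
      then show "ln x > 1" by simp
    qed
    have l: "ln (ln x) > 0" by (rule ln_gt_zero[OF x(2)])
    define W where "W = real (V_phi_sigma x)"
    have nz: "ln x \<noteq> 0" using x(2) by linarith
    then have pw: "ln x powr a > 0" for a by (simp only: powr_gt_zero not_False_eq_True)
    have "x / ln x powr (1 + \<delta>) > 0" by (rule divide_pos_pos[OF x(1) pw])
    then have W: "W > 0" using elim(1) unfolding W_def by linarith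
    have "x \<le> W * ln x powr (1 + \<delta>)"
      using elim(1) unfolding W_def [symmetric] by (simp only: pos_divide_le_eq[OF pw])
    then have "x / W \<le> ln x powr (1 + \<delta>)"
      by (simp only: pos_divide_le_eq[OF W] mult.commute)
    then have "ln (x / W) \<le> ln (ln x powr (1 + \<delta>))" using x W by (intro ln_mono) auto
    also have "\<dots> = (1 + \<delta>) * ln (ln x)" using x by (simp add: ln_powr)
    finally have 1: "\<rho> x \<le> \<delta>" unfolding \<rho>_def W_def [symmetric] using l by (simp add: field_simps)
    have "(1 + \<rho> x) * ln (ln x) = ln (x / W)"
      unfolding \<rho>_def W_def [symmetric] using l by simp
    then have "ln x powr (1 + \<rho> x) = exp (ln (x / W))" by (simp only: powr_def nz if_False)
    also have "\<dots> = x / W" using x W by simp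
    finally have "x / W \<le> ln x powr (1 + \<epsilon> x)"
      using x unfolding \<epsilon>_def by (metis add_left_mono le_less max.cobounded2 powr_mono)
    then have "x \<le> W * ln x powr (1 + \<epsilon> x)" by (simp only: pos_divide_le_eq[OF W] mult.commute)
    then have "x / ln x powr (1 + \<epsilon> x) \<le> W" by (simp only: pos_divide_le_eq[OF pw])
    then show ?case using 1 by (simp add: W_def)
  qed
  have "(\<epsilon> \<longlongrightarrow> 0) at_top"
  proof (rule tendstoI)
    fix e :: real assume e: "e > 0"
    have "\<forall>\<^sub>F x in at_top. \<rho> x \<le> min 1 (e / 2) \<and> real (V_phi_sigma x) \<ge> x / ln x powr (1 + \<epsilon> x)"
      by (rule *) (use e in auto)
    then show "\<forall>\<^sub>F x in at_top. dist (\<epsilon> x) 0 < e"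
    proof eventually_elim
      case (elim x)
      then show ?case using e by (simp add: \<epsilon>_def max_def)
    qed
  qed
  moreover have "\<forall>\<^sub>F x in at_top. real (V_phi_sigma x) \<ge> x / ln x powr (1 + \<epsilon> x)"
    using *[of 1] by (auto elim: eventually_mono)
  ultimately show ?thesis by blast
qed

end
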